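(* Let $f:E\to X$ be a fibrewise pointed map over $B$ between pointed fibrant and cofibrant spaces over $B$. Suppose that $B$ is a CW-complex, $X$ is a paracompact Hausdorff space, and: (i) $f:E\to X$ is a $k$-equivalence for some $k\ge0$; (ii) $\dim(B)<(\mathrm{secat}_B(f)+1)(k+1)-1$. Then $\mathrm{secat}_B(f)=\mathrm{secat}^B_B(f)$.
   Context: Fibrewise space over $B$: a space $X$ with a map $p_X:X\to B$; fibrewise pointed space: with a section $s_X:B\to X$ of $p_X$; fibrewise pointed map: $p_Yf=p_X$ and $fs_X=s_Y$. A pointed fibrant and cofibrant space over $B$ is a fibrewise pointed space with $p_X$ a Hurewicz fibration and $s_X$ a closed cofibration (in the ordinary sense). A fibrewise homotopy is a homotopy $H$ with $p_Y(H(x,t))=p_X(x)$ for all $t$ ($\simeq_B$); it is fibrewise pointed if moreover $H(s_X(b),t)=s_Y(b)$ ($\simeq^B_B$). A $k$-equivalence is a map inducing bijections on $\pi_i$ for $i<k$ and a surjection on $\pi_k$ for all basepoints. $\mathrm{secat}_B(f)$: least $n$ such that $X$ is covered by $n+1$ open sets $U$ each with a fibrewise map $s:U\to E$, $fs\simeq_B$ the inclusion $U\hookrightarrow X$. $\mathrm{secat}^B_B(f)$: least $n$ such that $X$ is covered by $n+1$ open sets $U\supseteq s_X(B)$ each with a fibrewise pointed map $s:U\to E$, $fs\simeq^B_B$ the inclusion. Both are $\infty$ if no such $n$ exists. *)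

theory Defs
  imports "HOL-Analysis.Analysis" "HOL-Library.Extended_Nat"
begin

definition HLP_wrt :: "'z topology \<Rightarrow> 'e topology \<Rightarrow> 'b topology \<Rightarrow> ('e \<Rightarrow> 'b) \<Rightarrow> bool" where
  "HLP_wrt Z E B p \<longleftrightarrow>
     (\<forall>g H. continuous_map Z E g \<and>
            continuous_map (prod_topology Z (top_of_set {0..1::real})) B H \<and>
            (\<forall>z\<in>topspace Z. H (z, 0) = p (g z))
        \<longrightarrow> (\<exists>G. continuous_map (prod_topology Z (top_of_set {0..1::real})) E G \<and>
                 (\<forall>z\<in>topspace Z. \<forall>t\<in>{0..1}. p (G (z, t)) = H (z, t)) \<and>
                 (\<forall>z\<in>topspace Z. G (z, 0) = g z)))"

text \<open>Hurewicz fibration: HLP with respect to all test spaces.  Since a definition cannot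
  quantify over types, the test spaces range over all topologies on the type
  'e \<times> (real \<Rightarrow> 'b), which is large enough to carry (a homeomorphic copy of)
  the path space E \<times>_B B^I, and HLP for that single space implies HLP for all spaces.\<close>
definition hurewicz_fibration :: "'e topology \<Rightarrow> 'b topology \<Rightarrow> ('e \<Rightarrow> 'b) \<Rightarrow> bool" where
  "hurewicz_fibration E B p \<longleftrightarrow>
     continuous_map E B p \<and> (\<forall>Z :: ('e \<times> (real \<Rightarrow> 'b)) topology. HLP_wrt Z E B p)"

definition HEP_wrt :: "'y topology \<Rightarrow> 'a topology \<Rightarrow> 'x topology \<Rightarrow> ('a \<Rightarrow> 'x) \<Rightarrow> bool" where
  "HEP_wrt Y A X i \<longleftrightarrow>
     (\<forall>g H. continuous_map X Y g \<and>
            continuous_map (prod_topology A (top_of_set {0..1::real})) Y H \<and>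
            (\<forall>a\<in>topspace A. H (a, 0) = g (i a))
        \<longrightarrow> (\<exists>G. continuous_map (prod_topology X (top_of_set {0..1::real})) Y G \<and>
                 (\<forall>x\<in>topspace X. G (x, 0) = g x) \<and>
                 (\<forall>a\<in>topspace A. \<forall>t\<in>{0..1}. G (i a, t) = H (a, t))))"

text \<open>Closed cofibration: continuous map with closed image having the HEP with respect to
  all spaces; test spaces range over all topologies on 'x + 'a \<times> real, large enough to
  carry (a homeomorphic copy of) the mapping cylinder of i.\<close>
definition closed_cofibration :: "'a topology \<Rightarrow> 'x topology \<Rightarrow> ('a \<Rightarrow> 'x) \<Rightarrow> bool" where
  "closed_cofibration A X i \<longleftrightarrow>
     continuous_map A X i \<and> closedin X (i ` topspace A) \<and>
     (\<forall>Y :: ('x + 'a \<times> real) topology. HEP_wrt Y A X i)"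

definition fibrewise_pointed_space :: "'x topology \<Rightarrow> 'b topology \<Rightarrow> ('x \<Rightarrow> 'b) \<Rightarrow> ('b \<Rightarrow> 'x) \<Rightarrow> bool" where
  "fibrewise_pointed_space X B p s \<longleftrightarrow>
     continuous_map X B p \<and> continuous_map B X s \<and> (\<forall>b\<in>topspace B. p (s b) = b)"

definition pointed_fibrant_cofibrant :: "'x topology \<Rightarrow> 'b topology \<Rightarrow> ('x \<Rightarrow> 'b) \<Rightarrow> ('b \<Rightarrow> 'x) \<Rightarrow> bool" where
  "pointed_fibrant_cofibrant X B p s \<longleftrightarrow>
     fibrewise_pointed_space X B p s \<and> hurewicz_fibration X B p \<and> closed_cofibration B X s"

definition fibrewise_pointed_map ::
  "'e topology \<Rightarrow> 'x topology \<Rightarrow> 'b topology \<Rightarrow> ('e \<Rightarrow> 'b) \<Rightarrow> ('b \<Rightarrow> 'e) \<Rightarrow>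
   ('x \<Rightarrow> 'b) \<Rightarrow> ('b \<Rightarrow> 'x) \<Rightarrow> ('e \<Rightarrow> 'x) \<Rightarrow> bool" where
  "fibrewise_pointed_map E X B pE sE pX sX f \<longleftrightarrow>
     continuous_map E X f \<and> (\<forall>e\<in>topspace E. pX (f e) = pE e) \<and>
     (\<forall>b\<in>topspace B. f (sE b) = sX b)"

definition sphere_base :: "nat \<Rightarrow> real" where
  "sphere_base = (\<lambda>j. if j = 0 then 1 else 0)"

definition pointed_sphere_map :: "nat \<Rightarrow> 'y topology \<Rightarrow> 'y \<Rightarrow> ((nat \<Rightarrow> real) \<Rightarrow> 'y) \<Rightarrow> bool" where
  "pointed_sphere_map i Y y g \<longleftrightarrow> continuous_map (nsphere i) Y g \<and> g sphere_base = y"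

definition pointed_homotopic :: "nat \<Rightarrow> 'y topology \<Rightarrow> 'y \<Rightarrow> ((nat \<Rightarrow> real) \<Rightarrow> 'y) \<Rightarrow> ((nat \<Rightarrow> real) \<Rightarrow> 'y) \<Rightarrow> bool" where
  "pointed_homotopic i Y y g g' \<longleftrightarrow> homotopic_with (\<lambda>h. h sphere_base = y) (nsphere i) Y g g'"

definition pi_injective :: "nat \<Rightarrow> 'e topology \<Rightarrow> 'x topology \<Rightarrow> ('e \<Rightarrow> 'x) \<Rightarrow> 'e \<Rightarrow> bool" where
  "pi_injective i E X f e \<longleftrightarrow>
     (\<forall>g g'. pointed_sphere_map i E e g \<and> pointed_sphere_map i E e g' \<and>
             pointed_homotopic i X (f e) (f \<circ> g) (f \<circ> g') \<longrightarrow> pointed_homotopic i E e g g')"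

definition pi_surjective :: "nat \<Rightarrow> 'e topology \<Rightarrow> 'x topology \<Rightarrow> ('e \<Rightarrow> 'x) \<Rightarrow> 'e \<Rightarrow> bool" where
  "pi_surjective i E X f e \<longleftrightarrow>
     (\<forall>h. pointed_sphere_map i X (f e) h \<longrightarrow>
          (\<exists>g. pointed_sphere_map i E e g \<and> pointed_homotopic i X (f e) (f \<circ> g) h))"

definition k_equivalence :: "nat \<Rightarrow> 'e topology \<Rightarrow> 'x topology \<Rightarrow> ('e \<Rightarrow> 'x) \<Rightarrow> bool" where
  "k_equivalence k E X f \<longleftrightarrow>
     continuous_map E X f \<and>
     (\<forall>e\<in>topspace E.
        (\<forall>i<k. pi_injective i E X f e \<and> pi_surjective i E X f e) \<and> pi_surjective k E X f e)"

definition ndisc :: "nat \<Rightarrow> (nat \<Rightarrow> real) topology" where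
  "ndisc n = subtopology (Euclidean_space n) {x. (\<Sum>i<n. x i ^ 2) \<le> 1}"

definition cw_structure ::
  "'b topology \<Rightarrow> 'b set set \<Rightarrow> ('b set \<Rightarrow> nat) \<Rightarrow> ('b set \<Rightarrow> (nat \<Rightarrow> real) \<Rightarrow> 'b) \<Rightarrow> bool" where
  "cw_structure B cells d \<Phi> \<longleftrightarrow>
     Hausdorff_space B \<and>
     \<Union>cells = topspace B \<and> {} \<notin> cells \<and> pairwise disjnt cells \<and>
     (\<forall>c\<in>cells.
        continuous_map (ndisc (d c)) B (\<Phi> c) \<and>
        homeomorphic_map (subtopology (ndisc (d c)) {x. (\<Sum>i<d c. x i ^ 2) < 1})
                         (subtopology B c) (\<Phi> c) \<and>
        \<Phi> c ` {x \<in> topspace (ndisc (d c)). (\<Sum>i<d c. x i ^ 2) = 1}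
          \<subseteq> \<Union>{c'\<in>cells. d c' < d c} \<and>
        finite {c'\<in>cells. c' \<inter> \<Phi> c ` topspace (ndisc (d c)) \<noteq> {}}) \<and>
     (\<forall>A. A \<subseteq> topspace B \<and>
          (\<forall>c\<in>cells. closedin (subtopology B (\<Phi> c ` topspace (ndisc (d c))))
                                (A \<inter> \<Phi> c ` topspace (ndisc (d c))))
          \<longrightarrow> closedin B A)"

definition CW_complex :: "'b topology \<Rightarrow> bool" where
  "CW_complex B \<longleftrightarrow> (\<exists>cells d \<Phi>. cw_structure B cells d \<Phi>)"

definition cw_dim :: "'b topology \<Rightarrow> enat" where
  "cw_dim B = Inf (enat ` {n. \<exists>cells d \<Phi>. cw_structure B cells d \<Phi> \<and> (\<forall>c\<in>cells. d c \<le> n)})"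

definition paracompact_space :: "'a topology \<Rightarrow> bool" where
  "paracompact_space X \<longleftrightarrow>
     (\<forall>\<U>. (\<forall>U\<in>\<U>. openin X U) \<and> topspace X \<subseteq> \<Union>\<U> \<longrightarrow>
        (\<exists>\<V>. (\<forall>V\<in>\<V>. openin X V) \<and> topspace X \<subseteq> \<Union>\<V> \<and> (\<forall>V\<in>\<V>. \<exists>U\<in>\<U>. V \<subseteq> U) \<and>
             (\<forall>x\<in>topspace X. \<exists>N. openin X N \<and> x \<in> N \<and> finite {V\<in>\<V>. V \<inter> N \<noteq> {}})))"

definition secat_B :: "'e topology \<Rightarrow> 'x topology \<Rightarrow> ('e \<Rightarrow> 'b) \<Rightarrow> ('x \<Rightarrow> 'b) \<Rightarrow> ('e \<Rightarrow> 'x) \<Rightarrow> enat" where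
  "secat_B E X pE pX f = Inf (enat ` {n. \<exists>U :: nat \<Rightarrow> 'x set.
      (\<forall>i\<le>n. openin X (U i)) \<and> topspace X \<subseteq> (\<Union>i\<le>n. U i) \<and>
      (\<forall>i\<le>n. \<exists>s. continuous_map (subtopology X (U i)) E s \<and>
                  (\<forall>x\<in>U i. pE (s x) = pX x) \<and>
                  homotopic_with (\<lambda>h. \<forall>x\<in>U i. pX (h x) = pX x)
                     (subtopology X (U i)) X (f \<circ> s) id)})"

definition secat_B_pointed ::
  "'b topology \<Rightarrow> 'e topology \<Rightarrow> 'x topology \<Rightarrow> ('e \<Rightarrow> 'b) \<Rightarrow> ('b \<Rightarrow> 'e) \<Rightarrow>
   ('x \<Rightarrow> 'b) \<Rightarrow> ('b \<Rightarrow> 'x) \<Rightarrow> ('e \<Rightarrow> 'x) \<Rightarrow> enat" where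
  "secat_B_pointed B E X pE sE pX sX f = Inf (enat ` {n. \<exists>U :: nat \<Rightarrow> 'x set.
      (\<forall>i\<le>n. openin X (U i) \<and> sX ` topspace B \<subseteq> U i) \<and> topspace X \<subseteq> (\<Union>i\<le>n. U i) \<and>
      (\<forall>i\<le>n. \<exists>s. continuous_map (subtopology X (U i)) E s \<and>
                  (\<forall>x\<in>U i. pE (s x) = pX x) \<and>
                  (\<forall>b\<in>topspace B. s (sX b) = sE b) \<and>
                  homotopic_with (\<lambda>h. (\<forall>x\<in>U i. pX (h x) = pX x) \<and>
                                      (\<forall>b\<in>topspace B. h (sX b) = sX b))
                     (subtopology X (U i)) X (f \<circ> s) id)})"

end

theory Submission
  imports Defs
begin

text \<open>Replace \<open>f\<close> by the fibration \<open>P \<rightarrow> X\<close> of its fibrewise mapping paths.  A cover of \<open>X\<close> by \<open>n + 1\<close>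
  open sets with sections of \<open>f\<close> up to fibrewise homotopy is a section of the \<open>(n + 1)\<close>-fold fibrewise
  join \<open>J \<rightarrow> X\<close> of \<open>P\<close>, and it is a pointed one if and only if this section restricts on \<open>s\<^sub>X B\<close> to the
  one given by \<open>s\<^sub>E\<close>.  Since \<open>f\<close> is a \<open>k\<close>-equivalence, the fibres of \<open>P\<close> over \<open>s\<^sub>X B\<close> are
  \<open>(k - 1)\<close>-connected, so those of \<open>J\<close> are \<open>((n + 1)(k + 1) - 2)\<close>-connected.  As \<open>B\<close> has at most that
  dimension, any two lifts of \<open>s\<^sub>X\<close> to \<open>J\<close> are homotopic over \<open>X\<close>, and since \<open>s\<^sub>X\<close> is a closed
  cofibration and \<open>J \<rightarrow> X\<close> a fibration, the homotopy extends to one of sections over all of \<open>X\<close>.\<close>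

section \<open>Path spaces and the homotopy lifting property\<close>

text \<open>Put r = (n + 1)(k + 1) - 1. A cell of B of dimension at most r - 1 gives a cell of
  dimension at most r in B x [0,1]; its boundary sphere has dimension at most r - 1, and this is the
  last degree in which (r - 1)-connected fibres can be filled. So the bound on the dimension of B
  leaves exactly enough room. The connectivity of joins is the laborious point, as it has to hold
  for arbitrary topological spaces. A map of a sphere into the join of two spaces is a pair of
  partial maps whose open domains cover the sphere. For factors that are (a - 1)- and (c -
  1)-connected, each partial map is extended, after a small homotopy, over a neighbourhood of the
  a-skeleton, respectively c-skeleton, of one of two interleaved cubical grids. The two
  neighbourhoods together cover a cube of dimension at most a + c + 1, so the join is (a +
  c)-connected. Iterating this produces (n + 1)(k + 1) - 2. Arbitrary spaces also explain the use of
  path spaces: with the compact-open topology, currying and evaluation along the compact interval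
  are continuous without any condition on the parameter space.\<close>

abbreviation cyl :: "'a topology \<Rightarrow> ('a \<times> real) topology" where
  "cyl Z \<equiv> prod_topology Z (top_of_set {0..1})"

lemma continuous_map_glue_closed:
  assumes "closedin Z A" "closedin Z C" "topspace Z \<subseteq> A \<union> C"
    and "continuous_map (subtopology Z A) Y h" "continuous_map (subtopology Z C) Y h"
  shows "continuous_map Z Y h"
  by (rule pasting_lemma_closed[where I = UNIV and T = "\<lambda>b. if b then A else C" and f = "\<lambda>_. h"])
     (use assms in \<open>auto simp: UNIV_bool\<close>)

lemma continuous_map_glue_open:
  assumes "\<And>x. x \<in> topspace Z \<Longrightarrow> \<exists>U. openin Z U \<and> x \<in> U \<and> continuous_map (subtopology Z U) Y h"
  shows "continuous_map Z Y h"
  by (rule pasting_lemma[where I = "{U. openin Z U \<and> continuous_map (subtopology Z U) Y h}"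
        and T = id and f = "\<lambda>_. h"])
     (use assms in auto)

lemma continuous_map_compose':
  assumes "continuous_map Z X f" "continuous_map X Y g"
  shows "continuous_map Z Y (\<lambda>z. g (f z))"
  using continuous_map_compose[OF assms] by (simp add: o_def)

lemma continuous_map_slice:
  assumes "continuous_map (prod_topology Z T) Y H" "t \<in> topspace T"
  shows "continuous_map Z Y (\<lambda>z. H (z, t))"
  by (rule continuous_map_compose'[OF _ assms(1)]) (intro continuous_map_pairedI, use assms in auto)

lemma continuous_map_fst_sub: "continuous_map (subtopology (prod_topology X Y) A) X fst"
  by (intro continuous_map_from_subtopology continuous_map_fst)

lemma continuous_map_snd_sub: "continuous_map (subtopology (prod_topology X Y) A) Y snd"
  by (intro continuous_map_from_subtopology continuous_map_snd)

lemma compact_space_unit_interval: "compact_space (top_of_set {0..1::real})"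
  by (simp add: compact_space_subtopology)

lemma unit_interval_real:
  "continuous_map Z (top_of_set {0..1::real}) u \<longleftrightarrow>
     continuous_map Z euclideanreal u \<and> (\<forall>z\<in>topspace Z. 0 \<le> u z \<and> u z \<le> 1)"
  by (auto simp: continuous_map_in_subtopology)

lemma unit_interval_realD:
  "continuous_map Z (top_of_set {0..1::real}) u \<Longrightarrow> continuous_map Z euclideanreal u"
  by (simp add: unit_interval_real)

text \<open>The compact-open topology, since closed subsets of the interval are compact. Paths are
  extensional outside [0,1], so that equality of functions is equality of paths.\<close>

definition path_space :: "'y topology \<Rightarrow> (real \<Rightarrow> 'y) topology" where
  "path_space Y = subtopology
     (topology_generated_by {{\<gamma>. \<gamma> ` K \<subseteq> W} | K W. closed K \<and> K \<subseteq> {0..1} \<and> openin Y W})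
     {\<gamma>. continuous_map (top_of_set {0..1}) Y \<gamma> \<and> \<gamma> \<in> extensional {0..1}}"

lemma topspace_path_space:
  "topspace (path_space Y) = {\<gamma>. continuous_map (top_of_set {0..1}) Y \<gamma> \<and> \<gamma> \<in> extensional {0..1}}"
proof -
  have "UNIV \<in> {{\<gamma>::real \<Rightarrow> 'a. \<gamma> ` K \<subseteq> W} | K W. closed K \<and> K \<subseteq> {0..1} \<and> openin Y W}"
    by (rule CollectI, rule exI[of _ "{}"], rule exI[of _ "{}"]) auto
  then show ?thesis
    unfolding path_space_def topspace_subtopology topology_generated_by_topspace by blast
qed

lemma openin_path_space:
  assumes "closed K" "K \<subseteq> {0..1}" "openin Y W"
  shows "openin (path_space Y) {\<gamma> \<in> topspace (path_space Y). \<gamma> ` K \<subseteq> W}"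
proof -
  have "openin (topology_generated_by {{\<gamma>. \<gamma> ` K \<subseteq> W} | K W. closed K \<and> K \<subseteq> {0..1} \<and> openin Y W})
          {\<gamma>. \<gamma> ` K \<subseteq> W}"
    by (rule topology_generated_by_Basis) (use assms in auto)
  then have "openin (path_space Y) ({\<gamma>. \<gamma> ` K \<subseteq> W} \<inter>
      {\<gamma>. continuous_map (top_of_set {0..1}) Y \<gamma> \<and> \<gamma> \<in> extensional {0..1}})"
    unfolding path_space_def by (rule openin_subtopology_Int)
  then show ?thesis
    by (rule back_subst[of "openin _"]) (auto simp: topspace_path_space)
qed

text \<open>Evaluation is jointly continuous because the interval is locally compact: a path that
  sends t into W sends a whole closed neighbourhood K of t into W, and K defines a subbasic
  set.\<close>

lemma path_space_eval: "continuous_map (cyl (path_space Y)) Y (\<lambda>(\<gamma>, t). \<gamma> t)"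
  unfolding continuous_map_def
proof (intro conjI allI impI)
  show "(\<lambda>(\<gamma>, t). \<gamma> t) \<in> topspace (cyl (path_space Y)) \<rightarrow> topspace Y"
    by (auto simp: topspace_path_space continuous_map_def)
next
  fix W assume W: "openin Y W"
  show "openin (cyl (path_space Y)) {x \<in> topspace (cyl (path_space Y)). (case x of (\<gamma>, t) \<Rightarrow> \<gamma> t) \<in> W}"
    unfolding openin_prod_topology_alt
  proof (intro allI impI)
    fix \<gamma> :: "real \<Rightarrow> 'a" and t :: real
    assume "(\<gamma>, t) \<in> {x \<in> topspace (cyl (path_space Y)). (case x of (\<gamma>, t) \<Rightarrow> \<gamma> t) \<in> W}"
    then have \<gamma>: "\<gamma> \<in> topspace (path_space Y)" "continuous_map (top_of_set {0..1}) Y \<gamma>"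
      and t: "t \<in> {0..1}" "\<gamma> t \<in> W"
      by (auto simp: topspace_path_space)
    have "openin (top_of_set {0..1}) {s \<in> {0..1}. \<gamma> s \<in> W}"
      using openin_continuous_map_preimage[OF \<gamma>(2) W] by simp
    then obtain e where e: "e > 0" "\<And>s. s \<in> {0..1} \<Longrightarrow> dist s t < e \<Longrightarrow> \<gamma> s \<in> W"
      unfolding openin_euclidean_subtopology_iff using t by blast
    define K where "K = cball t (e/2) \<inter> {0..1}"
    have K: "closed K" "K \<subseteq> {0..1}" "\<gamma> ` K \<subseteq> W"
      using e by (auto simp: K_def dist_commute)
    show "\<exists>U V. openin (path_space Y) U \<and> openin (top_of_set {0..1}) V \<and> \<gamma> \<in> U \<and> t \<in> V \<and>
          U \<times> V \<subseteq> {x \<in> topspace (cyl (path_space Y)). (case x of (\<gamma>, t) \<Rightarrow> \<gamma> t) \<in> W}"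
    proof (intro exI conjI)
      show "openin (path_space Y) {\<gamma> \<in> topspace (path_space Y). \<gamma> ` K \<subseteq> W}"
        by (rule openin_path_space[OF K(1,2) W])
      show "openin (top_of_set {0..1}) ({0..1} \<inter> ball t (e/2))" by auto
      show "\<gamma> \<in> {\<gamma> \<in> topspace (path_space Y). \<gamma> ` K \<subseteq> W}" using \<gamma> K by auto
      show "t \<in> {0..1} \<inter> ball t (e/2)" using t e by auto
      show "{\<gamma> \<in> topspace (path_space Y). \<gamma> ` K \<subseteq> W} \<times> ({0..1} \<inter> ball t (e/2))
          \<subseteq> {x \<in> topspace (cyl (path_space Y)). (case x of (\<gamma>, t) \<Rightarrow> \<gamma> t) \<in> W}"
        by (auto simp: K_def)
    qed
  qed
qed

lemma path_space_eval_compose: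
  assumes "continuous_map Z (path_space Y) \<gamma>" "continuous_map Z (top_of_set {0..1}) u"
  shows "continuous_map Z Y (\<lambda>z. \<gamma> z (u z))"
  using continuous_map_compose'[OF continuous_map_pairedI[OF assms] path_space_eval] by simp

text \<open>The points of Z whose path leaves W at some time in K form the projection of a closed
  subset of Z x [0,1], and this projection is a closed map because the interval is compact. So Z may
  be any space.\<close>

lemma path_space_curry:
  assumes H: "continuous_map (cyl Z) Y H"
  shows "continuous_map Z (path_space Y) (\<lambda>z. restrict (\<lambda>t. H (z, t)) {0..1})"
  unfolding path_space_def continuous_map_in_subtopology continuous_on_generated_topo_iff
proof (intro conjI allI impI)
  fix U assume "U \<in> {{\<gamma>::real \<Rightarrow> 'b. \<gamma> ` K \<subseteq> W} | K W. closed K \<and> K \<subseteq> {0..1} \<and> openin Y W}"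
  then obtain K W where K: "closed K" "K \<subseteq> {0..1}" "openin Y W" and U: "U = {\<gamma>. \<gamma> ` K \<subseteq> W}"
    by blast
  have c: "closedin (cyl Z) {x \<in> topspace (cyl Z). H x \<in> topspace Y - W}"
    by (rule closedin_continuous_map_preimage[OF H]) (use K in auto)
  have "closedin (cyl Z) (topspace Z \<times> K)"
    using closed_subset[OF K(2,1)] unfolding closedin_prod_Times_iff by simp
  with c have "closedin (cyl Z) ({x \<in> topspace (cyl Z). H x \<in> topspace Y - W} \<inter> topspace Z \<times> K)"
    by (rule closedin_Int)
  then have "closedin Z (fst ` ({x \<in> topspace (cyl Z). H x \<in> topspace Y - W} \<inter> topspace Z \<times> K))"
    using closed_map_fst[OF compact_space_unit_interval, of Z] by (simp add: closed_map_def)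
  then have "openin Z (topspace Z - fst ` ({x \<in> topspace (cyl Z). H x \<in> topspace Y - W} \<inter> topspace Z \<times> K))"
    by blast
  moreover have "topspace Z - fst ` ({x \<in> topspace (cyl Z). H x \<in> topspace Y - W} \<inter> topspace Z \<times> K)
      = (\<lambda>z. restrict (\<lambda>t. H (z, t)) {0..1}) -` U \<inter> topspace Z"
    (is "topspace Z - fst ` ?C = ?R")
  proof
    show "topspace Z - fst ` ?C \<subseteq> ?R"
    proof
      fix z assume z: "z \<in> topspace Z - fst ` ?C"
      have "H (z, t) \<in> W" if "t \<in> K" for t
      proof (rule ccontr)
        assume "H (z, t) \<notin> W"
        then have "(z, t) \<in> ?C" using z that K(2) continuous_map_funspace[OF H] by auto
        then have "fst (z, t) \<in> fst ` ?C" by (rule imageI)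
        then show False using z by simp
      qed
      then show "z \<in> ?R" using z K(2) by (auto simp: U)
    qed
    show "?R \<subseteq> topspace Z - fst ` ?C" using K(2) by (auto simp: U image_subset_iff)
  qed
  ultimately show "openin Z ((\<lambda>z. restrict (\<lambda>t. H (z, t)) {0..1}) -` U \<inter> topspace Z)"
    by simp
next
  show "(\<lambda>z. restrict (\<lambda>t. H (z, t)) {0..1}) ` topspace Z
      \<subseteq> \<Union>{{\<gamma>::real \<Rightarrow> 'b. \<gamma> ` K \<subseteq> W} | K W. closed K \<and> K \<subseteq> {0..1} \<and> openin Y W}"
    by (rule image_subsetI, rule UnionI[of UNIV], rule CollectI, rule exI[of _ "{}"], rule exI[of _ "{}"]) auto
next
  have "continuous_map (top_of_set {0..1}) Y (\<lambda>t. H (z, t))" if "z \<in> topspace Z" for z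
    by (rule continuous_map_compose'[OF _ H]) (intro continuous_map_pairedI, use that in auto)
  then show "(\<lambda>z. restrict (\<lambda>t. H (z, t)) {0..1})
      \<in> topspace Z \<rightarrow> {\<gamma>. continuous_map (top_of_set {0..1}) Y \<gamma> \<and> \<gamma> \<in> extensional {0..1}}"
    by (intro funcsetI CollectI conjI restrict_extensional) (rule continuous_map_eq, auto)
qed

text \<open>The tube lemma, read off from currying: the paths that stay in W are the subbasic set
  for K = [0,1].\<close>

lemma tube_open:
  assumes H: "continuous_map (cyl Z) Y H" and W: "openin Y W"
  shows "openin Z {z \<in> topspace Z. \<forall>t\<in>{0..1}. H (z, t) \<in> W}"
proof -
  have "openin Z {z \<in> topspace Z. restrict (\<lambda>t. H (z, t)) {0..1}
          \<in> {\<gamma> \<in> topspace (path_space Y). \<gamma> ` {0..1} \<subseteq> W}}"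
    by (rule openin_continuous_map_preimage[OF path_space_curry[OF H] openin_path_space[OF _ _ W]]) simp_all
  moreover have "restrict (\<lambda>t. H (z, t)) {0..1} \<in> topspace (path_space Y)" if "z \<in> topspace Z" for z
    using continuous_map_funspace[OF path_space_curry[OF H]] that by blast
  then have "{z \<in> topspace Z. restrict (\<lambda>t. H (z, t)) {0..1}
          \<in> {\<gamma> \<in> topspace (path_space Y). \<gamma> ` {0..1} \<subseteq> W}} = {z \<in> topspace Z. \<forall>t\<in>{0..1}. H (z, t) \<in> W}"
    by (auto simp: image_subset_iff)
  ultimately show ?thesis by simp
qed

text \<open>The space P of pairs of a point and a path starting at its image carries the universal
  lifting problem; every other one is its pullback along \<open>j\<close>. P lives on the type over
  which the definition quantifies, so Z may have any type.\<close>

lemma hurewicz_fibration_HLP: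
  fixes Z :: "'z topology"
  assumes fib: "hurewicz_fibration E B p"
  shows "HLP_wrt Z E B p"
  unfolding HLP_wrt_def
proof (intro allI impI)
  fix g :: "'z \<Rightarrow> _" and H
  assume asm: "continuous_map Z E g \<and> continuous_map (cyl Z) B H \<and> (\<forall>z\<in>topspace Z. H (z, 0) = p (g z))"
  define P where "P = subtopology (prod_topology E (path_space B)) {(e, \<gamma>). \<gamma> 0 = p e}"
  have "HLP_wrt P E B p" using fib unfolding hurewicz_fibration_def by blast
  moreover have "continuous_map P E fst" unfolding P_def by (rule continuous_map_fst_sub)
  moreover have "continuous_map (cyl P) B (\<lambda>(x, t). snd x t)"
  proof -
    have "continuous_map (cyl P) (path_space B) (\<lambda>x. snd (fst x))"
      by (rule continuous_map_compose'[OF continuous_map_fst]) (simp add: P_def continuous_map_snd_sub)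
    from path_space_eval_compose[OF this continuous_map_snd]
    show ?thesis by (simp add: case_prod_unfold)
  qed
  moreover have "\<forall>x\<in>topspace P. (\<lambda>(x, t). snd x t) (x, 0) = p (fst x)"
    by (auto simp: P_def)
  ultimately obtain G where G: "continuous_map (cyl P) E G"
    "\<forall>x\<in>topspace P. \<forall>t\<in>{0..1}. p (G (x, t)) = (\<lambda>(x, t). snd x t) (x, t)"
    "\<forall>x\<in>topspace P. G (x, 0) = fst x"
    unfolding HLP_wrt_def by blast
  define j where "j = (\<lambda>z. (g z, restrict (\<lambda>t. H (z, t)) {0..1}))"
  have j: "continuous_map Z P j"
    unfolding j_def P_def continuous_map_in_subtopology
    using asm by (auto intro!: continuous_map_pairedI path_space_curry)
  then have jt: "j z \<in> topspace P" if "z \<in> topspace Z" for z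
    using that by (auto simp: continuous_map_def)
  have "continuous_map (cyl Z) (cyl P) (\<lambda>x. (j (fst x), snd x))"
    by (intro continuous_map_pairedI continuous_map_compose'[OF continuous_map_fst j] continuous_map_snd)
  from continuous_map_compose'[OF this G(1)]
  have "continuous_map (cyl Z) E (\<lambda>x. G (j (fst x), snd x))" .
  moreover have "\<forall>z\<in>topspace Z. \<forall>t\<in>{0..1}. p (G (j z, t)) = H (z, t)"
    using G(2) jt by (force simp: j_def)
  moreover have "\<forall>z\<in>topspace Z. G (j z, 0) = g z"
    using G(3) jt by (force simp: j_def)
  ultimately show "\<exists>G. continuous_map (cyl Z) E G \<and>
      (\<forall>z\<in>topspace Z. \<forall>t\<in>{0..1}. p (G (z, t)) = H (z, t)) \<and> (\<forall>z\<in>topspace Z. G (z, 0) = g z)"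
    by (intro exI[of _ "\<lambda>x. G (j (fst x), snd x)"]) simp
qed

lemma HLP_lift:
  assumes "HLP_wrt Z E B p" "continuous_map Z E g" "continuous_map (cyl Z) B H"
    and "\<And>z. z \<in> topspace Z \<Longrightarrow> H (z, 0) = p (g z)"
  obtains G where "continuous_map (cyl Z) E G"
    and "\<And>z t. z \<in> topspace Z \<Longrightarrow> t \<in> {0..1} \<Longrightarrow> p (G (z, t)) = H (z, t)"
    and "\<And>z. z \<in> topspace Z \<Longrightarrow> G (z, 0) = g z"
  using assms unfolding HLP_wrt_def by blast

section \<open>Cofibred pairs and relative lifting\<close>

text \<open>Strom's description of a closed cofibration: a function vanishing exactly on A together
  with a retraction of the cylinder. Relative lifting needs the function in order to control the
  speed at which the retraction is run.\<close>

definition cofibred_pair :: "'z topology \<Rightarrow> 'z set \<Rightarrow> bool" where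
  "cofibred_pair Z A \<longleftrightarrow>
     (\<exists>u. continuous_map Z (top_of_set {0..1::real}) u \<and> A = {z \<in> topspace Z. u z = 0}) \<and>
     (\<exists>\<rho>. continuous_map (cyl Z) (cyl Z) \<rho> \<and>
          (\<forall>x\<in>topspace (cyl Z). \<rho> x \<in> topspace Z \<times> {0} \<union> A \<times> {0..1}) \<and>
          (\<forall>x\<in>topspace Z \<times> {0} \<union> A \<times> {0..1}. \<rho> x = x))"

text \<open>The strong deformation retraction onto \<open>D\<close> is run so fast near \<open>D\<close> that it arrives at
  \<open>w\<close> at time \<open>\<phi> w\<close>; evaluating the lifted homotopy at that time gives a lift that is
  unchanged on \<open>D\<close>.\<close>

lemma relative_lifting:
  fixes Z :: "'z topology"
  assumes fib: "hurewicz_fibration P X \<pi>" and cof: "cofibred_pair Z A"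
    and q: "continuous_map (cyl Z) X q"
    and D: "D = topspace Z \<times> {0} \<union> A \<times> {0..1}"
    and \<sigma>: "continuous_map (subtopology (cyl Z) D) P \<sigma>" "\<And>x. x \<in> D \<Longrightarrow> \<pi> (\<sigma> x) = q x"
  obtains \<sigma>' where "continuous_map (cyl Z) P \<sigma>'"
    and "\<And>x. x \<in> topspace (cyl Z) \<Longrightarrow> \<pi> (\<sigma>' x) = q x" and "\<And>x. x \<in> D \<Longrightarrow> \<sigma>' x = \<sigma> x"
proof -
  obtain u \<rho> where u: "continuous_map Z (top_of_set {0..1::real}) u" "A = {z \<in> topspace Z. u z = 0}"
    and \<rho>: "continuous_map (cyl Z) (cyl Z) \<rho>" "\<And>x. x \<in> topspace (cyl Z) \<Longrightarrow> \<rho> x \<in> D"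
      "\<And>x. x \<in> D \<Longrightarrow> \<rho> x = x"
    using cof unfolding cofibred_pair_def D[symmetric] by blast
  have DZ: "D \<subseteq> topspace (cyl Z)" using u by (auto simp: D)
  \<comment> \<open>As the smaller of the height and the function that vanishes on A, \<phi> is zero
    exactly on D.\<close>
  define \<phi> where "\<phi> = (\<lambda>w::'z \<times> real. min (snd w) (u (fst w)))"
  \<comment> \<open>A deformation from \<rho> at t = 0 to the identity at t = 1 that fixes D: the
    base coordinate follows \<rho> down the vertical segment to height 0, where \<rho> is the
    identity, and the height is interpolated linearly.\<close>
  define K where "K = (\<lambda>(w::'z \<times> real, t::real). (fst (\<rho> (fst w, snd w * (1 - t))), t * snd w + (1 - t) * snd (\<rho> w)))"
  \<comment> \<open>At speed 1 / \<phi> the deformation is complete at time \<phi>. On D, where K is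
    stationary, the jump of \<tau> does no harm.\<close>
  define \<tau> where "\<tau> = (\<lambda>(w, t::real). if \<phi> w = 0 then 1 else min 1 (t / \<phi> w))"
  have u01: "u z \<in> {0..1}" if "z \<in> topspace Z" for z using u(1) that by (auto simp: unit_interval_real)
  have \<rho>01: "\<rho> w \<in> topspace Z \<times> {0..1}" if "w \<in> topspace (cyl Z)" for w
    using \<rho>(2)[OF that] DZ by auto
  have cs: "continuous_map (cyl (cyl Z)) euclideanreal (\<lambda>x. snd (fst x))"
    by (rule unit_interval_realD)
       (rule continuous_map_compose'[OF continuous_map_fst continuous_map_snd])
  have ct: "continuous_map (cyl (cyl Z)) euclideanreal snd"
    by (rule unit_interval_realD) (rule continuous_map_snd)
  have Kc: "continuous_map (cyl (cyl Z)) (cyl Z) K"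
  proof -
    have "continuous_map (cyl (cyl Z)) (cyl Z) (\<lambda>x. (fst (fst x), snd (fst x) * (1 - snd x)))"
      by (intro continuous_map_pairedI continuous_map_compose'[OF continuous_map_fst continuous_map_fst])
         (auto simp: unit_interval_real mult_le_one intro!: continuous_intros cs ct)
    then have 1: "continuous_map (cyl (cyl Z)) Z (\<lambda>x. fst (\<rho> (fst (fst x), snd (fst x) * (1 - snd x))))"
      by (rule continuous_map_compose'[OF continuous_map_compose'[OF _ \<rho>(1)] continuous_map_fst])
    have 2: "continuous_map (cyl (cyl Z)) euclideanreal (\<lambda>x. snd (\<rho> (fst x)))"
      by (rule unit_interval_realD)
         (rule continuous_map_compose'[OF continuous_map_compose'[OF continuous_map_fst \<rho>(1)] continuous_map_snd])
    have "continuous_map (cyl (cyl Z)) (top_of_set {0..1})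
            (\<lambda>x. snd x * snd (fst x) + (1 - snd x) * snd (\<rho> (fst x)))"
      unfolding unit_interval_real
    proof (intro conjI ballI)
      show "continuous_map (cyl (cyl Z)) euclideanreal
         (\<lambda>x. snd x * snd (fst x) + (1 - snd x) * snd (\<rho> (fst x)))"
        by (intro continuous_intros cs ct 2)
      fix x assume x: "x \<in> topspace (cyl (cyl Z))"
      then have "snd (\<rho> (fst x)) \<in> {0..1}" "snd (fst x) \<in> {0..1}" "snd x \<in> {0..1}"
        using \<rho>01[of "fst x"] by auto
      then show "0 \<le> snd x * snd (fst x) + (1 - snd x) * snd (\<rho> (fst x))"
        "snd x * snd (fst x) + (1 - snd x) * snd (\<rho> (fst x)) \<le> 1"
        by (auto simp: convex_bound_le)
    qed
    with 1 have "continuous_map (cyl (cyl Z)) (cyl Z)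
       (\<lambda>x. (fst (\<rho> (fst (fst x), snd (fst x) * (1 - snd x))),
             snd x * snd (fst x) + (1 - snd x) * snd (\<rho> (fst x))))"
      by (rule continuous_map_pairedI)
    then show ?thesis by (simp add: K_def case_prod_unfold)
  qed
  have K0: "K (w, 0) = \<rho> w" if "w \<in> topspace (cyl Z)" for w
    by (simp add: K_def)
  have K1: "K (w, 1) = w" if "w \<in> topspace (cyl Z)" for w
  proof -
    have "(fst w, 0) \<in> D" using that by (auto simp: D)
    then show ?thesis using \<rho>(3)[of "(fst w, 0)"] by (simp add: K_def)
  qed
  have KD: "K (w, t) = w" if "w \<in> D" "t \<in> {0..1}" for w t
  proof -
    have w: "fst w \<in> topspace Z" "0 \<le> snd w" "snd w \<le> 1" "\<rho> w = w" "w \<in> topspace Z \<times> {0} \<union> A \<times> {0..1}"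
      using DZ that \<rho>(3) by (auto simp: D)
    then have "(fst w, snd w * (1 - t)) \<in> D"
      using that(2) unfolding D by (auto simp: mult_le_one)
    then have "\<rho> (fst w, snd w * (1 - t)) = (fst w, snd w * (1 - t))" by (rule \<rho>(3))
    then show ?thesis using w by (simp add: K_def algebra_simps)
  qed
  have \<phi>c: "continuous_map (cyl Z) (top_of_set {0..1}) \<phi>"
    unfolding unit_interval_real
  proof
    have "continuous_map (cyl Z) euclideanreal (\<lambda>x. u (fst x))"
      by (intro unit_interval_realD continuous_map_compose'[OF continuous_map_fst u(1)])
    then show "continuous_map (cyl Z) euclideanreal \<phi>"
      unfolding \<phi>_def
      by (intro continuous_intros unit_interval_realD[OF continuous_map_snd])
    show "\<forall>z\<in>topspace (cyl Z). 0 \<le> \<phi> z \<and> \<phi> z \<le> 1" using u01 by (auto simp: \<phi>_def)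
  qed
  have \<phi>D: "\<phi> w = 0 \<longleftrightarrow> w \<in> D" if "w \<in> topspace (cyl Z)" for w
    using that u u01[of "fst w"] by (cases w) (auto simp: \<phi>_def D min_def)
  have \<phi>01: "\<phi> w \<in> {0..1}" if "w \<in> topspace (cyl Z)" for w
    using \<phi>c that by (auto simp: unit_interval_real)
  have \<tau>01: "\<tau> (w, t) \<in> {0..1}" if "w \<in> topspace (cyl Z)" "t \<in> {0..1}" for w t
    using \<phi>01[OF that(1)] that(2) by (auto simp: \<tau>_def)
  define K' where "K' = (\<lambda>(w, t). K (w, \<tau> (w, t)))"
  have K'c: "continuous_map (cyl (cyl Z)) (cyl Z) K'"
    unfolding continuous_map_def
  proof (intro conjI allI impI)
    show "K' \<in> topspace (cyl (cyl Z)) \<rightarrow> topspace (cyl Z)"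
    proof (rule funcsetI)
      fix x assume "x \<in> topspace (cyl (cyl Z))"
      then obtain w t where wt: "x = (w, t)" "w \<in> topspace (cyl Z)" "t \<in> {0..1}" by auto
      then have "(w, \<tau> (w, t)) \<in> topspace (cyl (cyl Z))" using \<tau>01[OF wt(2,3)] by simp
      then have "K (w, \<tau> (w, t)) \<in> topspace (cyl Z)"
        by (rule funcset_mem[OF continuous_map_funspace[OF Kc]])
      then show "K' x \<in> topspace (cyl Z)" by (simp add: K'_def wt(1))
    qed
    fix W assume W: "openin (cyl Z) W"
    \<comment> \<open>\<tau> is continuous on the open set N where \<phi> is positive. Any other w
      lies in D, where K(w, -) is constant, so the tube lemma gives a neighbourhood that K maps into
      W at all times, whatever the value of \<tau>.\<close>
    define N where "N = {x \<in> topspace (cyl (cyl Z)). \<phi> (fst x) \<in> {0<..}}"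
    have \<phi>f: "continuous_map (cyl (cyl Z)) euclideanreal (\<lambda>x. \<phi> (fst x))"
      by (rule unit_interval_realD) (rule continuous_map_compose'[OF continuous_map_fst \<phi>c])
    have N: "openin (cyl (cyl Z)) N"
      unfolding N_def by (rule openin_continuous_map_preimage[OF \<phi>f]) simp
    have \<tau>N: "continuous_map (subtopology (cyl (cyl Z)) N) (top_of_set {0..1}) \<tau>"
    proof -
      have "continuous_map (subtopology (cyl (cyl Z)) N) euclideanreal (\<lambda>x. min 1 (snd x / \<phi> (fst x)))"
        by (intro continuous_intros continuous_map_real_divide continuous_map_from_subtopology[OF ct] continuous_map_from_subtopology[OF \<phi>f]) (auto simp: N_def)
      then have "continuous_map (subtopology (cyl (cyl Z)) N) euclideanreal \<tau>"
        by (rule continuous_map_eq) (auto simp: \<tau>_def N_def)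
      then show ?thesis using \<tau>01 by (fastforce simp: unit_interval_real N_def)
    qed
    have "continuous_map (subtopology (cyl (cyl Z)) N) (cyl Z) (\<lambda>x. K (fst x, \<tau> x))"
      by (rule continuous_map_compose'[OF _ Kc]) (intro continuous_map_pairedI continuous_map_fst_sub \<tau>N)
    then have K'N: "continuous_map (subtopology (cyl (cyl Z)) N) (cyl Z) K'"
      by (simp add: K'_def case_prod_unfold)
    have "openin (subtopology (cyl (cyl Z)) N) {x \<in> topspace (subtopology (cyl (cyl Z)) N). K' x \<in> W}"
      by (rule openin_continuous_map_preimage[OF K'N W])
    then have 1: "openin (cyl (cyl Z)) {x \<in> topspace (subtopology (cyl (cyl Z)) N). K' x \<in> W}"
      using N openin_trans_full by blast
    have 2: "openin (cyl (cyl Z)) ({w \<in> topspace (cyl Z). \<forall>t\<in>{0..1}. K (w, t) \<in> W} \<times> {0..1})"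
      using tube_open[OF Kc W] by (simp add: openin_prod_Times_iff)
    have "{x \<in> topspace (cyl (cyl Z)). K' x \<in> W}
        = {x \<in> topspace (subtopology (cyl (cyl Z)) N). K' x \<in> W}
          \<union> {w \<in> topspace (cyl Z). \<forall>t\<in>{0..1}. K (w, t) \<in> W} \<times> {0..1}" (is "?L = ?R")
    proof
      show "?L \<subseteq> ?R"
      proof
        fix x assume x: "x \<in> ?L"
        then obtain w t where wt: "x = (w, t)" "w \<in> topspace (cyl Z)" "t \<in> {0..1}" by auto
        show "x \<in> ?R"
        proof (cases "\<phi> w = 0")
          case True
          then have "w \<in> D" using \<phi>D wt by blast
          then show ?thesis using x wt KD[OF \<open>w \<in> D\<close>] \<tau>01 by (auto simp: K'_def)
        next
          case False
          then show ?thesis using x wt \<phi>01[of w] by (auto simp: N_def)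
        qed
      qed
      show "?R \<subseteq> ?L" using \<tau>01 by (auto simp: K'_def)
    qed
    then show "openin (cyl (cyl Z)) {x \<in> topspace (cyl (cyl Z)). K' x \<in> W}"
      using 1 2 by (simp add: openin_Un)
  qed
  have lift1: "continuous_map (cyl (cyl Z)) X (\<lambda>x. q (K' x))"
    by (rule continuous_map_compose'[OF K'c q])
  have \<rho>D: "continuous_map (cyl Z) (subtopology (cyl Z) D) \<rho>"
    using \<rho>(1,2) by (auto simp: continuous_map_in_subtopology)
  then have lift2: "continuous_map (cyl Z) P (\<lambda>w. \<sigma> (\<rho> w))"
    by (rule continuous_map_compose'[OF _ \<sigma>(1)])
  have lift3: "q (K' (w, 0)) = \<pi> (\<sigma> (\<rho> w))" if "w \<in> topspace (cyl Z)" for w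
  proof (cases "w \<in> D")
    case True
    then show ?thesis using that \<sigma>(2) \<rho>(3) by (simp add: K'_def \<tau>_def \<phi>D K1)
  next
    case False
    then show ?thesis using that \<sigma>(2) \<rho>(2) K0[OF that] by (simp add: K'_def \<tau>_def \<phi>D)
  qed
  obtain G where G: "continuous_map (cyl (cyl Z)) P G"
    "\<And>w t. w \<in> topspace (cyl Z) \<Longrightarrow> t \<in> {0..1} \<Longrightarrow> \<pi> (G (w, t)) = q (K' (w, t))"
    "\<And>w. w \<in> topspace (cyl Z) \<Longrightarrow> G (w, 0) = \<sigma> (\<rho> w)"
    using HLP_lift[OF hurewicz_fibration_HLP[OF fib] lift2 lift1 lift3] by blast
  show thesis
  proof
    show "continuous_map (cyl Z) P (\<lambda>w. G (w, \<phi> w))"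
      by (rule continuous_map_compose'[OF _ G(1)]) (intro continuous_map_pairedI \<phi>c; simp)
    fix w
    { assume w: "w \<in> topspace (cyl Z)"
      have "K' (w, \<phi> w) = w" using w by (simp add: K'_def \<tau>_def K1)
      then show "\<pi> (G (w, \<phi> w)) = q w" using G(2)[OF w \<phi>01[OF w]] by simp }
    { assume "w \<in> D"
      then show "G (w, \<phi> w) = \<sigma> w" using \<phi>D[of w] DZ G(3)[of w] \<rho>(3) by auto }
  qed
qed

section \<open>The fibrewise mapping path fibration\<close>

lemma cyl_subtopology: "cyl (subtopology Z A) = subtopology (cyl Z) (A \<times> {0..1})"
  by (simp add: subtopology_Times subtopology_subtopology)

text \<open>The square of the two real coordinates (t, s) is projected radially from the point (1/2,
  2) onto its bottom and its two sides; Z is carried along.\<close>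

lemma cofibred_pair_ends: "cofibred_pair (cyl Z) (topspace Z \<times> {0, 1})"
  unfolding cofibred_pair_def
proof (intro conjI exI)
  \<comment> \<open>The vector from (1/2, 2) to (t, s) is scaled by 1 / m. The first term of m is
    the larger one when the ray hits a side, the second when it hits the bottom.\<close>
  define m where "m = (\<lambda>t s::real. max \<bar>2 * t - 1\<bar> (1 - s / 2))"
  define \<rho> where "\<rho> = (\<lambda>x::('a \<times> real) \<times> real. let z = fst (fst x); t = snd (fst x); s = snd x in
      ((z, (1 + (2 * t - 1) / m t s) / 2), 2 - (2 - s) / m t s))"
  have ct: "continuous_map (cyl (cyl Z)) euclideanreal (\<lambda>x. snd (fst x))"
    by (rule unit_interval_realD) (rule continuous_map_compose'[OF continuous_map_fst continuous_map_snd])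
  have cs: "continuous_map (cyl (cyl Z)) euclideanreal snd"
    by (rule unit_interval_realD) (rule continuous_map_snd)
  have m: "m t s \<ge> 1 / 2" "\<bar>2 * t - 1\<bar> \<le> m t s" "1 - s / 2 \<le> m t s" "m t s \<le> 1"
    if "t \<in> {0..1}" "s \<in> {0..1}" for t s
    using that unfolding m_def by (auto simp: le_max_iff_disj)
  have cm: "continuous_map (cyl (cyl Z)) euclideanreal (\<lambda>x. m (snd (fst x)) (snd x))"
    unfolding m_def by (intro continuous_intros continuous_map_real_divide ct cs) auto
  have m0: "m (snd (fst x)) (snd x) \<noteq> 0" if "x \<in> topspace (cyl (cyl Z))" for x
    using m(1)[of "snd (fst x)" "snd x"] that by auto
  have bounds: "0 \<le> (1 + (2 * t - 1) / m t s) / 2" "(1 + (2 * t - 1) / m t s) / 2 \<le> 1"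
     "0 \<le> 2 - (2 - s) / m t s" "2 - (2 - s) / m t s \<le> 1"
    if "t \<in> {0..1}" "s \<in> {0..1}" for t s
  proof -
    have "\<bar>(2 * t - 1) / m t s\<bar> \<le> 1" using m[OF that] by (simp add: divide_le_eq)
    then show "0 \<le> (1 + (2 * t - 1) / m t s) / 2" "(1 + (2 * t - 1) / m t s) / 2 \<le> 1"
      unfolding abs_le_iff by simp_all
    show "0 \<le> 2 - (2 - s) / m t s" using m[OF that] by (simp add: divide_le_eq)
    have "1 * m t s \<le> 2 - s" using m[OF that] that by auto
    then show "2 - (2 - s) / m t s \<le> 1" using m[OF that] by (simp add: le_divide_eq)
  qed
  show "continuous_map (cyl (cyl Z)) (cyl (cyl Z)) \<rho>"
    unfolding \<rho>_def Let_def
  proof (intro continuous_map_pairedI continuous_map_compose'[OF continuous_map_fst continuous_map_fst])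
    show "continuous_map (cyl (cyl Z)) (top_of_set {0..1})
        (\<lambda>x. (1 + (2 * snd (fst x) - 1) / m (snd (fst x)) (snd x)) / 2)"
      "continuous_map (cyl (cyl Z)) (top_of_set {0..1}) (\<lambda>x. 2 - (2 - snd x) / m (snd (fst x)) (snd x))"
      unfolding unit_interval_real
      by (intro conjI ballI continuous_intros continuous_map_real_divide ct cs cm m0 bounds; force)+
  qed
  show "\<forall>x\<in>topspace (cyl (cyl Z)). \<rho> x \<in> topspace (cyl Z) \<times> {0} \<union> (topspace Z \<times> {0, 1}) \<times> {0..1}"
  proof
    fix x assume "x \<in> topspace (cyl (cyl Z))"
    then obtain z t s where x: "x = ((z, t), s)" "z \<in> topspace Z" "t \<in> {0..1}" "s \<in> {0..1}" by auto
    consider "m t s = 1 - s / 2" | "m t s = 2 * t - 1" | "m t s = - (2 * t - 1)"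
      unfolding m_def by linarith
    then show "\<rho> x \<in> topspace (cyl Z) \<times> {0} \<union> (topspace Z \<times> {0, 1}) \<times> {0..1}"
    proof cases
      case 1
      then have "2 - (2 - s) / m t s = 0" using m(1)[OF x(3,4)] by (simp add: field_simps)
      then show ?thesis using x bounds[OF x(3,4)] by (simp add: \<rho>_def)
    next
      case 2
      then have "(2 * t - 1) / m t s = 1" using m(1)[OF x(3,4)] by simp
      then show ?thesis using x bounds[OF x(3,4)] by (simp add: \<rho>_def)
    next
      case 3
      then have "2 * t - 1 = - m t s" by simp
      then have "(2 * t - 1) / m t s = -1" using m(1)[OF x(3,4)] by simp
      then show ?thesis using x bounds[OF x(3,4)] by (simp add: \<rho>_def)
    qed
  qed
  show "\<forall>x\<in>topspace (cyl Z) \<times> {0} \<union> (topspace Z \<times> {0, 1}) \<times> {0..1}. \<rho> x = x"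
    by (auto simp: \<rho>_def m_def max_def)
  show "continuous_map (cyl Z) (top_of_set {0..1}) (\<lambda>x. snd x * (1 - snd x))"
    by (auto simp: unit_interval_real mult_le_one
        intro!: continuous_intros unit_interval_realD[OF continuous_map_snd])
  show "topspace Z \<times> {0, 1} = {z \<in> topspace (cyl Z). snd z * (1 - snd z) = 0}"
    by auto
qed

text \<open>With both projections constant this is the ordinary mapping path space; that case gives
  access to the homotopy groups of E and X.\<close>

definition mapping_paths ::
  "'e topology \<Rightarrow> 'x topology \<Rightarrow> ('e \<Rightarrow> 'b) \<Rightarrow> ('x \<Rightarrow> 'b) \<Rightarrow> ('e \<Rightarrow> 'x) \<Rightarrow> ('e \<times> (real \<Rightarrow> 'x)) topology" where
  "mapping_paths E X pE pX f = subtopology (prod_topology E (path_space X))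
     {(e, \<gamma>). \<gamma> 0 = f e \<and> (\<forall>t\<in>{0..1}. pX (\<gamma> t) = pE e)}"

lemma continuous_map_mapping_paths:
  assumes "continuous_map Z E e" "continuous_map (cyl Z) X H"
    and "\<And>z. z \<in> topspace Z \<Longrightarrow> H (z, 0) = f (e z)"
    and "\<And>z t. z \<in> topspace Z \<Longrightarrow> t \<in> {0..1} \<Longrightarrow> pX (H (z, t)) = pE (e z)"
  shows "continuous_map Z (mapping_paths E X pE pX f) (\<lambda>z. (e z, restrict (\<lambda>t. H (z, t)) {0..1}))"
  unfolding mapping_paths_def continuous_map_in_subtopology
  using assms by (auto intro!: continuous_map_pairedI path_space_curry)

lemma mapping_paths_fst: "continuous_map (mapping_paths E X pE pX f) E fst"
  unfolding mapping_paths_def by (rule continuous_map_fst_sub)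

lemma mapping_paths_eval:
  assumes "continuous_map Z (mapping_paths E X pE pX f) g" "continuous_map Z (top_of_set {0..1}) u"
  shows "continuous_map Z X (\<lambda>z. snd (g z) (u z))"
proof -
  have "continuous_map Z (path_space X) (\<lambda>z. snd (g z))"
    using assms(1) unfolding mapping_paths_def
    by (rule continuous_map_compose'[OF _ continuous_map_snd_sub])
  then show ?thesis using assms(2) by (rule path_space_eval_compose)
qed

lemma mapping_pathsD:
  assumes "x \<in> topspace (mapping_paths E X pE pX f)"
  shows "fst x \<in> topspace E" "snd x 0 = f (fst x)" "t \<in> {0..1} \<Longrightarrow> pX (snd x t) = pE (fst x)"
    "t \<in> {0..1} \<Longrightarrow> snd x t \<in> topspace X" "snd x \<in> extensional {0..1}"
  using assms by (auto simp: mapping_paths_def topspace_path_space continuous_map_def)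

text \<open>The image of the homotopy in B is lifted to E, which moves the E-components. The paths
  in X must then be moved so that they start at f of this lift and end at H. For each z this is a
  square over B with its bottom and two sides given, and relative lifting in the fibration X over B
  fills it.\<close>

lemma HLP_mapping_paths:
  fixes Z :: "'z topology"
  assumes fE: "hurewicz_fibration E B pE" and fX: "hurewicz_fibration X B pX"
    and f: "continuous_map E X f" "\<And>e. e \<in> topspace E \<Longrightarrow> pX (f e) = pE e"
  shows "HLP_wrt Z (mapping_paths E X pE pX f) X (\<lambda>x. snd x 1)"
  unfolding HLP_wrt_def
proof (intro allI impI)
  fix g :: "'z \<Rightarrow> _" and H
  let ?P = "mapping_paths E X pE pX f"
  assume "continuous_map Z ?P g \<and> continuous_map (cyl Z) X H \<and> (\<forall>z\<in>topspace Z. H (z, 0) = snd (g z) 1)"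
  then have g: "continuous_map Z ?P g" and H: "continuous_map (cyl Z) X H"
    and H0: "\<And>z. z \<in> topspace Z \<Longrightarrow> H (z, 0) = snd (g z) 1" by auto
  have gP: "g z \<in> topspace ?P" if "z \<in> topspace Z" for z
    using g that by (auto simp: continuous_map_def)
  note gD = mapping_pathsD[OF gP]
  have pX: "continuous_map X B pX" using fX by (simp add: hurewicz_fibration_def)
  have lift2: "continuous_map Z E (\<lambda>z. fst (g z))"
    by (rule continuous_map_compose'[OF g mapping_paths_fst])
  have lift1: "continuous_map (cyl Z) B (\<lambda>x. pX (H x))"
    by (rule continuous_map_compose'[OF H pX])
  have lift3: "pX (H (z, 0)) = pE (fst (g z))" if "z \<in> topspace Z" for z
    using that H0 gD(3)[OF that, of 1] by simp
  obtain L where L: "continuous_map (cyl Z) E L"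
    "\<And>z t. z \<in> topspace Z \<Longrightarrow> t \<in> {0..1} \<Longrightarrow> pE (L (z, t)) = pX (H (z, t))"
    "\<And>z. z \<in> topspace Z \<Longrightarrow> L (z, 0) = fst (g z)"
    using HLP_lift[OF hurewicz_fibration_HLP[OF fE] lift2 lift1 lift3] by blast
  have Lt: "L (z, t) \<in> topspace E" if "z \<in> topspace Z" "t \<in> {0..1}" for z t
    using continuous_map_funspace[OF L(1)] that by auto
  define D where "D = topspace (cyl Z) \<times> {0} \<union> (topspace Z \<times> {0, 1}) \<times> {0..1::real}"
  \<comment> \<open>Here s is the time of the homotopy and t the parameter of the path: the given
    path at s = 0, the image of the lift at t = 0, the prescribed end points H at t = 1.\<close>
  define \<sigma> where "\<sigma> = (\<lambda>x::('z \<times> real) \<times> real. let z = fst (fst x); t = snd (fst x); s = snd x in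
      if s = 0 then snd (g z) t else if t = 0 then f (L (z, s)) else H (z, s))"
  have cz: "continuous_map (cyl (cyl Z)) Z (\<lambda>x. fst (fst x))"
    by (rule continuous_map_compose'[OF continuous_map_fst continuous_map_fst])
  have ct: "continuous_map (cyl (cyl Z)) (top_of_set {0..1}) (\<lambda>x. snd (fst x))"
    by (rule continuous_map_compose'[OF continuous_map_fst continuous_map_snd])
  have czs: "continuous_map (cyl (cyl Z)) (cyl Z) (\<lambda>x. (fst (fst x), snd x))"
    by (intro continuous_map_pairedI cz continuous_map_snd)
  have q: "continuous_map (cyl (cyl Z)) B (\<lambda>x. pX (H (fst (fst x), snd x)))"
    by (rule continuous_map_compose'[OF continuous_map_compose'[OF czs H] pX])
  have p1: "continuous_map (cyl (cyl Z)) X (\<lambda>x. snd (g (fst (fst x))) (snd (fst x)))"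
    by (rule mapping_paths_eval[OF continuous_map_compose'[OF cz g] ct])
  have p2: "continuous_map (cyl (cyl Z)) X (\<lambda>x. f (L (fst (fst x), snd x)))"
    by (rule continuous_map_compose'[OF continuous_map_compose'[OF czs L(1)] f(1)])
  have p3: "continuous_map (cyl (cyl Z)) X (\<lambda>x. H (fst (fst x), snd x))"
    by (rule continuous_map_compose'[OF czs H])
  have closed0: "closedin (cyl (cyl Z)) (topspace (cyl Z) \<times> {0})"
    by (intro closedin_prod_Times_iff[THEN iffD2] disjI2 conjI closedin_topspace) auto
  have closed1: "closedin (cyl (cyl Z)) ((topspace Z \<times> {t}) \<times> {0..1})" if "t \<in> {0, 1}" for t
    using that by (auto simp: closedin_prod_Times_iff)
  have closedD: "closedin (subtopology (cyl (cyl Z)) D) (topspace (cyl Z) \<times> {0})"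
    "closedin (subtopology (cyl (cyl Z)) D) ((topspace Z \<times> {0}) \<times> {0..1} \<union> (topspace Z \<times> {1}) \<times> {0..1})"
    "closedin (subtopology (cyl (cyl Z)) ((topspace Z \<times> {0}) \<times> {0..1} \<union> (topspace Z \<times> {1}) \<times> {0..1})) ((topspace Z \<times> {0}) \<times> {0..1})"
    "closedin (subtopology (cyl (cyl Z)) ((topspace Z \<times> {0}) \<times> {0..1} \<union> (topspace Z \<times> {1}) \<times> {0..1})) ((topspace Z \<times> {1}) \<times> {0..1})"
    by (auto intro!: closedin_subset_topspace closedin_Un closed0[simplified] closed1 simp: D_def)
  have \<sigma>c: "continuous_map (subtopology (cyl (cyl Z)) D) X \<sigma>"
  proof (rule continuous_map_glue_closed[OF closedD(1,2)])
    show "topspace (subtopology (cyl (cyl Z)) D)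
       \<subseteq> topspace (cyl Z) \<times> {0} \<union> ((topspace Z \<times> {0}) \<times> {0..1} \<union> (topspace Z \<times> {1}) \<times> {0..1})"
      by (auto simp: D_def)
    have "continuous_map (subtopology (cyl (cyl Z)) (topspace (cyl Z) \<times> {0})) X \<sigma>"
      by (rule continuous_map_eq[OF continuous_map_from_subtopology[OF p1]]) (auto simp: \<sigma>_def)
    then show "continuous_map (subtopology (subtopology (cyl (cyl Z)) D) (topspace (cyl Z) \<times> {0})) X \<sigma>"
      by (simp add: subtopology_subtopology D_def Int_absorb1 Int_Un_distrib2)
    have "continuous_map (subtopology (cyl (cyl Z)) ((topspace Z \<times> {0}) \<times> {0..1} \<union> (topspace Z \<times> {1}) \<times> {0..1})) X \<sigma>"
    proof (rule continuous_map_glue_closed[OF closedD(3,4)])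
      have "continuous_map (subtopology (cyl (cyl Z)) ((topspace Z \<times> {0}) \<times> {0..1})) X \<sigma>"
        by (rule continuous_map_eq[OF continuous_map_from_subtopology[OF p2]])
           (auto simp: \<sigma>_def L gD)
      moreover have "continuous_map (subtopology (cyl (cyl Z)) ((topspace Z \<times> {1}) \<times> {0..1})) X \<sigma>"
        by (rule continuous_map_eq[OF continuous_map_from_subtopology[OF p3]])
           (auto simp: \<sigma>_def H0)
      ultimately show "continuous_map (subtopology (subtopology (cyl (cyl Z)) ((topspace Z \<times> {0}) \<times> {0..1} \<union> (topspace Z \<times> {1}) \<times> {0..1})) ((topspace Z \<times> {0}) \<times> {0..1})) X \<sigma>"
        "continuous_map (subtopology (subtopology (cyl (cyl Z)) ((topspace Z \<times> {0}) \<times> {0..1} \<union> (topspace Z \<times> {1}) \<times> {0..1})) ((topspace Z \<times> {1}) \<times> {0..1})) X \<sigma>"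
        by (simp_all add: subtopology_subtopology Int_absorb1)
    qed auto
    then show "continuous_map (subtopology (subtopology (cyl (cyl Z)) D) ((topspace Z \<times> {0}) \<times> {0..1} \<union> (topspace Z \<times> {1}) \<times> {0..1})) X \<sigma>"
    proof -
      have "D \<inter> ((topspace Z \<times> {0}) \<times> {0..1} \<union> (topspace Z \<times> {1}) \<times> {0..1})
          = (topspace Z \<times> {0}) \<times> {0..1} \<union> (topspace Z \<times> {1}) \<times> {0..1}"
        by (auto simp: D_def)
      then show ?thesis using \<open>continuous_map (subtopology (cyl (cyl Z)) ((topspace Z \<times> {0}) \<times> {0..1} \<union> (topspace Z \<times> {1}) \<times> {0..1})) X \<sigma>\<close>
        by (simp add: subtopology_subtopology)
    qed
  qed
  have "pX (\<sigma> x) = pX (H (fst (fst x), snd x))" if "x \<in> D" for x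
  proof -
    obtain z t s where x: "x = ((z, t), s)" "z \<in> topspace Z" "t \<in> {0..1}" "s \<in> {0..1}"
      and D: "s = 0 \<or> t = 0 \<or> t = 1"
      using \<open>x \<in> D\<close> by (auto simp: D_def)
    have "pX (snd (g z) t) = pX (H (z, 0))"
      using gD(3)[OF x(2,3)] lift3[OF x(2)] by simp
    then show ?thesis
      using D f(2)[OF Lt[OF x(2,4)]] L(2)[OF x(2,4)] by (auto simp: \<sigma>_def x(1))
  qed
  from relative_lifting[OF fX cofibred_pair_ends q D_def \<sigma>c this]
  obtain \<sigma>' where \<sigma>': "continuous_map (cyl (cyl Z)) X \<sigma>'"
    "\<And>x. x \<in> topspace (cyl (cyl Z)) \<Longrightarrow> pX (\<sigma>' x) = pX (H (fst (fst x), snd x))"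
    "\<And>x. x \<in> D \<Longrightarrow> \<sigma>' x = \<sigma> x" by blast
  have e0: "\<sigma>' ((z, 0), s) = f (L (z, s))" and e1: "\<sigma>' ((z, 1), s) = H (z, s)"
    if "z \<in> topspace Z" "s \<in> {0..1}" for z s
    using that \<sigma>'(3)[of "((z, 0), s)"] \<sigma>'(3)[of "((z, 1), s)"] gD H0 L(3)
    by (auto simp: D_def \<sigma>_def)
  have e2: "\<sigma>' ((z, t), 0) = snd (g z) t" if "z \<in> topspace Z" "t \<in> {0..1}" for z t
    using that \<sigma>'(3)[of "((z, t), 0)"] by (auto simp: D_def \<sigma>_def)
  define G where "G = (\<lambda>x. (L x, restrict (\<lambda>t. \<sigma>' ((fst x, t), snd x)) {0..1}))"
  have "continuous_map (cyl Z) ?P (\<lambda>x. (L x, restrict (\<lambda>t. (\<lambda>y. \<sigma>' ((fst (fst y), snd y), snd (fst y))) (x, t)) {0..1}))"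
  proof (rule continuous_map_mapping_paths[OF L(1)])
    show "continuous_map (cyl (cyl Z)) X (\<lambda>y. \<sigma>' ((fst (fst y), snd y), snd (fst y)))"
      by (rule continuous_map_compose'[OF _ \<sigma>'(1)]) (intro continuous_map_pairedI czs ct)
  qed (use e0 \<sigma>'(2) L(2) in auto)
  then have "continuous_map (cyl Z) ?P G" by (simp add: G_def)
  moreover have "\<forall>z\<in>topspace Z. \<forall>t\<in>{0..1}. snd (G (z, t)) 1 = H (z, t)"
    by (simp add: G_def e1)
  moreover have "\<forall>z\<in>topspace Z. G (z, 0) = g z"
  proof
    fix z assume z: "z \<in> topspace Z"
    have "restrict (\<lambda>t. \<sigma>' ((z, t), 0)) {0..1} = snd (g z)"
      using gD(5)[OF z] e2[OF z] by (auto simp: fun_eq_iff extensional_def)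
    then show "G (z, 0) = g z" using L(3)[OF z] by (simp add: G_def)
  qed
  ultimately show "\<exists>G. continuous_map (cyl Z) ?P G \<and>
      (\<forall>z\<in>topspace Z. \<forall>t\<in>{0..1}. snd (G (z, t)) 1 = H (z, t)) \<and> (\<forall>z\<in>topspace Z. G (z, 0) = g z)"
    by blast
qed

lemma mapping_paths_fibration:
  assumes "hurewicz_fibration E B pE" "hurewicz_fibration X B pX"
    and "continuous_map E X f" "\<And>e. e \<in> topspace E \<Longrightarrow> pX (f e) = pE e"
  shows "hurewicz_fibration (mapping_paths E X pE pX f) X (\<lambda>x. snd x 1)"
  unfolding hurewicz_fibration_def
  using HLP_mapping_paths[OF assms] mapping_paths_eval[OF continuous_map_id, of _ _ _ _ _ "\<lambda>_. 1"]
  by auto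

section \<open>Fibrewise joins\<close>

text \<open>A continuous map from an open subset of Z to P, undefined points being sent to
  \<open>None\<close>. Openness of the domain is the case W = \<open>topspace P\<close>.\<close>

definition partial_map :: "'z topology \<Rightarrow> 'p topology \<Rightarrow> ('z \<Rightarrow> 'p option) \<Rightarrow> bool" where
  "partial_map Z P h \<longleftrightarrow> (\<forall>z\<in>topspace Z. \<forall>p. h z = Some p \<longrightarrow> p \<in> topspace P) \<and>
     (\<forall>W. openin P W \<longrightarrow> openin Z {z \<in> topspace Z. \<exists>p\<in>W. h z = Some p})"

lemma partial_map_dom:
  assumes "partial_map Z P h"
  shows "openin Z {z \<in> topspace Z. h z \<noteq> None}"
proof -
  have "{z \<in> topspace Z. h z \<noteq> None} = {z \<in> topspace Z. \<exists>p\<in>topspace P. h z = Some p}"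
    using assms unfolding partial_map_def by auto
  then show ?thesis using assms unfolding partial_map_def by simp
qed

lemma partial_map_continuous:
  assumes "partial_map Z P h"
  shows "continuous_map (subtopology Z {z \<in> topspace Z. h z \<noteq> None}) P (\<lambda>z. the (h z))"
  unfolding continuous_map_def
proof (intro conjI allI impI)
  show "(\<lambda>z. the (h z)) \<in> topspace (subtopology Z {z \<in> topspace Z. h z \<noteq> None}) \<rightarrow> topspace P"
    using assms unfolding partial_map_def by auto
  fix W assume "openin P W"
  then have "openin Z {z \<in> topspace Z. \<exists>p\<in>W. h z = Some p}"
    using assms unfolding partial_map_def by simp
  moreover have "{z \<in> topspace (subtopology Z {z \<in> topspace Z. h z \<noteq> None}). the (h z) \<in> W}
      = {z \<in> topspace Z. \<exists>p\<in>W. h z = Some p}" by auto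
  ultimately show "openin (subtopology Z {z \<in> topspace Z. h z \<noteq> None})
      {z \<in> topspace (subtopology Z {z \<in> topspace Z. h z \<noteq> None}). the (h z) \<in> W}"
    by (simp only: openin_open_subtopology[OF partial_map_dom[OF assms]]) auto
qed

lemma partial_mapI:
  assumes U: "openin Z U" and c: "continuous_map (subtopology Z U) P g"
    and h: "\<And>z. z \<in> U \<Longrightarrow> h z = Some (g z)" "\<And>z. z \<in> topspace Z \<Longrightarrow> z \<notin> U \<Longrightarrow> h z = None"
  shows "partial_map Z P h"
  unfolding partial_map_def
proof (intro conjI ballI allI impI)
  have Us: "U \<subseteq> topspace Z" by (rule openin_subset[OF U])
  fix z p assume "z \<in> topspace Z" "h z = Some p"
  then show "p \<in> topspace P" using h continuous_map_funspace[OF c] by (cases "z \<in> U") auto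
next
  have Us: "U \<subseteq> topspace Z" by (rule openin_subset[OF U])
  fix W assume "openin P W"
  then have "openin (subtopology Z U) {z \<in> topspace (subtopology Z U). g z \<in> W}"
    by (rule openin_continuous_map_preimage[OF c])
  then have "openin Z {z \<in> topspace (subtopology Z U). g z \<in> W}"
    using U openin_trans_full by blast
  moreover have "{z \<in> topspace (subtopology Z U). g z \<in> W} = {z \<in> topspace Z. \<exists>p\<in>W. h z = Some p}"
    using h Us by force
  ultimately show "openin Z {z \<in> topspace Z. \<exists>p\<in>W. h z = Some p}" by simp
qed

lemma partial_map_compose:
  assumes "continuous_map Z' Z g" "partial_map Z P h"
  shows "partial_map Z' P (\<lambda>z. h (g z))"
  unfolding partial_map_def
proof (intro conjI ballI allI impI)
  fix z p assume "z \<in> topspace Z'" "h (g z) = Some p"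
  then show "p \<in> topspace P" using assms unfolding partial_map_def continuous_map_def by blast
next
  fix W assume "openin P W"
  then have "openin Z' {z \<in> topspace Z'. g z \<in> {z \<in> topspace Z. \<exists>p\<in>W. h z = Some p}}"
    using assms unfolding partial_map_def by (blast intro: openin_continuous_map_preimage)
  moreover have "{z \<in> topspace Z'. g z \<in> {z \<in> topspace Z. \<exists>p\<in>W. h z = Some p}}
     = {z \<in> topspace Z'. \<exists>p\<in>W. h (g z) = Some p}"
    using assms(1) by (auto simp: continuous_map_def)
  ultimately show "openin Z' {z \<in> topspace Z'. \<exists>p\<in>W. h (g z) = Some p}" by simp
qed

lemma partial_map_const_None: "partial_map Z P (\<lambda>_. None)"
  by (simp add: partial_map_def)

lemma partial_map_subtopology:
  "partial_map Z P h \<Longrightarrow> partial_map (subtopology Z A) P h"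
  using partial_map_compose[OF continuous_map_from_subtopology[OF continuous_map_id]] by (simp add: id_def)

text \<open>A point of the \<open>m\<close>-fold fibrewise join is a nonempty partial family of points of \<open>P\<close>
  in a common fibre.  Join coordinates are replaced by mere domains of definition, so that a map
  into the join is an open cover together with a lift over each member; no partition of
  unity is needed to produce one.\<close>

definition join_carrier :: "'p topology \<Rightarrow> ('p \<Rightarrow> 'c) \<Rightarrow> nat \<Rightarrow> (nat \<Rightarrow> 'p option) set" where
  "join_carrier P \<pi> m = {h. (\<forall>i\<ge>m. h i = None) \<and> (\<exists>i. h i \<noteq> None) \<and>
     (\<forall>i p. h i = Some p \<longrightarrow> p \<in> topspace P) \<and>
     (\<forall>i j p q. h i = Some p \<and> h j = Some q \<longrightarrow> \<pi> p = \<pi> q)}"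

text \<open>The coarsest topology in which every coordinate is a partial map with open domain.
  \<open>UNIV\<close> is put in so that the underlying set is visibly the whole carrier.\<close>

definition join_space :: "'p topology \<Rightarrow> ('p \<Rightarrow> 'c) \<Rightarrow> nat \<Rightarrow> (nat \<Rightarrow> 'p option) topology" where
  "join_space P \<pi> m = subtopology
     (topology_generated_by (insert UNIV {{h. \<exists>p\<in>W. h i = Some p} | i W. openin P W}))
     (join_carrier P \<pi> m)"

text \<open>On the carrier all defined entries lie over the same point; the least index merely
  selects one of them.\<close>

definition join_proj :: "('p \<Rightarrow> 'c) \<Rightarrow> (nat \<Rightarrow> 'p option) \<Rightarrow> 'c" where
  "join_proj \<pi> h = \<pi> (the (h (LEAST i. h i \<noteq> None)))"

lemma topspace_join_space: "topspace (join_space P \<pi> m) = join_carrier P \<pi> m"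
  unfolding join_space_def topspace_subtopology topology_generated_by_topspace by blast

lemma join_proj_eq:
  assumes "h \<in> join_carrier P \<pi> m" "h i = Some p"
  shows "join_proj \<pi> h = \<pi> p"
proof -
  have "h (LEAST i. h i \<noteq> None) \<noteq> None"
    by (rule LeastI[of "\<lambda>i. h i \<noteq> None" i]) (simp add: assms(2))
  then obtain q where q: "h (LEAST i. h i \<noteq> None) = Some q" by blast
  have "\<forall>i j p q. h i = Some p \<and> h j = Some q \<longrightarrow> \<pi> p = \<pi> q"
    using assms(1) unfolding join_carrier_def by blast
  then have "\<pi> q = \<pi> p" using q assms(2) by blast
  then show ?thesis unfolding join_proj_def q by simp
qed

lemma join_carrierI:
  assumes "\<And>i. i \<ge> m \<Longrightarrow> h i = None" "h i \<noteq> None" "\<And>i p. h i = Some p \<Longrightarrow> p \<in> topspace P \<and> \<pi> p = x"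
  shows "h \<in> join_carrier P \<pi> m"
proof -
  have "\<forall>i j p q. h i = Some p \<and> h j = Some q \<longrightarrow> \<pi> p = \<pi> q" using assms(3) by metis
  then show ?thesis unfolding join_carrier_def using assms by blast
qed

lemma join_carrierE:
  assumes "h \<in> join_carrier P \<pi> m"
  obtains i p where "h i = Some p" "i < m" "p \<in> topspace P" "join_proj \<pi> h = \<pi> p"
proof -
  obtain i p where "h i = Some p" using assms unfolding join_carrier_def by auto
  moreover from this have "i < m" using assms unfolding join_carrier_def by (metis (mono_tags, lifting) linorder_not_less mem_Collect_eq option.distinct(1))
  ultimately show ?thesis using that assms join_proj_eq[OF assms] unfolding join_carrier_def by blast
qed

text \<open>The universal property for which the topology is made: a map into the join is a family
  of partial maps whose open domains cover Z and whose values lie over a common point. Sections of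
  the join are thereby open covers with local sections.\<close>

lemma continuous_map_join_iff:
  "continuous_map Z (join_space P \<pi> m) h \<longleftrightarrow>
     (\<forall>z\<in>topspace Z. h z \<in> join_carrier P \<pi> m) \<and> (\<forall>i. partial_map Z P (\<lambda>z. h z i))"
proof -
  have c: "p \<in> topspace P" if "h z \<in> join_carrier P \<pi> m" "h z i = Some p" for z i p
    using that by (simp add: join_carrier_def)
  have "continuous_map Z (join_space P \<pi> m) h \<longleftrightarrow>
     (\<forall>U\<in>insert UNIV {{h. \<exists>p\<in>W. h i = Some p} | i W. openin P W}. openin Z (h -` U \<inter> topspace Z)) \<and>
     (\<forall>z\<in>topspace Z. h z \<in> join_carrier P \<pi> m)"
    unfolding join_space_def continuous_map_in_subtopology continuous_on_generated_topo_iff by auto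
  also have "(\<forall>U\<in>insert UNIV {{h. \<exists>p\<in>W. h i = Some p} | i W. openin P W}. openin Z (h -` U \<inter> topspace Z))
     \<longleftrightarrow> (\<forall>i W. openin P W \<longrightarrow> openin Z {z \<in> topspace Z. \<exists>p\<in>W. h z i = Some p})"
  proof -
    have eq: "h -` {h. \<exists>p\<in>W. h i = Some p} \<inter> topspace Z = {z \<in> topspace Z. \<exists>p\<in>W. h z i = Some p}" for i W
      by auto
    have "(\<forall>U\<in>{{h. \<exists>p\<in>W. h i = Some p} | i W. openin P W}. openin Z (h -` U \<inter> topspace Z))
     \<longleftrightarrow> (\<forall>i W. openin P W \<longrightarrow> openin Z (h -` {h. \<exists>p\<in>W. h i = Some p} \<inter> topspace Z))"
      by blast
    then show ?thesis unfolding eq by simp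
  qed
  also have "(\<dots> \<and> (\<forall>z\<in>topspace Z. h z \<in> join_carrier P \<pi> m)) \<longleftrightarrow> 
     (\<forall>z\<in>topspace Z. h z \<in> join_carrier P \<pi> m) \<and> (\<forall>i. partial_map Z P (\<lambda>z. h z i))"
  proof -
    have "(\<forall>i W. openin P W \<longrightarrow> openin Z {z \<in> topspace Z. \<exists>p\<in>W. h z i = Some p})
        \<longleftrightarrow> (\<forall>i. partial_map Z P (\<lambda>z. h z i))"
      if C: "\<forall>z\<in>topspace Z. h z \<in> join_carrier P \<pi> m"
    proof -
      have "\<forall>z\<in>topspace Z. \<forall>p. h z i = Some p \<longrightarrow> p \<in> topspace P" for i using c C by blast
      then show ?thesis unfolding partial_map_def by blast
    qed
    then show ?thesis by argo
  qed
  finally show ?thesis .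
qed

lemma continuous_map_join_proj:
  assumes "continuous_map P X \<pi>"
  shows "continuous_map (join_space P \<pi> m) X (join_proj \<pi>)"
proof (rule continuous_map_glue_open)
  fix h assume h: "h \<in> topspace (join_space P \<pi> m)"
  then obtain i p where i: "h i = Some p" unfolding topspace_join_space by (rule join_carrierE)
  have pm: "partial_map (join_space P \<pi> m) P (\<lambda>h. h i)"
    using continuous_map_join_iff[of "join_space P \<pi> m" P \<pi> m "\<lambda>h. h"] by simp
  let ?U = "{h \<in> topspace (join_space P \<pi> m). h i \<noteq> None}"
  have "continuous_map (subtopology (join_space P \<pi> m) ?U) X (\<lambda>h. \<pi> (the (h i)))"
    by (rule continuous_map_compose'[OF partial_map_continuous[OF pm] assms])
  then have "continuous_map (subtopology (join_space P \<pi> m) ?U) X (join_proj \<pi>)"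
    by (rule continuous_map_eq) (auto simp: topspace_join_space join_proj_eq)
  then show "\<exists>U. openin (join_space P \<pi> m) U \<and> h \<in> U \<and> continuous_map (subtopology (join_space P \<pi> m) U) X (join_proj \<pi>)"
    using partial_map_dom[OF pm] h i by blast
qed

text \<open>Each coordinate is lifted separately over its own domain \<open>U i\<close>, which does
  not change during the homotopy. All these lifts cover the same H, so at every time they stay in a
  common fibre.\<close>

lemma HLP_join:
  fixes Z :: "'z topology"
  assumes fib: "hurewicz_fibration P X \<pi>"
  shows "HLP_wrt Z (join_space P \<pi> m) X (join_proj \<pi>)"
  unfolding HLP_wrt_def
proof (intro allI impI)
  fix g :: "'z \<Rightarrow> _" and H
  assume asm: "continuous_map Z (join_space P \<pi> m) g \<and> continuous_map (cyl Z) X H \<and>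
     (\<forall>z\<in>topspace Z. H (z, 0) = join_proj \<pi> (g z))"
  define U where "U = (\<lambda>i. {z \<in> topspace Z. g z i \<noteq> None})"
  have gc: "g z \<in> join_carrier P \<pi> m" if "z \<in> topspace Z" for z
    using asm that unfolding continuous_map_join_iff by blast
  have pm: "partial_map Z P (\<lambda>z. g z i)" for i
    using asm unfolding continuous_map_join_iff by blast
  have U: "openin Z (U i)" for i unfolding U_def by (rule partial_map_dom[OF pm])
  have "\<exists>G. continuous_map (cyl (subtopology Z (U i))) P G \<and>
      (\<forall>z\<in>U i. \<forall>t\<in>{0..1}. \<pi> (G (z, t)) = H (z, t)) \<and> (\<forall>z\<in>U i. G (z, 0) = the (g z i))" for i
  proof -
    have lift2: "continuous_map (subtopology Z (U i)) P (\<lambda>z. the (g z i))"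
      unfolding U_def by (rule partial_map_continuous[OF pm])
    have lift1: "continuous_map (cyl (subtopology Z (U i))) X H"
      using asm unfolding cyl_subtopology by (blast intro: continuous_map_from_subtopology)
    have lift3: "H (z, 0) = \<pi> (the (g z i))" if "z \<in> topspace (subtopology Z (U i))" for z
      using that asm gc join_proj_eq by (fastforce simp: U_def)
    obtain G where "continuous_map (cyl (subtopology Z (U i))) P G"
      "\<And>z t. z \<in> topspace (subtopology Z (U i)) \<Longrightarrow> t \<in> {0..1} \<Longrightarrow> \<pi> (G (z, t)) = H (z, t)"
      "\<And>z. z \<in> topspace (subtopology Z (U i)) \<Longrightarrow> G (z, 0) = the (g z i)"
      using HLP_lift[OF hurewicz_fibration_HLP[OF fib] lift2 lift1 lift3] by blast
    then show ?thesis by (auto simp: U_def)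
  qed
  then obtain G where G: "\<And>i. continuous_map (cyl (subtopology Z (U i))) P (G i)"
      "\<And>i z t. z \<in> U i \<Longrightarrow> t \<in> {0..1} \<Longrightarrow> \<pi> (G i (z, t)) = H (z, t)"
      "\<And>i z. z \<in> U i \<Longrightarrow> G i (z, 0) = the (g z i)"
    by metis
  define K where "K = (\<lambda>x i. if fst x \<in> U i then Some (G i x) else None)"
  have Ki: "partial_map (cyl Z) P (\<lambda>x. K x i)" for i
  proof (rule partial_mapI[where U = "U i \<times> {0..1}"])
    show "openin (cyl Z) (U i \<times> {0..1})" using U by (simp add: openin_prod_Times_iff)
    show "continuous_map (subtopology (cyl Z) (U i \<times> {0..1})) P (G i)"
      using G(1)[of i] unfolding cyl_subtopology .
  qed (auto simp: K_def)
  have Kt: "G i (z, t) \<in> topspace P" if "z \<in> U i" "t \<in> {0..1}" for i z t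
    using continuous_map_funspace[OF G(1)[of i]] that by (auto simp: U_def Pi_iff)
  have Kc: "K (z, t) \<in> join_carrier P \<pi> m" if z: "z \<in> topspace Z" "t \<in> {0..1}" for z t
    using gc[OF z(1)] z Kt G(2)[OF _ z(2)] unfolding join_carrier_def K_def by (auto simp: U_def)
  have Kp: "join_proj \<pi> (K (z, t)) = H (z, t)" if zt: "z \<in> topspace Z" "t \<in> {0..1}" for z t
  proof -
    obtain i where "z \<in> U i" using gc[OF zt(1)] zt by (auto simp: U_def join_carrier_def)
    then have "K (z, t) i = Some (G i (z, t))" by (simp add: K_def)
    from join_proj_eq[OF Kc[OF that] this] show ?thesis using G(2) \<open>z \<in> U i\<close> that by simp
  qed
  have "continuous_map (cyl Z) (join_space P \<pi> m) K"
    unfolding continuous_map_join_iff using Ki Kc by auto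
  moreover have "K (z, 0) = g z" if "z \<in> topspace Z" for z
    using that G(3) by (auto simp: K_def U_def fun_eq_iff)
  ultimately show "\<exists>G. continuous_map (cyl Z) (join_space P \<pi> m) G \<and>
      (\<forall>z\<in>topspace Z. \<forall>t\<in>{0..1}. join_proj \<pi> (G (z, t)) = H (z, t)) \<and> (\<forall>z\<in>topspace Z. G (z, 0) = g z)"
    using Kp by blast
qed

lemma join_fibration:
  assumes "hurewicz_fibration P X \<pi>"
  shows "hurewicz_fibration (join_space P \<pi> m) X (join_proj \<pi>)"
  using HLP_join[OF assms] continuous_map_join_proj assms unfolding hurewicz_fibration_def by blast

section \<open>Cubes, spheres and discs\<close>

text \<open>Points of n-space are sequences vanishing from index n on, the representation used by
  \<open>nsphere\<close> and \<open>ndisc\<close>. The maximum norm is chosen because its balls are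
  products of intervals, which suits grids.\<close>

primrec cnorm :: "nat \<Rightarrow> (nat \<Rightarrow> real) \<Rightarrow> real" where
  "cnorm 0 x = 0"
| "cnorm (Suc n) x = max (cnorm n x) \<bar>x n\<bar>"

definition cube :: "nat \<Rightarrow> (nat \<Rightarrow> real) set" where
  "cube n = {x. (\<forall>i\<ge>n. x i = 0) \<and> cnorm n x \<le> 1}"

definition cube_bd :: "nat \<Rightarrow> (nat \<Rightarrow> real) set" where
  "cube_bd n = {x \<in> cube n. cnorm n x = 1}"

lemma cnorm_nonneg: "0 \<le> cnorm n x"
  by (induction n) auto

lemma abs_le_cnorm: "i < n \<Longrightarrow> \<bar>x i\<bar> \<le> cnorm n x"
  by (induction n) (auto simp: less_Suc_eq)

lemma cnorm_le_iff: "cnorm n x \<le> c \<longleftrightarrow> 0 \<le> c \<and> (\<forall>i<n. \<bar>x i\<bar> \<le> c)"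
  by (induction n) (auto simp: less_Suc_eq)

lemma cnorm_attained: "0 < cnorm n x \<Longrightarrow> \<exists>i<n. \<bar>x i\<bar> = cnorm n x"
proof (induction n)
  case (Suc n)
  then show ?case
  proof (cases "cnorm n x \<le> \<bar>x n\<bar>")
    case False
    then have "0 < cnorm n x" by linarith
    then obtain i where "i < n" "\<bar>x i\<bar> = cnorm n x" using Suc.IH by blast
    then show ?thesis using False by (auto intro!: exI[of _ i])
  qed auto
qed simp

lemma cnorm_cong: "(\<And>i. i < n \<Longrightarrow> x i = y i) \<Longrightarrow> cnorm n x = cnorm n y"
  by (induction n) auto

lemma cnorm_scale: "cnorm n (\<lambda>i. a * x i) = \<bar>a\<bar> * cnorm n x"
  by (induction n) (auto simp: abs_mult max_mult_distrib_left)

lemma cnorm_divide: "cnorm n (\<lambda>i. x i / a) = cnorm n x / \<bar>a\<bar>"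
  using cnorm_scale[of n "1 / a" x] by simp

lemma cnorm_Suc_shift: "cnorm (Suc n) x = max \<bar>x 0\<bar> (cnorm n (\<lambda>i. x (Suc i)))"
  by (induction n) (auto simp: max.assoc)

lemma cnorm_triangle: "cnorm n (\<lambda>i. x i - z i) \<le> cnorm n (\<lambda>i. x i - y i) + cnorm n (\<lambda>i. y i - z i)"
  unfolding cnorm_le_iff
proof (intro conjI allI impI)
  fix i assume i: "i < n"
  have "\<bar>x i - z i\<bar> \<le> \<bar>x i - y i\<bar> + \<bar>y i - z i\<bar>" by linarith
  then show "\<bar>x i - z i\<bar> \<le> cnorm n (\<lambda>i. x i - y i) + cnorm n (\<lambda>i. y i - z i)"
    using abs_le_cnorm[OF i, of "\<lambda>i. x i - y i"] abs_le_cnorm[OF i, of "\<lambda>i. y i - z i"] by linarith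
qed (simp add: cnorm_nonneg)

lemma continuous_on_nth [continuous_intros]:
  "continuous_on S (\<lambda>x::nat \<Rightarrow> real. x i)" "continuous_on S' (\<lambda>z::(nat \<Rightarrow> real) \<times> 'b::topological_space. fst z i)"
  by (rule continuous_on_subset[OF continuous_on_product_coordinates], simp)
     (rule continuous_on_product_then_coordinatewise[OF continuous_on_fst[OF continuous_on_id]])

lemma continuous_on_cnorm [continuous_intros]:
  fixes f :: "'a::topological_space \<Rightarrow> nat \<Rightarrow> real"
  assumes "continuous_on S f"
  shows "continuous_on S (\<lambda>x. cnorm n (f x))"
proof (induction n)
  case (Suc n)
  then show ?case
    using continuous_on_product_then_coordinatewise[OF assms, of n] by (auto intro!: continuous_intros)
qed simp

lemma cube_iff: "x \<in> cube n \<longleftrightarrow> (\<forall>i\<ge>n. x i = 0) \<and> (\<forall>i<n. \<bar>x i\<bar> \<le> 1)"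
  by (auto simp: cube_def cnorm_le_iff)

lemma cube_bd_subset: "cube_bd n \<subseteq> cube n"
  by (auto simp: cube_bd_def)

lemma cube_bd_0: "cube_bd 0 = {}"
  by (auto simp: cube_bd_def)

lemma zero_in_cube: "(\<lambda>_. 0) \<in> cube n"
  by (simp add: cube_iff)

lemma compact_cube: "compact (cube n)"
proof -
  have "cube n = Pi\<^sub>E UNIV (\<lambda>i. if i < n then {-1..1} else {0})"
    by (auto simp: cube_iff PiE_iff abs_le_iff split: if_splits; metis linorder_not_less minus_le_iff)
  moreover have "compactin (product_topology (\<lambda>_. euclideanreal) UNIV)
      (Pi\<^sub>E (UNIV::nat set) (\<lambda>i. if i < n then {-1..1} else {0}))"
    by (simp add: compactin_PiE)
  ultimately show ?thesis by (simp add: euclidean_product_topology)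
qed

lemma closed_cube_bd: "closed (cube_bd n)"
proof -
  have "cube_bd n = cube n \<inter> (\<lambda>x. cnorm n x) -` {1}" by (auto simp: cube_bd_def)
  moreover have "closed (cube n \<inter> (\<lambda>x. cnorm n x) -` {1})"
    by (rule continuous_closed_preimage)
       (auto intro!: continuous_intros compact_imp_closed compact_cube)
  ultimately show ?thesis by simp
qed

lemma compact_cube_bd: "compact (cube_bd n)"
  using compact_Int_closed[OF compact_cube closed_cube_bd, of n n] cube_bd_subset[of n]
  by (simp add: Int_absorb1)

lemma cube_scale: "x \<in> cube n \<Longrightarrow> \<bar>a\<bar> \<le> 1 \<Longrightarrow> (\<lambda>i. a * x i) \<in> cube n"
  by (auto simp: cube_iff abs_mult mult_le_one)

lemma cube_convex:
  assumes "x \<in> cube n" "y \<in> cube n" "0 \<le> t" "t \<le> 1"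
  shows "(\<lambda>i. (1 - t) * x i + t * y i) \<in> cube n"
  unfolding cube_iff
proof (intro conjI allI impI)
  fix i assume "i < n"
  then have "\<bar>x i\<bar> \<le> 1" "\<bar>y i\<bar> \<le> 1" using assms by (auto simp: cube_iff)
  have "\<bar>(1 - t) * x i + t * y i\<bar> \<le> (1 - t) * \<bar>x i\<bar> + t * \<bar>y i\<bar>"
    using assms by (auto intro!: order_trans[OF abs_triangle_ineq] simp: abs_mult)
  also have "\<dots> \<le> (1 - t) * 1 + t * 1"
    by (intro add_mono mult_left_mono) (use assms \<open>\<bar>x i\<bar> \<le> 1\<close> \<open>\<bar>y i\<bar> \<le> 1\<close> in auto)
  finally show "\<bar>(1 - t) * x i + t * y i\<bar> \<le> 1" by simp
qed (use assms in \<open>auto simp: cube_iff\<close>)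

lemma cube_normalize:
  assumes "\<forall>i\<ge>n. x i = 0" "0 < cnorm n x"
  shows "(\<lambda>i. x i / cnorm n x) \<in> cube_bd n"
  using assms by (auto simp: cube_bd_def cube_def cnorm_divide)

lemma continuous_map_top_of_set:
  "continuous_map (top_of_set S) (top_of_set T) f \<longleftrightarrow> continuous_on S f \<and> f \<in> S \<rightarrow> T"
  by (auto simp: continuous_map_in_subtopology)

text \<open>The cylinder over the cube is projected radially from the point (0, 2) above its top
  onto the bottom and the sides; the distance to the boundary in the maximum norm, 1 -
  \<open>cnorm n x\<close>, is the vanishing function.\<close>

lemma cofibred_pair_cube: "cofibred_pair (top_of_set (cube n)) (cube_bd n)"
  unfolding cofibred_pair_def
proof (intro conjI exI)
  show "continuous_map (top_of_set (cube n)) (top_of_set {0..1}) (\<lambda>x. 1 - cnorm n x)"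
    by (auto simp: continuous_map_top_of_set cube_def cnorm_nonneg intro!: continuous_intros)
  show "cube_bd n = {z \<in> topspace (top_of_set (cube n)). 1 - cnorm n z = 0}"
    by (auto simp: cube_bd_def)
  define m where "m = (\<lambda>x s. max (cnorm n x) (1 - s / 2))"
  define \<rho> where "\<rho> = (\<lambda>(x, s). ((\<lambda>i. x i / m x s), 2 - (2 - s) / m x s))"
  have m: "0 < m x s" "cnorm n x \<le> m x s" "1 - s / 2 \<le> m x s" "m x s \<le> 1" if "x \<in> cube n" "s \<in> {0..1}" for x s
    using that by (auto simp: m_def cube_def less_max_iff_disj)
  have mem: "\<rho> (x, s) \<in> cube n \<times> {0} \<union> cube_bd n \<times> {0..1}" if xs: "x \<in> cube n" "s \<in> {0..1}" for x s
  proof (cases "cnorm n x \<le> 1 - s / 2")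
    case True
    then have "m x s = 1 - s / 2" by (simp add: m_def)
    then have "2 - (2 - s) / m x s = 0" using m[OF xs] by (simp add: field_simps)
    moreover have "(\<lambda>i. x i / m x s) \<in> cube n"
      using m[OF xs] xs by (auto simp: cube_def cnorm_divide)
    ultimately show ?thesis by (simp add: \<rho>_def)
  next
    case False
    then have mx: "m x s = cnorm n x" by (simp add: m_def)
    then have "(\<lambda>i. x i / m x s) \<in> cube_bd n"
      using m[OF xs] xs by (auto intro!: cube_normalize simp: cube_def)
    moreover have "0 \<le> 2 - (2 - s) / m x s" "2 - (2 - s) / m x s \<le> 1"
      using m[OF xs] xs by (auto simp: field_simps)
    ultimately show ?thesis by (simp add: \<rho>_def)
  qed
  show "continuous_map (cyl (top_of_set (cube n))) (cyl (top_of_set (cube n))) \<rho>"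
    unfolding prod_topology_subtopology_eu continuous_map_top_of_set
  proof
    have "continuous_on (cube n \<times> {0..1}) (\<lambda>z. ((\<lambda>i. fst z i / m (fst z) (snd z)), 2 - (2 - snd z) / m (fst z) (snd z)))"
    proof -
      have "continuous_on (cube n \<times> {0..1}) (\<lambda>z. m (fst z) (snd z))"
        unfolding m_def by (intro continuous_intros) auto
      moreover have "\<forall>z\<in>cube n \<times> {0..1}. m (fst z) (snd z) \<noteq> 0" using m(1) by force
      ultimately show ?thesis by (intro continuous_intros) auto
    qed
    then show "continuous_on (cube n \<times> {0..1}) \<rho>" by (simp add: \<rho>_def case_prod_unfold)
    show "\<rho> \<in> cube n \<times> {0..1} \<rightarrow> cube n \<times> {0..1}"
      using mem cube_bd_subset by fastforce
  qed
  show "\<forall>x\<in>topspace (cyl (top_of_set (cube n))). \<rho> x \<in> topspace (top_of_set (cube n)) \<times> {0} \<union> cube_bd n \<times> {0..1}"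
    using mem by auto
  show "\<forall>x\<in>topspace (top_of_set (cube n)) \<times> {0} \<union> cube_bd n \<times> {0..1}. \<rho> x = x"
    by (auto simp: \<rho>_def m_def cube_def cube_bd_def max_def)
qed

section \<open>Connectivity as extension from the boundary of a cube\<close>

definition fillable :: "nat \<Rightarrow> 'y topology \<Rightarrow> ((nat \<Rightarrow> real) \<Rightarrow> 'y) \<Rightarrow> bool" where
  "fillable j T g \<longleftrightarrow>
     (\<exists>G. continuous_map (top_of_set (cube j)) T G \<and> (\<forall>x\<in>cube_bd j. G x = g x))"

text \<open>\<open>cube_connected r T\<close> says that \<open>T\<close> is \<open>(r - 1)\<close>-connected; for \<open>r = 0\<close> that it is nonempty.\<close>

definition cube_connected :: "nat \<Rightarrow> 'y topology \<Rightarrow> bool" where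
  "cube_connected r T \<longleftrightarrow>
     (\<forall>j\<le>r. \<forall>g. continuous_map (top_of_set (cube_bd j)) T g \<longrightarrow> fillable j T g)"

lemma fillable_cong: "fillable j T g \<Longrightarrow> (\<And>x. x \<in> cube_bd j \<Longrightarrow> g x = g' x) \<Longrightarrow> fillable j T g'"
  unfolding fillable_def by metis

text \<open>The filling at time 1 is placed on the concentric cube of half the size, and the
  homotopy, run backwards, fills the shell between it and the boundary.\<close>

lemma fillable_homotopy:
  assumes m: "continuous_map (cyl (top_of_set (cube_bd j))) T m" and fill: "fillable j T (\<lambda>x. m (x, 1))"
  shows "fillable j T (\<lambda>x. m (x, 0))"
proof -
  obtain G where G: "continuous_map (top_of_set (cube j)) T G" "\<And>x. x \<in> cube_bd j \<Longrightarrow> G x = m (x, 1)"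
    using fill unfolding fillable_def by blast
  define F where "F = (\<lambda>x. if cnorm j x \<le> 1/2 then G (\<lambda>i. 2 * x i)
      else m ((\<lambda>i. x i / cnorm j x), 2 - 2 * cnorm j x))"
  have "continuous_map (top_of_set (cube j)) T F"
    unfolding F_def
  proof (rule continuous_map_cases_le)
    show "continuous_map (top_of_set (cube j)) euclideanreal (cnorm j)"
      by (auto intro!: continuous_intros)
    show "continuous_map (subtopology (top_of_set (cube j)) {x \<in> topspace (top_of_set (cube j)). cnorm j x \<le> 1/2})
        T (\<lambda>x. G (\<lambda>i. 2 * x i))"
      by (rule continuous_map_compose'[OF _ G(1)])
         (auto simp: subtopology_subtopology continuous_map_top_of_set cube_def cnorm_scale intro!: continuous_intros)
    show "continuous_map (subtopology (top_of_set (cube j)) {x \<in> topspace (top_of_set (cube j)). 1/2 \<le> cnorm j x})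
        T (\<lambda>x. m ((\<lambda>i. x i / cnorm j x), 2 - 2 * cnorm j x))"
      by (rule continuous_map_compose'[OF _ m])
         (auto simp: subtopology_subtopology continuous_map_top_of_set cube_bd_def cube_def cnorm_divide
            intro!: continuous_intros)
    fix x assume x: "x \<in> topspace (top_of_set (cube j))" "cnorm j x = 1/2"
    then have "(\<lambda>i. 2 * x i) \<in> cube_bd j" by (auto simp: cube_bd_def cube_def cnorm_scale)
    then show "G (\<lambda>i. 2 * x i) = m ((\<lambda>i. x i / cnorm j x), 2 - 2 * cnorm j x)"
      using G(2) unfolding x(2) by (simp add: mult.commute)
  qed simp
  moreover have "F x = m (x, 0)" if "x \<in> cube_bd j" for x
    using that by (simp add: F_def cube_bd_def)
  ultimately show ?thesis unfolding fillable_def by blast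
qed

lemma cube_connected_retract:
  assumes "cube_connected r T" "continuous_map T' T i" "continuous_map T T' q"
    and "\<And>y. y \<in> topspace T' \<Longrightarrow> q (i y) = y"
  shows "cube_connected r T'"
  unfolding cube_connected_def
proof (intro allI impI)
  fix j g assume j: "j \<le> r" and g: "continuous_map (top_of_set (cube_bd j)) T' g"
  have "continuous_map (top_of_set (cube_bd j)) T (\<lambda>x. i (g x))"
    by (rule continuous_map_compose'[OF g assms(2)])
  then obtain G where G: "continuous_map (top_of_set (cube j)) T G" "\<forall>x\<in>cube_bd j. G x = i (g x)"
    using assms(1) j unfolding cube_connected_def fillable_def by blast
  have "continuous_map (top_of_set (cube j)) T' (\<lambda>x. q (G x))"
    by (rule continuous_map_compose'[OF G(1) assms(3)])
  moreover have "\<forall>x\<in>cube_bd j. q (G x) = g x"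
    using G(2) assms(4) continuous_map_funspace[OF g] by auto
  ultimately show "fillable j T' g" unfolding fillable_def by blast
qed

text \<open>Identifies cube x [0,1] with the next cube. Time t becomes coordinate 0 with value 1 -
  2t, so that \<open>sphere_base\<close> is the centre of the face t = 0.\<close>

definition prism :: "(nat \<Rightarrow> real) \<times> real \<Rightarrow> nat \<Rightarrow> real" where
  "prism = (\<lambda>(x, t) i. case i of 0 \<Rightarrow> 1 - 2 * t | Suc i \<Rightarrow> x i)"

definition unprism :: "(nat \<Rightarrow> real) \<Rightarrow> (nat \<Rightarrow> real) \<times> real" where
  "unprism y = (\<lambda>i. y (Suc i), (1 - y 0) / 2)"

lemma unprism_prism [simp]: "unprism (prism z) = z"
  by (cases z) (simp add: prism_def unprism_def)

lemma prism_unprism [simp]: "prism (unprism y) = y"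
  by (rule ext) (simp add: prism_def unprism_def field_simps split: nat.split)

lemma cnorm_prism: "cnorm (Suc n) (prism (x, t)) = max \<bar>1 - 2 * t\<bar> (cnorm n x)"
  unfolding cnorm_Suc_shift by (simp add: prism_def)

lemma prism_in_cube: "prism (x, t) \<in> cube (Suc n) \<longleftrightarrow> x \<in> cube n \<and> t \<in> {0..1}"
proof -
  have "(\<forall>i\<ge>Suc n. prism (x, t) i = 0) \<longleftrightarrow> (\<forall>i\<ge>n. x i = 0)"
    by (auto simp: prism_def Suc_le_eq less_Suc_eq_le split: nat.split)
  then show ?thesis
    by (simp add: cube_def cnorm_prism del: cnorm.simps) (auto simp: abs_le_iff)
qed

lemma prism_in_cube_bd:
  "prism (x, t) \<in> cube_bd (Suc n) \<longleftrightarrow> x \<in> cube n \<and> t \<in> {0..1} \<and> (x \<in> cube_bd n \<or> t = 0 \<or> t = 1)"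
proof -
  have "\<bar>1 - 2 * t\<bar> = 1 \<longleftrightarrow> t = 0 \<or> t = 1" by (auto simp: abs_if)
  moreover have "max a c = 1 \<longleftrightarrow> a = 1 \<or> c = 1" if "a \<le> 1" "c \<le> 1" for a c :: real
    using that by (auto simp: max_def)
  ultimately have "cnorm (Suc n) (prism (x, t)) = 1 \<longleftrightarrow> (t = 0 \<or> t = 1) \<or> cnorm n x = 1"
    if "x \<in> cube n" "t \<in> {0..1}"
    using that unfolding cnorm_prism cube_def by (auto simp: abs_le_iff)
  then show ?thesis unfolding cube_bd_def mem_Collect_eq prism_in_cube by blast
qed

lemma continuous_on_prism: "continuous_on S prism"
proof (rule continuous_on_coordinatewise_then_product)
  fix i
  show "continuous_on S (\<lambda>z. prism z i)"
    by (cases i) (auto simp: prism_def case_prod_unfold intro!: continuous_intros)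
qed

lemma continuous_on_unprism: "continuous_on S unprism"
  unfolding unprism_def[abs_def] by (intro continuous_intros) auto

section \<open>Euclidean discs and spheres compared with cubes\<close>

definition enorm :: "nat \<Rightarrow> (nat \<Rightarrow> real) \<Rightarrow> real" where
  "enorm n x = sqrt (\<Sum>i<n. (x i)\<^sup>2)"

definition disc :: "nat \<Rightarrow> (nat \<Rightarrow> real) set" where
  "disc n = {x. (\<forall>i\<ge>n. x i = 0) \<and> enorm n x \<le> 1}"

lemma ndisc_eq: "ndisc n = top_of_set (disc n)"
proof -
  have "{x. (\<forall>i\<ge>n. x i = 0)} \<inter> {x. (\<Sum>i<n. (x i)\<^sup>2) \<le> 1} = disc n"
    by (auto simp: disc_def enorm_def)
  then show ?thesis
    by (simp add: ndisc_def Euclidean_space_def subtopology_subtopology euclidean_product_topology)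
qed

lemma nsphere_eq: "nsphere n = top_of_set {x \<in> disc (Suc n). enorm (Suc n) x = 1}"
proof -
  have "{x. (\<forall>i\<ge>Suc n. x i = 0)} \<inter> {x. (\<Sum>i\<le>n. (x i)\<^sup>2) = 1} = {x \<in> disc (Suc n). enorm (Suc n) x = 1}"
    by (auto simp: disc_def enorm_def lessThan_Suc_atMost)
  then show ?thesis
    by (simp add: nsphere_def Euclidean_space_def subtopology_subtopology euclidean_product_topology)
qed

lemma enorm_nonneg: "0 \<le> enorm n x"
  by (simp add: enorm_def sum_nonneg)

lemma abs_le_enorm: "i < n \<Longrightarrow> \<bar>x i\<bar> \<le> enorm n x"
  unfolding enorm_def by (rule real_le_rsqrt) (simp add: member_le_sum[of i "{..<n}" "\<lambda>i. (x i)\<^sup>2"])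

lemma enorm_scale: "enorm n (\<lambda>i. a * x i) = \<bar>a\<bar> * enorm n x"
  by (simp add: enorm_def power_mult_distrib real_sqrt_mult flip: sum_distrib_left)

lemma enorm_eq_0_iff: "enorm n x = 0 \<longleftrightarrow> (\<forall>i<n. x i = 0)"
  by (auto simp: enorm_def sum_nonneg_eq_0_iff)

lemma cnorm_eq_0_iff: "cnorm n x = 0 \<longleftrightarrow> (\<forall>i<n. x i = 0)"
  using cnorm_le_iff[of n x 0] cnorm_nonneg[of n x] by auto

lemma continuous_on_enorm [continuous_intros]:
  fixes f :: "'a::topological_space \<Rightarrow> nat \<Rightarrow> real"
  assumes "continuous_on S f"
  shows "continuous_on S (\<lambda>x. enorm n (f x))"
  unfolding enorm_def
  by (intro continuous_intros continuous_on_product_then_coordinatewise[OF assms])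

lemma enorm_cong: "(\<And>i. i < n \<Longrightarrow> x i = y i) \<Longrightarrow> enorm n x = enorm n y"
  by (simp add: enorm_def)

lemma norm_sphere_base: "cnorm (Suc n) sphere_base = 1" "enorm (Suc n) sphere_base = 1"
proof -
  show "cnorm (Suc n) sphere_base = 1"
    by (induction n) (auto simp: sphere_base_def)
  have "(\<Sum>i<Suc n. (sphere_base i)\<^sup>2) = (\<Sum>i<Suc n. if i = 0 then 1 else 0)"
    by (rule sum.cong) (auto simp: sphere_base_def)
  then show "enorm (Suc n) sphere_base = 1" unfolding enorm_def by (simp add: sum.delta)
qed

lemma sphere_base_in_cube_bd: "sphere_base \<in> cube_bd (Suc n)"
proof -
  have "\<forall>i\<ge>Suc n. sphere_base i = 0" by (auto simp: sphere_base_def)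
  then show ?thesis by (simp only: cube_bd_def cube_def norm_sphere_base mem_Collect_eq) simp
qed

text \<open>Radial rescaling by the quotient of the two norms, which vanish at the same points;
  there, division by zero yields the correct value 0. Continuity of the inverse comes from
  compactness of the cube.\<close>

lemma cube_disc_homeomorphism:
  obtains \<theta> \<theta>' where "homeomorphism (cube n) (disc n) \<theta> \<theta>'"
    "\<And>x. x \<in> cube n \<Longrightarrow> enorm n (\<theta> x) = cnorm n x" "n > 0 \<Longrightarrow> \<theta> sphere_base = sphere_base"
proof -
  define \<theta> where "\<theta> = (\<lambda>x i. if i < n then cnorm n x / enorm n x * x i else 0)"
  define \<tau> where "\<tau> = (\<lambda>x i. if i < n then enorm n x / cnorm n x * x i else 0)"
  have z: "enorm n x = 0 \<longleftrightarrow> cnorm n x = 0" for x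
    by (simp add: enorm_eq_0_iff cnorm_eq_0_iff)
  have e\<theta>: "enorm n (\<theta> x) = cnorm n x" and c\<theta>: "cnorm n (\<theta> x) = cnorm n x / enorm n x * cnorm n x" for x
  proof -
    have "enorm n (\<theta> x) = enorm n (\<lambda>i. cnorm n x / enorm n x * x i)" by (rule enorm_cong) (simp add: \<theta>_def)
    then show "enorm n (\<theta> x) = cnorm n x"
      using cnorm_nonneg[of n x] enorm_nonneg[of n x] z[of x] unfolding enorm_scale by auto
    have "cnorm n (\<theta> x) = cnorm n (\<lambda>i. cnorm n x / enorm n x * x i)" by (rule cnorm_cong) (simp add: \<theta>_def)
    then show "cnorm n (\<theta> x) = cnorm n x / enorm n x * cnorm n x"
      using cnorm_nonneg[of n x] enorm_nonneg[of n x] unfolding cnorm_scale by simp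
  qed
  have e\<tau>: "enorm n (\<tau> x) = enorm n x / cnorm n x * enorm n x" and c\<tau>: "cnorm n (\<tau> x) = enorm n x" for x
  proof -
    have "enorm n (\<tau> x) = enorm n (\<lambda>i. enorm n x / cnorm n x * x i)" by (rule enorm_cong) (simp add: \<tau>_def)
    then show "enorm n (\<tau> x) = enorm n x / cnorm n x * enorm n x"
      using cnorm_nonneg[of n x] enorm_nonneg[of n x] unfolding enorm_scale by simp
    have "cnorm n (\<tau> x) = cnorm n (\<lambda>i. enorm n x / cnorm n x * x i)" by (rule cnorm_cong) (simp add: \<tau>_def)
    then show "cnorm n (\<tau> x) = enorm n x"
      using cnorm_nonneg[of n x] enorm_nonneg[of n x] z[of x] unfolding cnorm_scale by auto
  qed
  have \<tau>\<theta>: "\<tau> (\<theta> x) = x" if "\<forall>i\<ge>n. x i = 0" for x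
  proof
    fix i
    show "\<tau> (\<theta> x) i = x i"
      using that cnorm_eq_0_iff[of n x] z[of x]
      by (auto simp: \<tau>_def e\<theta> c\<theta>) (auto simp: \<theta>_def)
  qed
  have \<theta>\<tau>: "\<theta> (\<tau> x) = x" if "\<forall>i\<ge>n. x i = 0" for x
  proof
    fix i
    show "\<theta> (\<tau> x) i = x i"
      using that cnorm_eq_0_iff[of n x] z[of x]
      by (auto simp: \<theta>_def e\<tau> c\<tau>) (auto simp: \<tau>_def)
  qed
  have "continuous_on UNIV (\<lambda>x. \<theta> x i)" for i
  proof (cases "i < n")
    case i: True
    have co: "isCont (enorm n) x" "isCont (cnorm n) x" "isCont (\<lambda>x::nat \<Rightarrow> real. x i) x" for x
      by (auto intro!: continuous_on_interior[of UNIV] continuous_intros)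
    have "isCont (\<lambda>x. \<theta> x i) x" for x
    proof (cases "enorm n x = 0")
      case False
      then show ?thesis unfolding \<theta>_def using co i by (auto intro!: continuous_intros)
    next
      case True
      \<comment> \<open>Where the norms vanish the quotient has no useful limit, but each coordinate
        of \<theta> is bounded by its Euclidean norm, which is \<open>cnorm n\<close> of the
        argument and tends to 0.\<close>
      have "((\<lambda>y. \<theta> y i) \<longlongrightarrow> 0) (at x)"
      proof (rule Lim_null_comparison)
        have "norm (\<theta> y i) \<le> cnorm n y" for y
        proof -
          have "\<bar>\<theta> y i\<bar> \<le> enorm n (\<theta> y)" by (rule abs_le_enorm[OF i])
          then show ?thesis by (simp add: e\<theta>)
        qed
        then show "\<forall>\<^sub>F y in at x. norm (\<theta> y i) \<le> cnorm n y" by simp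
        show "(cnorm n \<longlongrightarrow> 0) (at x)" using co(2)[of x] True z[of x] by (simp add: isCont_def)
      qed
      moreover have "\<theta> x i = 0" using True by (simp add: \<theta>_def)
      ultimately show ?thesis by (simp add: isCont_def)
    qed
    then show ?thesis by (simp add: continuous_at_imp_continuous_on)
  qed (simp add: \<theta>_def)
  then have "continuous_on UNIV \<theta>" by (rule continuous_on_coordinatewise_then_product)
  then have 1: "continuous_on (cube n) \<theta>" by (rule continuous_on_subset) simp
  have 2: "inj_on \<theta> (cube n)"
    by (rule inj_on_inverseI[of _ \<tau>]) (simp add: \<tau>\<theta> cube_def)
  have 3: "\<theta> ` cube n = disc n"
  proof
    show "\<theta> ` cube n \<subseteq> disc n" by (auto simp: cube_def disc_def e\<theta>) (simp add: \<theta>_def)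
    show "disc n \<subseteq> \<theta> ` cube n"
    proof
      fix y assume y: "y \<in> disc n"
      then have "y = \<theta> (\<tau> y)" by (simp add: \<theta>\<tau> disc_def)
      moreover have "\<tau> y \<in> cube n" using y by (simp add: cube_def disc_def c\<tau>) (simp add: \<tau>_def)
      ultimately show "y \<in> \<theta> ` cube n" by blast
    qed
  qed
  obtain \<theta>' where "homeomorphism (cube n) (disc n) \<theta> \<theta>'"
    using homeomorphism_compact[OF compact_cube 1 3 2] by blast
  moreover have "\<theta> sphere_base = sphere_base" if "n > 0"
    using that norm_sphere_base[of "n - 1"] by (auto simp: \<theta>_def fun_eq_iff) (auto simp: sphere_base_def)
  ultimately show thesis using that e\<theta> by blast
qed

section \<open>Grids\<close>

definition lo :: "real set \<Rightarrow> real \<Rightarrow> real" where "lo V t = Max {v \<in> V. v \<le> t}"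
definition hi :: "real set \<Rightarrow> real \<Rightarrow> real" where "hi V t = Min {v \<in> V. t \<le> v}"

text \<open>The map \<open>collapse\<close> preserves every edge of the grid and is locally constant near
  the vertices.\<close>

definition collapse :: "real set \<Rightarrow> real \<Rightarrow> real" where
  "collapse V t = max (lo V t) (min (hi V t) (4 * t - 3 * (lo V t + hi V t) / 2))"

text \<open>Degenerate edges, with l = u a vertex, are included, so that products of edges give
  cells of all dimensions.\<close>

definition edges :: "real set \<Rightarrow> (real \<times> real) set" where
  "edges V = {(l, u). l \<in> V \<and> u \<in> V \<and> l \<le> u \<and> (\<forall>v\<in>V. \<not> (l < v \<and> v < u))}"

text \<open>The interior, relative to [-1,1], of the set that \<open>collapse\<close> sends to
  vertices. Openness is what lets the extended maps be defined on open sets.\<close>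

definition collapsed :: "real set \<Rightarrow> real set" where
  "collapsed V = {t \<in> {-1..1}. \<exists>\<epsilon>>0. \<forall>s\<in>{-1..1}. \<bar>s - t\<bar> < \<epsilon> \<longrightarrow> collapse V s \<in> V}"

text \<open>g bounds the distance of distinct vertices from below and makes the regions on which
  \<open>collapse\<close> is constant uniformly large; \<delta> bounds the edges from above and
  keeps \<open>collapse\<close> close to the identity.\<close>

locale grid =
  fixes V :: "real set" and g \<delta> :: real
  assumes finite_V: "finite V" and ends: "-1 \<in> V" "1 \<in> V" and V_sub: "V \<subseteq> {-1..1}"
    and g_pos: "0 < g" and gap: "\<And>v w. v \<in> V \<Longrightarrow> w \<in> V \<Longrightarrow> v \<noteq> w \<Longrightarrow> g \<le> \<bar>v - w\<bar>"
    and mesh: "\<And>l u. (l, u) \<in> edges V \<Longrightarrow> u - l \<le> \<delta>"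
begin

lemma lo: assumes "t \<in> {-1..1}" shows "lo V t \<in> V" "lo V t \<le> t" "v \<in> V \<Longrightarrow> v \<le> t \<Longrightarrow> v \<le> lo V t"
proof -
  have *: "finite {v \<in> V. v \<le> t}" "{v \<in> V. v \<le> t} \<noteq> {}" using finite_V ends assms by auto
  show "lo V t \<in> V" "lo V t \<le> t" using Max_in[OF *] by (auto simp: lo_def)
  show "v \<in> V \<Longrightarrow> v \<le> t \<Longrightarrow> v \<le> lo V t" using * by (simp add: lo_def)
qed

lemma hi: assumes "t \<in> {-1..1}" shows "hi V t \<in> V" "t \<le> hi V t" "v \<in> V \<Longrightarrow> t \<le> v \<Longrightarrow> hi V t \<le> v"
proof -
  have *: "finite {v \<in> V. t \<le> v}" "{v \<in> V. t \<le> v} \<noteq> {}" using finite_V ends assms by auto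
  show "hi V t \<in> V" "t \<le> hi V t" using Min_in[OF *] by (auto simp: hi_def)
  show "v \<in> V \<Longrightarrow> t \<le> v \<Longrightarrow> hi V t \<le> v" using * by (simp add: hi_def)
qed

lemma lo_hi_edge: "t \<in> {-1..1} \<Longrightarrow> (lo V t, hi V t) \<in> edges V"
  using lo[of t] hi[of t] by (force simp: edges_def)

lemma edge_sub: "(l, u) \<in> edges V \<Longrightarrow> l \<in> {-1..1} \<and> u \<in> {-1..1}"
  using V_sub by (auto simp: edges_def)

lemma edge_contains:
  assumes "(l, u) \<in> edges V" "l \<le> t" "t \<le> u"
  shows "l \<le> lo V t" "hi V t \<le> u"
  using assms lo(3)[of t l] hi(3)[of t u] edge_sub[OF assms(1)] by (auto simp: edges_def)

lemma edge_interior: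
  assumes "(l, u) \<in> edges V" "l < t" "t < u"
  shows "lo V t = l" "hi V t = u"
proof -
  have t: "t \<in> {-1..1}" using assms edge_sub by fastforce
  have "\<not> (l < lo V t \<and> lo V t < u)" "\<not> (l < hi V t \<and> hi V t < u)"
    using assms(1) lo(1)[OF t] hi(1)[OF t] by (auto simp: edges_def)
  then show "lo V t = l" "hi V t = u"
    using edge_contains[of l u t] assms lo(2)[OF t] hi(2)[OF t] by linarith+
qed

lemma lo_hi_vertex: assumes "v \<in> V" shows "lo V v = v" "hi V v = v"
proof -
  have v: "v \<in> {-1..1}" using assms V_sub by auto
  show "lo V v = v" using lo[OF v] assms by (meson antisym order_refl)
  show "hi V v = v" using hi[OF v] assms by (meson antisym order_refl)
qed

text \<open>At a vertex \<open>lo\<close> and \<open>hi\<close> coincide, so the definition uses a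
  degenerate edge there. Truncation gives the same value for every edge ending at the vertex, and
  this makes the pieces fit together continuously.\<close>

lemma collapse_edge:
  assumes "(l, u) \<in> edges V" "l \<le> t" "t \<le> u"
  shows "collapse V t = max l (min u (4 * t - 3 * (l + u) / 2))"
proof -
  have "l \<in> V" "u \<in> V" using assms by (auto simp: edges_def)
  consider "t = l" | "t = u" | "l < t" "t < u" using assms by linarith
  then show ?thesis
  proof cases
    case 1
    have "4 * l - 3 * (l + u) / 2 \<le> l" using assms by (simp add: field_simps)
    then have "max l (min u (4 * l - 3 * (l + u) / 2)) = l" by (intro max_absorb1 min.coboundedI2)
    moreover have "collapse V l = l" by (simp add: collapse_def lo_hi_vertex[OF \<open>l \<in> V\<close>])
    ultimately show ?thesis unfolding 1 by simp
  next
    case 2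
    have "u \<le> 4 * u - 3 * (l + u) / 2" using assms by (simp add: field_simps)
    then have "max l (min u (4 * u - 3 * (l + u) / 2)) = u"
      using assms by (simp only: min_absorb1 max_absorb2 order_trans[OF assms(2,3)])
    moreover have "collapse V u = u" by (simp add: collapse_def lo_hi_vertex[OF \<open>u \<in> V\<close>])
    ultimately show ?thesis unfolding 2 by simp
  next
    case 3
    then show ?thesis using edge_interior[OF assms(1)] by (simp add: collapse_def)
  qed
qed

lemma collapse_bounds:
  assumes "(l, u) \<in> edges V" "l \<le> t" "t \<le> u"
  shows "l \<le> collapse V t" "collapse V t \<le> u"
  using assms unfolding collapse_edge[OF assms] by auto

lemma collapse_vertex: "v \<in> V \<Longrightarrow> collapse V v = v"
  using lo_hi_vertex by (simp add: collapse_def)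

lemma collapse_in: "t \<in> {-1..1} \<Longrightarrow> collapse V t \<in> {-1..1}"
  using collapse_bounds[OF lo_hi_edge, of t] lo(1,2)[of t] hi(1,2)[of t] V_sub by fastforce

lemma edge_mesh: "(l, u) \<in> edges V \<Longrightarrow> l \<le> s \<Longrightarrow> s \<le> u \<Longrightarrow> l \<le> t \<Longrightarrow> t \<le> u \<Longrightarrow> \<bar>s - t\<bar> \<le> \<delta>"
  using mesh[of l u] by linarith

lemma collapse_close: "t \<in> {-1..1} \<Longrightarrow> \<bar>t - collapse V t\<bar> \<le> \<delta>"
  using edge_mesh[OF lo_hi_edge] lo(2) hi(2) collapse_bounds[OF lo_hi_edge] by blast

lemma continuous_on_collapse: "continuous_on {-1..1} (collapse V)"
proof -
  have "finite (edges V)"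
    by (rule finite_subset[of _ "V \<times> V"]) (auto simp: edges_def finite_V)
  moreover have "continuous_on {l..u} (collapse V)" if "(l, u) \<in> edges V" for l u
  proof -
    have "continuous_on {l..u} (\<lambda>t. max l (min u (4 * t - 3 * (l + u) / 2)))"
      by (intro continuous_intros)
    then show ?thesis
      by (rule continuous_on_cong[THEN iffD1, rotated 2]) (simp_all add: collapse_edge[OF that])
  qed
  ultimately have "continuous_on (\<Union>e\<in>edges V. {fst e..snd e}) (collapse V)"
    by (intro continuous_on_closed_Union) auto
  moreover have "{-1..1} \<subseteq> (\<Union>e\<in>edges V. {fst e..snd e})"
  proof
    fix t :: real assume "t \<in> {-1..1}"
    then show "t \<in> (\<Union>e\<in>edges V. {fst e..snd e})"
      using lo(2)[of t] hi(2)[of t] by (intro UN_I[OF lo_hi_edge]) auto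
  qed
  ultimately show ?thesis by (rule continuous_on_subset)
qed

text \<open>Before truncation the map has slope 4 about the midpoint of an edge. On an edge of
  length w it is therefore linear only on the middle quarter and constant up to distance 3w/8 from
  each end, and w is at least g.\<close>

lemma collapse_near:
  assumes "v \<in> V" "s \<in> {-1..1}" "\<bar>s - v\<bar> \<le> 3 * g / 8"
  shows "collapse V s = v"
proof (cases "s = v")
  case True
  then show ?thesis using collapse_vertex assms by simp
next
  case False
  have lv: "lo V s \<in> V" and hv: "hi V s \<in> V" using lo hi assms by auto
  show ?thesis
  proof (cases "v < s")
    case True
    have "lo V s = v"
    proof (rule ccontr)
      assume "lo V s \<noteq> v"
      then have "g \<le> \<bar>lo V s - v\<bar>" using gap[OF lv assms(1)] by simp
      moreover have "v \<le> lo V s" "lo V s \<le> s" using lo[OF assms(2)] True assms(1) by auto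
      ultimately show False using assms g_pos True by linarith
    qed
    moreover have "g \<le> hi V s - v"
      using gap[OF hv assms(1)] hi(2)[OF assms(2)] True by (cases "hi V s = v") auto
    ultimately have "4 * s - 3 * (lo V s + hi V s) / 2 \<le> v"
      using assms(3) True by (simp add: field_simps)
    then show ?thesis using \<open>lo V s = v\<close> by (simp add: collapse_def)
  next
    case False
    then have "s < v" using \<open>s \<noteq> v\<close> by simp
    have "hi V s = v"
    proof (rule ccontr)
      assume "hi V s \<noteq> v"
      then have "g \<le> \<bar>hi V s - v\<bar>" using gap[OF hv assms(1)] by simp
      moreover have "hi V s \<le> v" "s \<le> hi V s" using hi[OF assms(2)] \<open>s < v\<close> assms(1) by auto
      ultimately show False using assms g_pos \<open>s < v\<close> by linarith
    qed
    moreover have gl: "g \<le> v - lo V s"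
      using gap[OF lv assms(1)] lo(2)[OF assms(2)] \<open>s < v\<close> by (cases "lo V s = v") auto
    ultimately have "v \<le> 4 * s - 3 * (lo V s + hi V s) / 2"
      using assms(3) \<open>s < v\<close> by (simp add: field_simps)
    then show ?thesis using \<open>hi V s = v\<close> gl g_pos by (simp add: collapse_def)
  qed
qed

lemma near_collapsed:
  assumes "v \<in> V" "t \<in> {-1..1}" "\<bar>t - v\<bar> < 3 * g / 8"
  shows "t \<in> collapsed V"
proof -
  have "collapse V s \<in> V" if "s \<in> {-1..1}" "\<bar>s - t\<bar> < 3 * g / 8 - \<bar>t - v\<bar>" for s
    using collapse_near[OF assms(1) that(1)] that(2) assms(1) by (simp add: abs_if split: if_splits)
  then show ?thesis using assms by (auto simp: collapsed_def intro!: exI[of _ "3 * g / 8 - \<bar>t - v\<bar>"])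
qed

lemma collapse_collapsed: "t \<in> collapsed V \<Longrightarrow> collapse V t \<in> V"
  by (auto simp: collapsed_def)

lemma openin_collapsed: "openin (top_of_set {-1..1}) (collapsed V)"
  unfolding openin_euclidean_subtopology_iff
proof (intro conjI ballI)
  fix t assume "t \<in> collapsed V"
  then obtain \<epsilon> where \<epsilon>: "\<epsilon> > 0" "\<forall>s\<in>{-1..1}. \<bar>s - t\<bar> < \<epsilon> \<longrightarrow> collapse V s \<in> V"
    by (auto simp: collapsed_def)
  have "s \<in> collapsed V" if s: "s \<in> {-1..1}" "dist s t < \<epsilon> / 2" for s
  proof -
    have "collapse V r \<in> V" if "r \<in> {-1..1}" "\<bar>r - s\<bar> < \<epsilon> / 2" for r
    proof -
      have "\<bar>r - t\<bar> < \<epsilon>" using that(2) s(2) by (simp add: dist_real_def abs_if split: if_splits)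
      then show ?thesis using \<epsilon>(2) that by blast
    qed
    then show ?thesis using s \<epsilon> by (auto simp: collapsed_def intro!: exI[of _ "\<epsilon> / 2"])
  qed
  then show "\<exists>e>0. \<forall>s\<in>{-1..1}. dist s t < e \<longrightarrow> s \<in> collapsed V"
    using \<epsilon>(1) by (intro exI[of _ "\<epsilon> / 2"]) auto
qed (auto simp: collapsed_def)

end

text \<open>Counted from -1, V consists of the even multiples of h and W of the odd ones together
  with the two ends. V collapses within 3h/4 of an even point; every remaining point is within h/4
  of an odd one, while W collapses within 3h/8.\<close>

lemma interleaved_grids:
  assumes "0 < \<delta>"
  obtains V W g h where "grid V g \<delta>" "grid W h \<delta>" "collapsed V \<union> collapsed W = {-1..1}"
proof -
  obtain M :: nat where M: "M > 0" "2 / real M \<le> \<delta>"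
  proof -
    obtain M :: nat where M: "2 / \<delta> < real M" using reals_Archimedean2 by blast
    have "0 < 2 / \<delta>" using assms by simp
    then have "M > 0" using M by (metis gr0I less_asym of_nat_0)
    moreover have "2 / real M \<le> \<delta>" using M assms \<open>M > 0\<close> by (simp add: field_simps)
    ultimately show ?thesis using that by blast
  qed
  define h where "h = 1 / real M"
  have h: "h > 0" "2 * h \<le> \<delta>" "real M * h = 1" using M by (auto simp: h_def)
  define pt where "pt = (\<lambda>k::int. -1 + real_of_int k * h)"
  define V where "V = (\<lambda>a::nat. pt (2 * int a)) ` {..M}"
  \<comment> \<open>The ends -1 and 1 have to be vertices, and they are only h away from their
    neighbours; hence the gap h for W in place of 2h.\<close>
  define W where "W = {-1, 1} \<union> (\<lambda>a::nat. pt (2 * int a + 1)) ` {..<M}"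
  have diff: "c * h \<le> \<bar>pt k - pt l\<bar>" if "c \<le> \<bar>real_of_int (k - l)\<bar>" for k l c
  proof -
    have "\<bar>pt k - pt l\<bar> = \<bar>real_of_int (k - l)\<bar> * h"
      using h(1) by (simp add: pt_def abs_mult left_diff_distrib flip: left_diff_distrib)
    then show ?thesis using that h(1) by (simp add: mult_right_mono)
  qed
  have end1: "pt (2 * int M) = 1" using h(3) by (simp add: pt_def)
  have end0: "pt 0 = -1" by (simp add: pt_def)
  have le1: "pt k \<le> 1 \<longleftrightarrow> k \<le> 2 * int M" for k
  proof -
    have "pt k \<le> pt (2 * int M) \<longleftrightarrow> k \<le> 2 * int M"
      using h(1) by (simp add: pt_def mult_le_cancel_right) linarith
    then show ?thesis by (simp add: end1)
  qed
  have ge1: "-1 \<le> pt k \<longleftrightarrow> 0 \<le> k" for k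
    unfolding pt_def using h(1) by (auto simp: zero_le_mult_iff)
  have step: "pt (k + 1) = pt k + h" "pt (k + 2) = pt k + 2 * h" for k
    by (simp_all add: pt_def algebra_simps)
  have gV: "grid V (2 * h) \<delta>"
  proof
    show "finite V" by (simp add: V_def)
    show "-1 \<in> V" using end0 by (auto simp: V_def intro!: image_eqI[of _ _ 0])
    show "1 \<in> V" using end1 by (auto simp: V_def intro!: image_eqI[of _ _ M])
    show "V \<subseteq> {-1..1}" by (auto simp: V_def le1 ge1)
    show "0 < 2 * h" using h by simp
    show "2 * h \<le> \<bar>v - w\<bar>" if vw: "v \<in> V" "w \<in> V" "v \<noteq> w" for v w
    proof -
      obtain a b where ab: "v = pt (2 * int a)" "w = pt (2 * int b)" using vw by (auto simp: V_def)
      then have "a \<noteq> b" using vw by auto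
      then have "2 \<le> \<bar>real_of_int (2 * int a - 2 * int b)\<bar>" by (simp add: abs_if; linarith)
      then show ?thesis unfolding ab by (rule diff)
    qed
    show "u - l \<le> \<delta>" if e: "(l, u) \<in> edges V" for l u
    proof (cases "l < u")
      case True
      obtain a where a: "l = pt (2 * int a)" "a \<le> M" using e by (auto simp: edges_def V_def)
      obtain b where b: "u = pt (2 * int b)" "b \<le> M" using e by (auto simp: edges_def V_def)
      have "a \<noteq> M" using True a b end1 le1[of "2 * int b"] by auto
      then have "pt (2 * int (Suc a)) \<in> V" using a(2) unfolding V_def by (intro imageI) auto
      then have "pt (2 * int a + 2) \<in> V" by (simp add: algebra_simps)
      then have "\<not> (l < l + 2 * h \<and> l + 2 * h < u)" using e a step(2)[of "2 * int a"] by (auto simp: edges_def)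
      then show ?thesis using h by linarith
    qed (use assms in auto)
  qed
  have gW: "grid W h \<delta>"
  proof
    show "finite W" by (simp add: W_def)
    show "-1 \<in> W" "1 \<in> W" by (auto simp: W_def)
    show "W \<subseteq> {-1..1}" by (auto simp: W_def le1 ge1)
    show "0 < h" using h by simp
    have Wpt: "\<exists>k. v = pt k" if "v \<in> W" for v
      using that end0[symmetric] end1[symmetric] by (auto simp: W_def)
    show "h \<le> \<bar>v - w\<bar>" if vw: "v \<in> W" "w \<in> W" "v \<noteq> w" for v w
    proof -
      obtain k l where kl: "v = pt k" "w = pt l" using Wpt vw by blast
      then have "k \<noteq> l" using vw by auto
      then have "1 \<le> \<bar>real_of_int (k - l)\<bar>" by (simp add: abs_if; linarith)
      then show ?thesis unfolding kl using diff[of 1 k l] by simp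
    qed
    show "u - l \<le> \<delta>" if e: "(l, u) \<in> edges W" for l u
    proof (cases "l < u")
      case True
      have lu: "l \<in> W" "u \<in> W" and no: "\<And>v. v \<in> W \<Longrightarrow> \<not> (l < v \<and> v < u)" using e by (auto simp: edges_def)
      have u1: "u \<le> 1" using lu(2) by (auto simp: W_def le1)
      consider "l = -1" | "l = 1" | a where "l = pt (2 * int a + 1)" "a < M" using lu by (auto simp: W_def)
      then show ?thesis
      proof cases
        case 1
        have "pt (2 * int 0 + 1) \<in> W" using M(1) unfolding W_def by blast
        then have "pt 1 \<in> W" by simp
        then have "\<not> (l < l + h \<and> l + h < u)" using no step(1)[of 0] 1 end0 by auto
        then show ?thesis using h by linarith
      next
        case 2
        then show ?thesis using True u1 by simp
      next
        case 3
        show ?thesis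
        proof (cases "Suc a < M")
          case True
          then have "pt (2 * int (Suc a) + 1) \<in> W" unfolding W_def by blast
          then have "pt ((2 * int a + 1) + 2) \<in> W" by (simp add: algebra_simps)
          then have "\<not> (l < l + 2 * h \<and> l + 2 * h < u)" using no step(2)[of "2 * int a + 1"] 3 by auto
          then show ?thesis using h by linarith
        next
          case False
          then have "2 * int a + 1 + 1 = 2 * int M" using 3 by simp
          then have "l + h = 1" using step(1)[of "2 * int a + 1"] end1 3 by simp
          then show ?thesis using u1 h by linarith
        qed
      qed
    qed (use assms in auto)
  qed
  have "t \<in> collapsed V \<union> collapsed W" if t: "t \<in> {-1..1}" for t
  proof -
    define a where "a = nat \<lfloor>(t + 1) / (2 * h)\<rfloor>"
    have "0 \<le> (t + 1) / (2 * h)" using t h by simp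
    then have "real a \<le> (t + 1) / (2 * h)" "(t + 1) / (2 * h) < real a + 1"
      unfolding a_def by linarith+
    then have a: "pt (2 * int a) \<le> t" "t < pt (2 * int a) + 2 * h"
      using h(1) by (simp_all add: pt_def field_simps)
    then have "pt (2 * int a) \<le> 1" using t by simp
    then have aM: "a \<le> M" using le1 by simp
    show ?thesis
    proof (cases "t - pt (2 * int a) < 3 * (2 * h) / 8")
      case True
      have "pt (2 * int a) \<in> V" using aM by (auto simp: V_def)
      then have "t \<in> collapsed V" using grid.near_collapsed[OF gV _ t] True a by simp
      then show ?thesis by simp
    next
      case F: False
      have "a \<noteq> M" using F end1 t h by auto
      then have aM: "a < M" using aM by simp
      show ?thesis
      proof (cases "pt (2 * int a) + 2 * h - t < 3 * (2 * h) / 8")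
        case True
        have "pt (2 * int (Suc a)) \<in> V" using aM unfolding V_def by (intro imageI) auto
        moreover have "pt (2 * int (Suc a)) = pt (2 * int a) + 2 * h"
          using step(2)[of "2 * int a"] by (simp add: algebra_simps)
        ultimately have "t \<in> collapsed V" using grid.near_collapsed[OF gV _ t] True a by simp
        then show ?thesis by simp
      next
        case False
        have "pt (2 * int a + 1) \<in> W" using aM by (auto simp: W_def)
        moreover have "\<bar>t - pt (2 * int a + 1)\<bar> < 3 * h / 8"
          unfolding step using F False h(1) by (simp add: abs_if)
        ultimately have "t \<in> collapsed W" using grid.near_collapsed[OF gW _ t] by simp
        then show ?thesis by simp
      qed
    qed
  qed
  moreover have "collapsed V \<union> collapsed W \<subseteq> {-1..1}" by (auto simp: collapsed_def)
  ultimately show thesis using that[OF gV gW] by blast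
qed

section \<open>Cells of the product grid and extension over skeleta\<close>

type_synonym cell = "(nat \<Rightarrow> real) \<times> (nat \<Rightarrow> real)"

definition cells :: "nat \<Rightarrow> real set \<Rightarrow> cell set" where
  "cells n V = {(l, u). (\<forall>i<n. (l i, u i) \<in> edges V) \<and> (\<forall>i\<ge>n. l i = 0 \<and> u i = 0)}"

definition cset :: "cell \<Rightarrow> (nat \<Rightarrow> real) set" where
  "cset c = {x. \<forall>i. fst c i \<le> x i \<and> x i \<le> snd c i}"

definition cdim :: "nat \<Rightarrow> cell \<Rightarrow> nat" where
  "cdim n c = card {i. i < n \<and> fst c i < snd c i}"

text \<open>The relative boundary of a cell: degenerate directions do not count, so that of a vertex
  is empty.\<close>

definition crb :: "nat \<Rightarrow> cell \<Rightarrow> (nat \<Rightarrow> real) set" where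
  "crb n c = {x \<in> cset c. \<exists>i<n. fst c i < snd c i \<and> (x i = fst c i \<or> x i = snd c i)}"

lemma closed_cset: "closed (cset c)"
proof -
  have "closed {x. fst c i \<le> x i \<and> x i \<le> snd c i}" for i
    by (intro closed_Collect_conj closed_Collect_le continuous_intros)
  then have "closed (\<Inter>i. {x. fst c i \<le> x i \<and> x i \<le> snd c i})" by blast
  moreover have "cset c = (\<Inter>i. {x. fst c i \<le> x i \<and> x i \<le> snd c i})" by (auto simp: cset_def)
  ultimately show ?thesis by simp
qed

text \<open>A cell of dimension j is an affine copy of the j-cube, through an enumeration of its
  nondegenerate directions, and its relative boundary corresponds to the boundary of that
  cube.\<close>

lemma fill_cell:
  assumes con: "cube_connected r T" and le: "\<And>i. fst c i \<le> snd c i"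
    and out: "\<And>i. i \<ge> n \<Longrightarrow> fst c i = snd c i"
    and dim: "cdim n c \<le> r" and g: "continuous_map (top_of_set (crb n c)) T g"
  obtains G where "continuous_map (top_of_set (cset c)) T G" "\<And>x. x \<in> crb n c \<Longrightarrow> G x = g x"
proof -
  obtain l u where c: "c = (l, u)" by (cases c)
  define S where "S = {i. i < n \<and> l i < u i}"
  define j where "j = card S"
  have jr: "j \<le> r" using dim by (simp add: j_def S_def cdim_def c)
  have "finite S" by (simp add: S_def)
  then obtain e where e: "bij_betw e {0..<j} S" using ex_bij_betw_nat_finite unfolding j_def by blast
  define e' where "e' = the_inv_into {0..<j} e"
  have e1: "e' i < j" "e (e' i) = i" if "i \<in> S" for i
    using bij_betw_the_inv_into[OF e] that f_the_inv_into_f_bij_betw[OF e] unfolding e'_def bij_betw_def by auto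
  have e2: "e' (e k) = k" "e k \<in> S" if "k < j" for k
    using e that unfolding e'_def by (auto simp: bij_betw_def the_inv_into_f_f)
  have eq: "l i = u i" if "i \<notin> S" for i
    using that le[of i] out[of i] by (cases "i < n") (auto simp: S_def c)
  have lu: "l i < u i" if "i \<in> S" for i using that by (simp add: S_def)
  \<comment> \<open>A is the affine parametrisation by the j-cube, constant in the degenerate
    directions, and A' its inverse on the cell.\<close>
  define A where "A = (\<lambda>y i. if i \<in> S then (l i + u i) / 2 + (u i - l i) / 2 * y (e' i) else l i)"
  define A' where "A' = (\<lambda>x k. if k < j then (2 * x (e k) - l (e k) - u (e k)) / (u (e k) - l (e k)) else 0)"
  have AA: "A (A' x) = x" if "x \<in> cset c" for x
  proof
    fix i
    show "A (A' x) i = x i"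
    proof (cases "i \<in> S")
      case True
      then show ?thesis using e1[OF True] lu[OF True] by (simp add: A_def A'_def field_simps)
    next
      case False
      then show ?thesis using that eq[OF False] by (auto simp: A_def cset_def c dest: spec[of _ i])
    qed
  qed
  have absA': "\<bar>A' x k\<bar> \<le> 1" and absA'1: "\<bar>A' x k\<bar> = 1 \<longleftrightarrow> x (e k) = l (e k) \<or> x (e k) = u (e k)"
    if "x \<in> cset c" "k < j" for x k
  proof -
    have *: "l (e k) \<le> x (e k)" "x (e k) \<le> u (e k)" "l (e k) < u (e k)"
      using that e2(2) lu by (auto simp: cset_def c)
    then show "\<bar>A' x k\<bar> \<le> 1" using that(2) by (simp add: A'_def abs_le_iff field_simps)
    show "\<bar>A' x k\<bar> = 1 \<longleftrightarrow> x (e k) = l (e k) \<or> x (e k) = u (e k)"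
      using * that(2) by (auto simp: A'_def abs_if field_simps)
  qed
  have A'cube: "A' x \<in> cube j" if "x \<in> cset c" for x
    using absA'[OF that] by (auto simp: cube_iff) (simp add: A'_def)
  have A'bd: "A' x \<in> cube_bd j" if x: "x \<in> crb n c" for x
  proof -
    have xc: "x \<in> cset c" using x by (simp add: crb_def)
    obtain i where i: "i \<in> S" "x i = l i \<or> x i = u i" using x by (auto simp: crb_def S_def c)
    then have "\<bar>A' x (e' i)\<bar> = 1" using absA'1[OF xc] e1[OF i(1)] by simp
    then have "1 \<le> cnorm j (A' x)" using abs_le_cnorm[OF e1(1)[OF i(1)], of "A' x"] by simp
    then show ?thesis using A'cube[OF xc] by (auto simp: cube_bd_def cube_def)
  qed
  have Acset: "A y \<in> cset c" if "y \<in> cube j" for y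
    unfolding cset_def c
  proof (intro CollectI allI)
    fix i
    show "fst (l, u) i \<le> A y i \<and> A y i \<le> snd (l, u) i"
    proof (cases "i \<in> S")
      case True
      have b: "\<bar>y (e' i)\<bar> \<le> 1" using that e1[OF True] by (simp add: cube_iff)
      have "\<bar>(u i - l i) / 2 * y (e' i)\<bar> \<le> (u i - l i) / 2 * 1"
        unfolding abs_mult using lu[OF True] b by (intro mult_mono) auto
      then show ?thesis using True unfolding A_def abs_le_iff by (simp add: field_simps)
    next
      case False
      then show ?thesis using le[of i] by (simp add: A_def c)
    qed
  qed
  have Abd: "A y \<in> crb n c" if y: "y \<in> cube_bd j" for y
  proof -
    have "cnorm j y = 1" using y by (simp add: cube_bd_def)
    then obtain k where k: "k < j" "\<bar>y k\<bar> = 1" using cnorm_attained[of j y] by auto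
    have "A y (e k) = l (e k) \<or> A y (e k) = u (e k)"
      using k e2[OF k(1)] by (auto simp: A_def abs_if field_simps split: if_splits)
    then show ?thesis
      using Acset[of y] y cube_bd_subset e2(2)[OF k(1)] unfolding crb_def c by (auto simp: S_def)
  qed
  have contA: "continuous_on X A" for X
  proof (unfold A_def, rule continuous_on_coordinatewise_then_product)
    fix i
    show "continuous_on X (\<lambda>y. if i \<in> S then (l i + u i) / 2 + (u i - l i) / 2 * y (e' i) else l i)"
      by (cases "i \<in> S") (auto intro!: continuous_intros)
  qed
  have contA': "continuous_on X A'" for X
  proof (unfold A'_def, rule continuous_on_coordinatewise_then_product)
    fix k
    show "continuous_on X (\<lambda>x. if k < j then (2 * x (e k) - l (e k) - u (e k)) / (u (e k) - l (e k)) else 0)"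
      using lu[OF e2(2)[of k]] by (cases "k < j") (auto intro!: continuous_intros)
  qed
  have "continuous_map (top_of_set (cube_bd j)) T (\<lambda>y. g (A y))"
    by (rule continuous_map_compose'[OF _ g]) (auto simp: continuous_map_top_of_set contA Abd)
  then obtain F where F: "continuous_map (top_of_set (cube j)) T F" "\<And>y. y \<in> cube_bd j \<Longrightarrow> F y = g (A y)"
    using con jr unfolding cube_connected_def fillable_def by blast
  show thesis
  proof
    show "continuous_map (top_of_set (cset c)) T (\<lambda>x. F (A' x))"
      by (rule continuous_map_compose'[OF _ F(1)]) (auto simp: continuous_map_top_of_set contA' A'cube)
    show "F (A' x) = g x" if "x \<in> crb n c" for x
      using F(2)[OF A'bd[OF that]] AA[of x] that by (simp add: crb_def)
  qed
qed

context grid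
begin

text \<open>The carrier of x: the smallest grid cell containing x, equivalently the one that has x
  in its relative interior.\<close>

definition car :: "nat \<Rightarrow> (nat \<Rightarrow> real) \<Rightarrow> cell" where
  "car n x = ((\<lambda>i. if i < n then lo V (x i) else 0), (\<lambda>i. if i < n then hi V (x i) else 0))"

lemma finite_cells: "finite (cells n V)"
proof -
  let ?F = "{f. \<forall>i. (i \<in> {..<n} \<longrightarrow> f i \<in> V) \<and> (i \<notin> {..<n} \<longrightarrow> f i = (0::real))}"
  have "finite ?F" by (rule finite_set_of_finite_funs) (auto simp: finite_V)
  moreover have "cells n V \<subseteq> ?F \<times> ?F" by (auto simp: cells_def edges_def)
  ultimately show ?thesis using finite_subset by blast
qed

lemma cube_coord: "x \<in> cube n \<Longrightarrow> i < n \<Longrightarrow> x i \<in> {-1..1}"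
  by (auto simp: cube_iff abs_le_iff)

lemma car_in_cells: "x \<in> cube n \<Longrightarrow> car n x \<in> cells n V"
  using lo_hi_edge[OF cube_coord] by (auto simp: car_def cells_def)

lemma in_car: assumes "x \<in> cube n" shows "x \<in> cset (car n x)"
  unfolding cset_def
proof (intro CollectI allI)
  fix i
  show "fst (car n x) i \<le> x i \<and> x i \<le> snd (car n x) i"
    using lo(2)[OF cube_coord[OF assms]] hi(2)[OF cube_coord[OF assms]] assms
    by (cases "i < n") (auto simp: car_def cube_iff)
qed

lemma cset_sub_cube: assumes "c \<in> cells n V" shows "cset c \<subseteq> cube n"
proof
  fix x assume x: "x \<in> cset c"
  have "\<bar>x i\<bar> \<le> 1" if "i < n" for i
  proof -
    have "(fst c i, snd c i) \<in> edges V" using assms that by (auto simp: cells_def)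
    then have "fst c i \<in> {-1..1}" "snd c i \<in> {-1..1}" using edge_sub by auto
    moreover have "fst c i \<le> x i" "x i \<le> snd c i" using x by (auto simp: cset_def)
    ultimately show ?thesis by (auto simp: abs_le_iff)
  qed
  moreover have "x i = 0" if "i \<ge> n" for i
    using assms x that by (auto simp: cells_def cset_def intro: antisym) (metis antisym fst_conv snd_conv)
  ultimately show "x \<in> cube n" by (simp add: cube_iff)
qed

definition face :: "cell \<Rightarrow> cell \<Rightarrow> bool" where
  "face c' c \<longleftrightarrow> (\<forall>i. fst c i \<le> fst c' i \<and> snd c' i \<le> snd c i)"

lemma face_cset: "face c' c \<Longrightarrow> cset c' \<subseteq> cset c"
  by (auto simp: face_def cset_def intro: order_trans)

lemma car_face: assumes "c \<in> cells n V" "x \<in> cset c" shows "face (car n x) c"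
  unfolding face_def
proof (intro allI conjI)
  fix i
  have *: "i < n \<Longrightarrow> (fst c i, snd c i) \<in> edges V" "i \<ge> n \<Longrightarrow> fst c i = 0 \<and> snd c i = 0"
    using assms by (auto simp: cells_def)
  have **: "fst c i \<le> x i" "x i \<le> snd c i" using assms by (auto simp: cset_def)
  show "fst c i \<le> fst (car n x) i" "snd (car n x) i \<le> snd c i"
    using edge_contains[OF *(1) **] *(2) by (cases "i < n"; simp add: car_def)+
qed

lemma cdim_mono: "face c' c \<Longrightarrow> cdim n c' \<le> cdim n c"
  unfolding cdim_def face_def by (intro card_mono) (auto intro: le_less_trans less_le_trans)

lemma car_interior: assumes "c \<in> cells n V" "x \<in> cset c" "x \<notin> crb n c" shows "car n x = c"
proof -
  have *: "(fst c i, snd c i) \<in> edges V" if "i < n" for i using assms that by (auto simp: cells_def)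
  have **: "fst c i \<le> x i" "x i \<le> snd c i" for i using assms by (auto simp: cset_def)
  have "lo V (x i) = fst c i \<and> hi V (x i) = snd c i" if i: "i < n" for i
  proof (cases "fst c i < snd c i")
    case True
    then have "x i \<noteq> fst c i" "x i \<noteq> snd c i" using assms i by (auto simp: crb_def)
    then show ?thesis using edge_interior[OF *[OF i], of "x i"] **[of i] by auto
  next
    case False
    then have "x i = fst c i" "x i = snd c i" using **[of i] by auto
    moreover have "fst c i \<in> V" using *[OF i] by (auto simp: edges_def)
    ultimately show ?thesis using lo_hi_vertex by metis
  qed
  moreover have "fst c i = 0" "snd c i = 0" if "i \<ge> n" for i using assms that by (auto simp: cells_def)
  ultimately show ?thesis by (auto simp: car_def prod_eq_iff fun_eq_iff)
qed

text \<open>In a direction where x sits at an end of a nondegenerate edge, the carrier is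
  degenerate; in no other direction does it gain anything, being a face.\<close>

lemma car_boundary: assumes "c \<in> cells n V" "x \<in> crb n c" shows "cdim n (car n x) < cdim n c"
proof -
  have x: "x \<in> cset c" using assms by (simp add: crb_def)
  obtain i where i: "i < n" "fst c i < snd c i" "x i = fst c i \<or> x i = snd c i"
    using assms by (auto simp: crb_def)
  have "(fst c i, snd c i) \<in> edges V" using assms i by (auto simp: cells_def)
  then have "x i \<in> V" using i by (auto simp: edges_def)
  then have "fst (car n x) i = snd (car n x) i" using lo_hi_vertex by (simp add: car_def i)
  then have "i \<notin> {i. i < n \<and> fst (car n x) i < snd (car n x) i}" by simp
  moreover have "i \<in> {i. i < n \<and> fst c i < snd c i}" using i by simp
  moreover have "{i. i < n \<and> fst (car n x) i < snd (car n x) i} \<subseteq> {i. i < n \<and> fst c i < snd c i}"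
    using car_face[OF assms(1) x] by (auto simp: face_def intro: le_less_trans less_le_trans)
  ultimately show ?thesis unfolding cdim_def by (intro psubset_card_mono) auto
qed

lemma cell_le: "c \<in> cells n V \<Longrightarrow> fst c i \<le> snd c i"
  by (cases "i < n") (auto simp: cells_def edges_def)

text \<open>Induction over the dimension: the relative boundary of a new cell consists of points
  with lower-dimensional carriers, where the map is already known, and cells of dimension at most r
  can be filled. L is a subcomplex on which the map is prescribed.\<close>

lemma skeleton_extension:
  assumes con: "cube_connected r T" and L: "L \<subseteq> cells n V"
    and down: "\<And>c c'. c \<in> L \<Longrightarrow> c' \<in> cells n V \<Longrightarrow> face c' c \<Longrightarrow> c' \<in> L"
    and \<rho>: "continuous_map (top_of_set (\<Union>(cset ` L))) T \<rho>" and "d \<le> Suc r"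
  shows "\<exists>G. continuous_map (top_of_set (\<Union>(cset ` (L \<union> {c \<in> cells n V. cdim n c < d})))) T G \<and>
             (\<forall>x\<in>\<Union>(cset ` L). G x = \<rho> x)"
  using \<open>d \<le> Suc r\<close>
proof (induction d)
  case 0
  then show ?case using \<rho> by auto
next
  case (Suc d)
  define A where "A = \<Union>(cset ` (L \<union> {c \<in> cells n V. cdim n c < d}))"
  obtain G where G: "continuous_map (top_of_set A) T G" "\<forall>x\<in>\<Union>(cset ` L). G x = \<rho> x"
    using Suc unfolding A_def by auto
  define N where "N = {c \<in> cells n V. cdim n c = d \<and> c \<notin> L}"
  have crbA: "crb n c \<subseteq> A" if c: "c \<in> N" for c
  proof
    fix x assume x: "x \<in> crb n c"
    then have xc: "x \<in> cset c" by (simp add: crb_def)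
    then have xq: "x \<in> cube n" using cset_sub_cube[of c n] c unfolding N_def by blast
    have "cdim n (car n x) < d" using car_boundary[OF _ x] c by (auto simp: N_def)
    then show "x \<in> A" unfolding A_def using car_in_cells[OF xq] in_car[OF xq] by blast
  qed
  have "\<exists>F. continuous_map (top_of_set (cset c)) T F \<and> (\<forall>x\<in>crb n c. F x = G x)" if c: "c \<in> N" for c
  proof -
    have 1: "continuous_map (top_of_set (crb n c)) T G"
      by (rule continuous_map_from_subtopology_mono[OF G(1) crbA[OF c]])
    have cc: "c \<in> cells n V" "cdim n c \<le> r" using c Suc.prems by (auto simp: N_def)
    have 2: "fst c i = snd c i" if "i \<ge> n" for i using cc that by (auto simp: cells_def)
    obtain F where "continuous_map (top_of_set (cset c)) T F" "\<And>x. x \<in> crb n c \<Longrightarrow> F x = G x"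
      using fill_cell[OF con cell_le[OF cc(1)] 2 cc(2) 1] by blast
    then show ?thesis by blast
  qed
  then obtain F where F: "\<And>c. c \<in> N \<Longrightarrow> continuous_map (top_of_set (cset c)) T (F c)"
     "\<And>c x. c \<in> N \<Longrightarrow> x \<in> crb n c \<Longrightarrow> F c x = G x"
    by metis
  \<comment> \<open>A point of a new cell outside A lies in the relative interior of that cell only,
    which is its carrier, and takes its value from the filling of that cell.\<close>
  define G' where "G' = (\<lambda>x. if x \<in> A then G x else F (car n x) x)"
  have sub: "c' \<in> L \<or> cdim n c' < d" if xA: "x \<in> A" and that: "x \<in> cset c" "c' = car n x" for x c c'
  proof -
    obtain b where b: "b \<in> L \<union> {c \<in> cells n V. cdim n c < d}" "x \<in> cset b"
      using xA unfolding A_def by blast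
    have bc: "b \<in> cells n V" using b L by auto
    then have f: "face c' b" using car_face b that by simp
    have "c' \<in> cells n V" using car_in_cells cset_sub_cube[OF bc] b that by auto
    then show ?thesis using b(1) down[of b c'] f cdim_mono[OF f, of n] by auto
  qed
  have GN: "G' x = F c x" if c: "c \<in> N" and x: "x \<in> cset c" for c x
  proof (cases "x \<in> crb n c")
    case True
    then show ?thesis using crbA[OF c] F(2)[OF c] by (auto simp: G'_def)
  next
    case False
    then have "car n x = c" using car_interior c x by (auto simp: N_def)
    moreover have "x \<notin> A" using sub[OF _ x refl] c unfolding \<open>car n x = c\<close> by (auto simp: N_def)
    ultimately show ?thesis by (simp add: G'_def)
  qed
  have union: "\<Union>(cset ` (L \<union> {c \<in> cells n V. cdim n c < Suc d})) = A \<union> \<Union>(cset ` N)"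
    by (auto simp: A_def N_def less_Suc_eq)
  have "finite (L \<union> {c \<in> cells n V. cdim n c < d})"
    using finite_subset[OF L finite_cells] finite_cells by simp
  then have clA: "closed A" unfolding A_def by (intro closed_UN) (auto simp: closed_cset)
  have finN: "finite N" using finite_cells by (simp add: N_def)
  then have clN: "closed (\<Union>(cset ` N))" by (intro closed_UN) (auto simp: closed_cset)
  have cN: "continuous_map (top_of_set (\<Union>(cset ` N))) T G'"
  proof (rule pasting_lemma_closed[where I = N and T = cset and f = "\<lambda>_. G'"])
    show "finite N" by (rule finN)
    fix c assume c: "c \<in> N"
    then have "cset c \<subseteq> \<Union>(cset ` N)" by blast
    then show "closedin (top_of_set (\<Union>(cset ` N))) (cset c)"
      by (simp add: closed_subset closed_cset)
    have "continuous_map (top_of_set (cset c)) T G'"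
      by (rule continuous_map_eq[OF F(1)[OF c]]) (simp add: GN[OF c])
    then show "continuous_map (subtopology (top_of_set (\<Union>(cset ` N))) (cset c)) T G'"
      using c by (simp add: subtopology_subtopology Int_absorb1 UN_upper)
  qed auto
  have "continuous_map (top_of_set (A \<union> \<Union>(cset ` N))) T G'"
  proof (rule continuous_map_glue_closed)
    show "closedin (top_of_set (A \<union> \<Union>(cset ` N))) A" by (simp add: closed_subset clA)
    show "closedin (top_of_set (A \<union> \<Union>(cset ` N))) (\<Union>(cset ` N))" by (simp add: closed_subset clN)
    have "continuous_map (top_of_set A) T G'"
      by (rule continuous_map_eq[OF G(1)]) (simp add: G'_def)
    then show "continuous_map (subtopology (top_of_set (A \<union> \<Union>(cset ` N))) A) T G'"
      by (simp add: subtopology_subtopology Int_absorb1)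
    show "continuous_map (subtopology (top_of_set (A \<union> \<Union>(cset ` N))) (\<Union>(cset ` N))) T G'"
      using cN by (simp add: subtopology_subtopology Int_absorb1)
  qed simp
  moreover have "\<forall>x\<in>\<Union>(cset ` L). G' x = \<rho> x" using G(2) by (auto simp: G'_def A_def)
  ultimately show ?case unfolding union by blast
qed

end

section \<open>Connectivity of joins\<close>

text \<open>Points of the whole cube, not only of its boundary, such that the boundary near them
  lies in U. Asking for some \<epsilon> strictly above r makes the set open; moving by s costs s in
  the radius.\<close>

definition core :: "nat \<Rightarrow> (nat \<Rightarrow> real) set \<Rightarrow> real \<Rightarrow> (nat \<Rightarrow> real) set" where
  "core j U r = {y \<in> cube j. \<exists>\<epsilon>>r. \<forall>z\<in>cube_bd j. cnorm j (\<lambda>i. y i - z i) < \<epsilon> \<longrightarrow> z \<in> U}"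

lemma core_shift:
  assumes "y \<in> core j U r" "y' \<in> cube j" "cnorm j (\<lambda>i. y i - y' i) \<le> s"
  shows "y' \<in> core j U (r - s)"
proof -
  obtain \<epsilon> where \<epsilon>: "\<epsilon> > r" "\<And>z. z \<in> cube_bd j \<Longrightarrow> cnorm j (\<lambda>i. y i - z i) < \<epsilon> \<Longrightarrow> z \<in> U"
    using assms(1) by (auto simp: core_def)
  have "z \<in> U" if "z \<in> cube_bd j" "cnorm j (\<lambda>i. y' i - z i) < \<epsilon> - s" for z
  proof -
    have "cnorm j (\<lambda>i. y i - z i) < \<epsilon>"
      using cnorm_triangle[of j y z y'] that(2) assms(3) by linarith
    then show ?thesis using \<epsilon>(2) that by blast
  qed
  then show ?thesis using assms(2) \<epsilon>(1) by (auto simp: core_def intro!: exI[of _ "\<epsilon> - s"])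
qed

lemma core_mem: "y \<in> core j U r \<Longrightarrow> z \<in> cube_bd j \<Longrightarrow> cnorm j (\<lambda>i. y i - z i) \<le> r \<Longrightarrow> z \<in> U"
  by (auto simp: core_def)

lemma openin_core: "openin (top_of_set (cube j)) (core j U r)"
proof (subst openin_subopen, intro ballI)
  fix y assume y: "y \<in> core j U r"
  then obtain \<epsilon> where \<epsilon>: "\<epsilon> > r" "\<And>z. z \<in> cube_bd j \<Longrightarrow> cnorm j (\<lambda>i. y i - z i) < \<epsilon> \<Longrightarrow> z \<in> U"
    by (auto simp: core_def)
  have y': "y \<in> core j U ((\<epsilon> + r) / 2)"
    using y \<epsilon> by (auto simp: core_def intro!: exI[of _ \<epsilon>])
  let ?N = "cube j \<inter> (\<lambda>y'. cnorm j (\<lambda>i. y i - y' i)) -` {..<(\<epsilon> - r) / 2}"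
  have "openin (top_of_set (cube j)) ?N"
    by (rule continuous_openin_preimage_gen) (auto intro!: continuous_intros)
  moreover have "y \<in> ?N"
  proof -
    have "cnorm j (\<lambda>i. y i - y i) = 0" by (simp add: cnorm_eq_0_iff)
    then show ?thesis using y \<epsilon>(1) by (simp add: core_def)
  qed
  moreover have "?N \<subseteq> core j U r"
  proof
    fix w assume w: "w \<in> ?N"
    then have "w \<in> core j U ((\<epsilon> + r) / 2 - (\<epsilon> - r) / 2)" by (intro core_shift[OF y']) auto
    then show "w \<in> core j U r" by (simp add: field_simps)
  qed
  ultimately show "\<exists>T. openin (top_of_set (cube j)) T \<and> y \<in> T \<and> T \<subseteq> core j U r" by blast
qed

text \<open>A Lebesgue number. On the compact set of triples of a boundary point, a point outside U
  and a point outside W, the larger of the two distances from the first point is positive and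
  attains its minimum.\<close>

lemma core_cover:
  assumes "openin (top_of_set (cube_bd j)) U" "openin (top_of_set (cube_bd j)) W" "cube_bd j \<subseteq> U \<union> W"
  obtains r where "0 < r" "cube_bd j \<subseteq> core j U r \<union> core j W r"
proof -
  define K where "K = cube_bd j \<times> (cube_bd j - U) \<times> (cube_bd j - W)"
  have "compact (cube_bd j - U')" if "openin (top_of_set (cube_bd j)) U'" for U'
  proof -
    have "closedin (top_of_set (cube_bd j)) (cube_bd j - U')"
      using closedin_diff[OF closedin_topspace that] by simp
    then show ?thesis by (rule closedin_compact[OF compact_cube_bd])
  qed
  then have K: "compact K" unfolding K_def using assms by (intro compact_Times compact_cube_bd) auto
  define f where "f = (\<lambda>z::(nat \<Rightarrow> real) \<times> (nat \<Rightarrow> real) \<times> (nat \<Rightarrow> real). max (cnorm j (\<lambda>i. fst z i - fst (snd z) i)) (cnorm j (\<lambda>i. fst z i - snd (snd z) i)))"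
  have cf: "continuous_on K f"
    unfolding f_def
    by (intro continuous_intros continuous_on_coordinatewise_then_product
        continuous_on_product_then_coordinatewise[where f = fst]
        continuous_on_product_then_coordinatewise[where f = "\<lambda>z. fst (snd z)"]
        continuous_on_product_then_coordinatewise[where f = "\<lambda>z. snd (snd z)"])
  have pos: "0 < f z" if "z \<in> K" for z
  proof (rule ccontr)
    assume "\<not> 0 < f z"
    obtain x y w where z: "z = (x, y, w)" by (cases z)
    have "cnorm j (\<lambda>i. x i - y i) = 0" "cnorm j (\<lambda>i. x i - w i) = 0"
      using \<open>\<not> 0 < f z\<close> cnorm_nonneg[of j "\<lambda>i. x i - y i"] cnorm_nonneg[of j "\<lambda>i. x i - w i"]
      by (auto simp: f_def z max_def split: if_splits)
    then have e: "\<forall>i<j. x i = y i" "\<forall>i<j. x i = w i" by (auto simp: cnorm_eq_0_iff)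
    have m: "x \<in> cube_bd j" "y \<in> cube_bd j - U" "w \<in> cube_bd j - W" using that by (auto simp: K_def z)
    have "x i = y i \<and> x i = w i" for i
      using m e by (cases "i < j") (auto simp: cube_bd_def cube_def)
    then have "x = y" "x = w" by auto
    then show False using m assms(3) by auto
  qed
  obtain r where r: "r > 0" "\<And>z. z \<in> K \<Longrightarrow> r \<le> f z"
  proof (cases "K = {}")
    case True
    then show ?thesis using that[of 1] by simp
  next
    case False
    then obtain z where "z \<in> K" "\<forall>y\<in>K. f z \<le> f y" using continuous_attains_inf[OF K _ cf] by blast
    then show ?thesis using that[of "f z"] pos by blast
  qed
  have "x \<in> core j U (r / 2) \<union> core j W (r / 2)" if x: "x \<in> cube_bd j" for x
  proof (rule ccontr)
    assume n: "x \<notin> core j U (r / 2) \<union> core j W (r / 2)"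
    have xq: "x \<in> cube j" using x cube_bd_subset by blast
    \<comment> \<open>Lying outside both cores of radius r / 2 is exploited with \<epsilon> = r: it
      yields points outside U and outside W at distance less than r.\<close>
    have "r > r / 2" using r by simp
    then obtain y w where "y \<in> cube_bd j" "cnorm j (\<lambda>i. x i - y i) < r" "y \<notin> U"
      "w \<in> cube_bd j" "cnorm j (\<lambda>i. x i - w i) < r" "w \<notin> W"
      using n xq unfolding core_def by blast
    then have "(x, y, w) \<in> K" "f (x, y, w) < r" using x by (auto simp: K_def f_def)
    then show False using r(2) by fastforce
  qed
  then show thesis using that[of "r / 2"] r by auto
qed

text \<open>Pigeonhole: with fewer than j - a indices for O1 and fewer than j - c for O2, at most 2j
  - a - c - 2 < j indices would be covered. This is the source of the summand 1 in the connectivity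
  of a join.\<close>

lemma card_complement:
  assumes "j \<le> a + c + 1" "\<And>i. i < j \<Longrightarrow> x i \<in> O1 \<union> O2"
  shows "j \<le> a + card {i. i < j \<and> x i \<in> O1} \<or> j \<le> c + card {i. i < j \<and> x i \<in> O2}"
proof -
  have "{..<j} = {i. i < j \<and> x i \<in> O1} \<union> {i. i < j \<and> x i \<in> O2}" using assms(2) by auto
  then have "j \<le> card {i. i < j \<and> x i \<in> O1} + card {i. i < j \<and> x i \<in> O2}"
    using card_Un_le[of "{i. i < j \<and> x i \<in> O1}" "{i. i < j \<and> x i \<in> O2}"] by (metis card_lessThan)
  then show ?thesis using assms(1) by linarith
qed

section \<open>Extending a partial map over a neighbourhood of a skeleton\<close>

context grid
begin

definition coll :: "nat \<Rightarrow> (nat \<Rightarrow> real) \<Rightarrow> nat \<Rightarrow> real" where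
  "coll n x = (\<lambda>i. if i < n then collapse V (x i) else 0)"

lemma continuous_on_coll: "continuous_on (cube n) (coll n)"
proof (unfold coll_def, rule continuous_on_coordinatewise_then_product)
  fix i
  have "continuous_on (cube n) (\<lambda>x. collapse V (x i))" if "i < n"
    by (rule continuous_on_compose2[OF continuous_on_collapse]) (auto intro!: continuous_intros dest: cube_coord[OF _ that])
  then show "continuous_on (cube n) (\<lambda>x. if i < n then collapse V (x i) else 0)" by (cases "i < n") auto
qed

lemma coll_cube: "x \<in> cube n \<Longrightarrow> coll n x \<in> cube n"
  using collapse_in[OF cube_coord] by (fastforce simp: coll_def cube_iff abs_le_iff)

lemma coll_close: "x \<in> cube n \<Longrightarrow> 0 \<le> \<delta> \<Longrightarrow> cnorm n (\<lambda>i. x i - coll n x i) \<le> \<delta>"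
  using collapse_close[OF cube_coord] by (auto simp: cnorm_le_iff coll_def)

lemma delta_nonneg: "0 \<le> \<delta>"
  using mesh[OF lo_hi_edge[of 0]] lo(2)[of 0] hi(2)[of 0] by simp

lemma coll_bd:
  assumes "x \<in> cube_bd n" "i < n" "\<bar>x i\<bar> = 1"
  shows "coll n x i = x i"
  using assms collapse_vertex ends by (auto simp: coll_def abs_if split: if_splits)

text \<open>The extension of a partial map over (a neighbourhood of) the \<open>a\<close>-skeleton of the grid,
  after a homotopy on the boundary that shrinks the domain and composes with \<open>coll\<close>.\<close>

lemma partial_extension:
  assumes con: "cube_connected a T" and h: "partial_map (top_of_set (cube_bd j)) T h"
    and U: "U = {x \<in> cube_bd j. h x \<noteq> None}"
  obtains H M where "partial_map (top_of_set (cube j)) T H"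
    and "partial_map (cyl (top_of_set (cube_bd j))) T M"
    and "\<And>x. x \<in> cube_bd j \<Longrightarrow> M (x, 0) = h x" "\<And>x. x \<in> cube_bd j \<Longrightarrow> M (x, 1) = H x"
    and "\<And>x. x \<in> cube j \<Longrightarrow> j \<le> a + card {i. i < j \<and> x i \<in> collapsed V} \<Longrightarrow> H x \<noteq> None"
    and "\<And>x t. x \<in> cube_bd j \<Longrightarrow> x \<in> core j U (2 * \<delta>) \<Longrightarrow> t \<in> {0..1} \<Longrightarrow> M (x, t) \<noteq> None"
proof -
  define \<rho> where "\<rho> = (\<lambda>x. the (h x))"
  have Uo: "openin (top_of_set (cube_bd j)) U"
    using partial_map_dom[OF h] by (simp add: U)
  have Us: "U \<subseteq> cube_bd j" by (auto simp: U)
  have \<rho>: "continuous_map (top_of_set U) T \<rho>"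
    using partial_map_continuous[OF h] Us unfolding U \<rho>_def
    by (simp add: subtopology_subtopology Int_absorb1)
  \<comment> \<open>The subcomplex of cells inside U, where the given map is defined; the extension
    to the a-skeleton must agree with it there.\<close>
  define L where "L = {c \<in> cells j V. cset c \<subseteq> U}"
  have "continuous_map (top_of_set (\<Union>(cset ` L))) T \<rho>"
    by (rule continuous_map_from_subtopology_mono[OF \<rho>]) (auto simp: L_def)
  then obtain G where G: "continuous_map (top_of_set (\<Union>(cset ` (L \<union> {c \<in> cells j V. cdim j c < Suc a})))) T G"
     "\<forall>x\<in>\<Union>(cset ` L). G x = \<rho> x"
    using skeleton_extension[OF con, of L j \<rho> "Suc a"] face_cset by (fastforce simp: L_def)
  define A where "A = \<Union>(cset ` (L \<union> {c \<in> cells j V. cdim j c < Suc a}))"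
  \<comment> \<open>On W1 at most a coordinates stay uncollapsed, so \<open>coll j x\<close> is in
    the a-skeleton. On W2 some coordinate is within 3g/8 of an end and collapses to it, so the
    carrier of \<open>coll j x\<close> lies in the boundary of the cube; its points are within
    \<delta> of a point of the core, hence in U.\<close>
  define W1 where "W1 = {x \<in> cube j. j \<le> a + card {i. i < j \<and> x i \<in> collapsed V}}"
  define W2 where "W2 = {x \<in> cube j. (\<exists>i<j. \<bar>x i\<bar> > 1 - 3 * g / 8) \<and> coll j x \<in> core j U \<delta>}"
  have W1A: "coll j x \<in> A" if "x \<in> W1" for x
  proof -
    have x: "x \<in> cube j" "j \<le> a + card {i. i < j \<and> x i \<in> collapsed V}" using that by (auto simp: W1_def)
    have cx: "coll j x \<in> cube j" by (rule coll_cube[OF x(1)])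
    have "{i. i < j \<and> fst (car j (coll j x)) i < snd (car j (coll j x)) i} \<subseteq> {..<j} - {i. i < j \<and> x i \<in> collapsed V}"
      using collapse_collapsed lo_hi_vertex by (auto simp: car_def coll_def)
    then have "cdim j (car j (coll j x)) \<le> card ({..<j} - {i. i < j \<and> x i \<in> collapsed V})"
      unfolding cdim_def by (intro card_mono) auto
    also have "\<dots> = j - card {i. i < j \<and> x i \<in> collapsed V}"
      by (subst card_Diff_subset) auto
    also have "\<dots> \<le> a" using x(2) by simp
    finally have "car j (coll j x) \<in> L \<union> {c \<in> cells j V. cdim j c < Suc a}"
      using car_in_cells[OF cx] by simp
    then show ?thesis unfolding A_def using in_car[OF cx] by blast
  qed
  have W2L: "coll j x \<in> \<Union>(cset ` L)" if xW: "x \<in> W2" for x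
  proof -
    obtain i where x: "x \<in> cube j" "i < j" "\<bar>x i\<bar> > 1 - 3 * g / 8" "coll j x \<in> core j U \<delta>"
      using xW by (auto simp: W2_def)
    have cx: "coll j x \<in> cube j" by (rule coll_cube[OF x(1)])
    let ?c = "car j (coll j x)"
    have xi: "x i \<in> {-1..1}" by (rule cube_coord[OF x(1,2)])
    have "collapse V (x i) = 1 \<or> collapse V (x i) = -1"
      using collapse_near[OF ends(1) xi] collapse_near[OF ends(2) xi] x(3) xi by (auto simp: abs_if split: if_splits)
    then have v: "coll j x i \<in> V" "\<bar>coll j x i\<bar> = 1" using ends x(2) by (auto simp: coll_def)
    have "cset ?c \<subseteq> U"
    proof
      fix z assume z: "z \<in> cset ?c"
      have zq: "z \<in> cube j" using cset_sub_cube[OF car_in_cells[OF cx]] z by blast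
      have "z i = coll j x i" using z lo_hi_vertex[OF v(1)] x(2) by (auto simp: cset_def car_def dest!: spec[of _ i])
      then have "1 \<le> cnorm j z" using abs_le_cnorm[OF x(2), of z] v by simp
      then have zb: "z \<in> cube_bd j" using zq by (auto simp: cube_bd_def cube_def)
      have "\<bar>coll j x k - z k\<bar> \<le> \<delta>" if k: "k < j" for k
      proof (rule edge_mesh)
        show "(fst ?c k, snd ?c k) \<in> edges V" using car_in_cells[OF cx] k by (auto simp: cells_def)
        show "fst ?c k \<le> coll j x k" "coll j x k \<le> snd ?c k" using in_car[OF cx] by (auto simp: cset_def)
        show "fst ?c k \<le> z k" "z k \<le> snd ?c k" using z by (auto simp: cset_def)
      qed
      then have "cnorm j (\<lambda>i. coll j x i - z i) \<le> \<delta>" by (simp add: cnorm_le_iff delta_nonneg)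
      then show "z \<in> U" by (rule core_mem[OF x(4) zb])
    qed
    then have "?c \<in> L" using car_in_cells[OF cx] by (simp add: L_def)
    then show ?thesis using in_car[OF cx] by blast
  qed
  have W1o: "openin (top_of_set (cube j)) W1"
  proof (subst openin_subopen, intro ballI)
    fix x assume x: "x \<in> W1"
    \<comment> \<open>The coordinates collapsed at x remain collapsed nearby, because
      \<open>collapsed V\<close> is open.\<close>
    define I where "I = {i. i < j \<and> x i \<in> collapsed V}"
    define N where "N = cube j \<inter> (\<Inter>i\<in>I. cube j \<inter> (\<lambda>x. x i) -` collapsed V)"
    have "finite I" by (simp add: I_def)
    moreover have "openin (top_of_set (cube j)) (cube j \<inter> (\<lambda>x. x i) -` collapsed V)" if "i \<in> I" for i
      by (rule continuous_openin_preimage[OF _ _ openin_collapsed])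
         (use that cube_coord in \<open>auto intro!: continuous_intros simp: I_def Pi_iff\<close>)
    ultimately have "openin (top_of_set (cube j)) N"
      unfolding N_def using openin_INT[of I "top_of_set (cube j)" "\<lambda>i. cube j \<inter> (\<lambda>x. x i) -` collapsed V"]
      by (simp add: Int_commute)
    moreover have "x \<in> N" using x by (auto simp: N_def I_def W1_def)
    moreover have "N \<subseteq> W1"
    proof
      fix y assume y: "y \<in> N"
      then have "\<forall>i\<in>I. y i \<in> collapsed V" unfolding N_def by blast
      then have "I \<subseteq> {i. i < j \<and> y i \<in> collapsed V}" unfolding I_def by blast
      then have "card I \<le> card {i. i < j \<and> y i \<in> collapsed V}" by (intro card_mono) auto
      then show "y \<in> W1" using x y by (auto simp: W1_def N_def I_def)
    qed
    ultimately show "\<exists>T. openin (top_of_set (cube j)) T \<and> x \<in> T \<and> T \<subseteq> W1" by blast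
  qed
  have W2o: "openin (top_of_set (cube j)) W2"
  proof -
    have 1: "openin (top_of_set (cube j)) (cube j \<inter> coll j -` core j U \<delta>)"
      by (rule continuous_openin_preimage[OF continuous_on_coll _ openin_core]) (auto simp: coll_cube)
    have "openin (top_of_set (cube j)) (cube j \<inter> (\<lambda>x. \<bar>x i\<bar>) -` {1 - 3 * g / 8<..})" for i
      by (rule continuous_openin_preimage_gen) (auto intro!: continuous_intros)
    then have 2: "openin (top_of_set (cube j)) (\<Union>i\<in>{..<j}. cube j \<inter> (\<lambda>x. \<bar>x i\<bar>) -` {1 - 3 * g / 8<..})"
      by blast
    have "W2 = (cube j \<inter> coll j -` core j U \<delta>) \<inter> (\<Union>i\<in>{..<j}. cube j \<inter> (\<lambda>x. \<bar>x i\<bar>) -` {1 - 3 * g / 8<..})"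
      by (auto simp: W2_def)
    then show ?thesis using 1 2 by (simp only: openin_Int)
  qed
  define W where "W = W1 \<union> W2"
  have Wo: "openin (top_of_set (cube j)) W" using W1o W2o by (simp add: W_def openin_Un)
  have WA: "coll j x \<in> A" if "x \<in> W" for x
    using that W1A W2L by (auto simp: W_def A_def)
  have Wq: "W \<subseteq> cube j" by (auto simp: W_def W1_def W2_def)
  have Gc: "continuous_map (top_of_set W) T (\<lambda>x. G (coll j x))"
    by (rule continuous_map_compose'[OF _ G(1)[folded A_def]])
       (auto simp: continuous_map_top_of_set WA intro: continuous_on_subset[OF continuous_on_coll Wq])
  define H where "H = (\<lambda>x. if x \<in> W then Some (G (coll j x)) else None)"
  have Hp: "partial_map (top_of_set (cube j)) T H"
    by (rule partial_mapI[OF Wo]) (use Gc Wq in \<open>auto simp: H_def subtopology_subtopology Int_absorb1\<close>)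
  \<comment> \<open>The part of U on which the homotopy is defined at all times. Of the radius 2 *
    \<delta>, one \<delta> is spent on moving x to \<open>coll j x\<close> and the other on the size
    of a cell.\<close>
  define V' where "V' = cube_bd j \<inter> core j U (2 * \<delta>)"
  have V'o: "openin (top_of_set (cube_bd j)) V'"
    using openin_core[of j U "2 * \<delta>"] cube_bd_subset[of j] unfolding V'_def
    by (metis openin_subtopology_Int2 subtopology_subtopology inf.absorb_iff2 inf_commute)
  have V'W2: "x \<in> W2" if "x \<in> V'" for x
  proof -
    have x: "x \<in> cube_bd j" "x \<in> cube j" "x \<in> core j U (2 * \<delta>)" using that cube_bd_subset by (auto simp: V'_def)
    have "coll j x \<in> core j U (2 * \<delta> - \<delta>)"
      by (rule core_shift[OF x(3) coll_cube[OF x(2)] coll_close[OF x(2) delta_nonneg]])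
    moreover obtain i where "i < j" "\<bar>x i\<bar> = 1" using x(1) cnorm_attained[of j x] by (auto simp: cube_bd_def)
    ultimately show ?thesis using x g_pos by (auto simp: W2_def intro!: exI[of _ i])
  qed
  \<comment> \<open>The homotopy rests on [0, 1/3] and on [2/3, 1], which leaves time for its domain
    to shrink at the start and to grow at the end.\<close>
  define s where "s = (\<lambda>t::real. max 0 (min 1 (3 * t - 1)))"
  define k where "k = (\<lambda>(x, t) i. (1 - s t) * x i + s t * coll j x i)"
  have s01: "0 \<le> s t" "s t \<le> 1" for t by (auto simp: s_def)
  have kU: "k (x, t) \<in> U" if "x \<in> V'" for x t
  proof -
    have x: "x \<in> cube_bd j" "x \<in> cube j" "x \<in> core j U (2 * \<delta>)" using that cube_bd_subset by (auto simp: V'_def)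
    have kq: "k (x, t) \<in> cube j"
      using cube_convex[OF x(2) coll_cube[OF x(2)] s01] by (simp add: k_def)
    obtain i where i: "i < j" "\<bar>x i\<bar> = 1" using x(1) cnorm_attained[of j x] by (auto simp: cube_bd_def)
    have "k (x, t) i = x i" using coll_bd[OF x(1) i] by (simp add: k_def algebra_simps)
    then have "1 \<le> cnorm j (k (x, t))" using abs_le_cnorm[OF i(1), of "k (x, t)"] i by simp
    then have kb: "k (x, t) \<in> cube_bd j" using kq by (auto simp: cube_bd_def cube_def)
    have "(\<lambda>i. x i - k (x, t) i) = (\<lambda>i. s t * (x i - coll j x i))" by (auto simp: k_def algebra_simps)
    then have "cnorm j (\<lambda>i. x i - k (x, t) i) = \<bar>s t\<bar> * cnorm j (\<lambda>i. x i - coll j x i)" by (simp add: cnorm_scale)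
    also have "\<dots> \<le> 1 * \<delta>" using s01[of t] coll_close[OF x(2) delta_nonneg] by (intro mult_mono) (auto simp: cnorm_nonneg)
    also have "\<dots> \<le> 2 * \<delta>" using delta_nonneg by simp
    finally show ?thesis by (rule core_mem[OF x(3) kb])
  qed
  have V'U: "V' \<subseteq> U" using kU[of _ 0] by (auto simp: k_def s_def)
  define val where "val = (\<lambda>(x, t). if t \<le> 1/3 then \<rho> x else if t \<ge> 2/3 then G (coll j x) else \<rho> (k (x, t)))"
  let ?Z = "top_of_set (cube_bd j \<times> {0..1::real})"
  \<comment> \<open>The domain depends on time: all of U early, V' throughout, the boundary part of
    W late. Since the homotopy rests early and late, \<open>val\<close> is continuous on each of the
    three open pieces.\<close>
  define R1 where "R1 = U \<times> {0..<1/3::real}"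
  define R2 where "R2 = V' \<times> {0..1::real}"
  define R3 where "R3 = (W \<inter> cube_bd j) \<times> {2/3<..1::real}"
  have I1: "openin (top_of_set {0..1::real}) {0..<1/3}" "openin (top_of_set {0..1::real}) {2/3<..1}"
  proof -
    have "{0..<1/3} = {0..1} \<inter> {..<1/3::real}" "{2/3<..1} = {0..1} \<inter> {2/3::real<..}" by auto
    then show "openin (top_of_set {0..1::real}) {0..<1/3}" "openin (top_of_set {0..1::real}) {2/3<..1}"
      by (metis openin_open_Int open_lessThan open_greaterThan)+
  qed
  have Wbo: "openin (top_of_set (cube_bd j)) (W \<inter> cube_bd j)"
    using Wo cube_bd_subset[of j] by (metis inf.absorb_iff2 openin_subtopology_Int subtopology_subtopology)
  have R: "openin ?Z R1" "openin ?Z R2" "openin ?Z R3"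
    unfolding R1_def R2_def R3_def prod_topology_subtopology_eu[symmetric]
    using Uo V'o Wbo I1 by (auto simp: openin_prod_Times_iff simp del: prod_topology_subtopology_eu)
  have fstR: "continuous_map (top_of_set (A' \<times> B')) (top_of_set A') fst" for A' :: "(nat \<Rightarrow> real) set" and B' :: "real set"
    by (auto simp: continuous_map_top_of_set intro!: continuous_intros)
  have v1: "continuous_map (top_of_set R1) T val"
  proof (rule continuous_map_eq)
    show "continuous_map (top_of_set R1) T (\<lambda>z. \<rho> (fst z))"
      unfolding R1_def by (rule continuous_map_compose'[OF fstR \<rho>])
  qed (auto simp: R1_def val_def)
  have v3: "continuous_map (top_of_set R3) T val"
  proof (rule continuous_map_eq)
    show "continuous_map (top_of_set R3) T (\<lambda>z. G (coll j (fst z)))"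
      unfolding R3_def
      by (rule continuous_map_compose'[OF fstR continuous_map_from_subtopology_mono[OF Gc]]) auto
  qed (auto simp: R3_def val_def)
  have v2: "continuous_map (top_of_set R2) T val"
  proof (rule continuous_map_eq)
    have "continuous_on R2 (\<lambda>z. k (fst z, snd z))"
    proof -
      have c: "continuous_on R2 (\<lambda>z. coll j (fst z))"
        by (rule continuous_on_compose2[OF continuous_on_coll])
           (use cube_bd_subset[of j] in \<open>auto simp: R2_def V'_def intro!: continuous_intros\<close>)
      have "continuous_on R2 (\<lambda>z. s (snd z))" unfolding s_def by (intro continuous_intros)
      then show ?thesis unfolding k_def split
        by (intro continuous_on_coordinatewise_then_product)
           (intro continuous_intros continuous_on_product_then_coordinatewise[OF c])
    qed
    then have "continuous_map (top_of_set R2) (top_of_set U) k"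
      by (auto simp: continuous_map_top_of_set R2_def kU)
    then show "continuous_map (top_of_set R2) T (\<lambda>z. \<rho> (k z))" by (rule continuous_map_compose'[OF _ \<rho>])
    fix z assume "z \<in> topspace (top_of_set R2)"
    then obtain x t where z: "z = (x, t)" "x \<in> V'" "t \<in> {0..1}" by (auto simp: R2_def)
    consider "t \<le> 1/3" | "t \<ge> 2/3" "\<not> t \<le> 1/3" | "1/3 < t" "t < 2/3" by linarith
    then show "\<rho> (k z) = val z"
    proof cases
      case 1
      then have "k z = x" by (simp add: z k_def s_def)
      then show ?thesis using 1 by (simp add: z val_def)
    next
      case 2
      have "x \<in> cube j" using z cube_bd_subset by (auto simp: V'_def)
      from 2 have "k z = coll j x" by (simp add: z k_def s_def)
      \<comment> \<open>V' lies in W2, which puts \<open>coll j x\<close> in the subcomplex L; there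
        the extension and the original map agree, so the late value continues the move.\<close>
      moreover have "G (coll j x) = \<rho> (coll j x)" using G(2) W2L[OF V'W2[OF z(2)]] by blast
      ultimately show ?thesis using 2 by (simp add: z val_def)
    next
      case 3
      then show ?thesis by (simp add: z val_def)
    qed
  qed
  define R where "R = R1 \<union> R2 \<union> R3"
  have Ro: "openin ?Z R" using R by (simp add: R_def openin_Un)
  then have Rs: "R \<subseteq> cube_bd j \<times> {0..1}" by (auto dest: openin_imp_subset)
  have vR: "continuous_map (top_of_set R) T val"
  proof (rule continuous_map_glue_open)
    fix z assume "z \<in> topspace (top_of_set R)"
    then have "z \<in> R1 \<or> z \<in> R2 \<or> z \<in> R3" by (auto simp: R_def)
    moreover have "R1 \<subseteq> R" "R2 \<subseteq> R" "R3 \<subseteq> R" by (auto simp: R_def)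
    ultimately obtain R' where R': "z \<in> R'" "R' \<subseteq> R" "openin ?Z R'" "continuous_map (top_of_set R') T val"
      using R v1 v2 v3 by metis
    have "openin (top_of_set R) R'" using R' Rs by (meson openin_subset_trans)
    moreover have "continuous_map (subtopology (top_of_set R) R') T val"
      using R' by (simp add: subtopology_subtopology Int_absorb1)
    ultimately show "\<exists>U. openin (top_of_set R) U \<and> z \<in> U \<and> continuous_map (subtopology (top_of_set R) U) T val"
      using R'(1) by blast
  qed
  define M where "M = (\<lambda>z. if z \<in> R then Some (val z) else None)"
  have Mp: "partial_map ?Z T M"
    by (rule partial_mapI[OF Ro]) (use vR Rs in \<open>auto simp: M_def subtopology_subtopology Int_absorb1\<close>)
  show thesis
  proof
    show "partial_map (top_of_set (cube j)) T H" by (rule Hp)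
    show "partial_map (cyl (top_of_set (cube_bd j))) T M" using Mp by simp
    fix x
    { assume x: "x \<in> cube_bd j"
      have "(x, 0) \<in> R \<longleftrightarrow> x \<in> U" using V'U by (auto simp: R_def R1_def R2_def R3_def)
      then show "M (x, 0) = h x" using x by (auto simp: M_def val_def \<rho>_def U)
      have "(x, 1) \<in> R \<longleftrightarrow> x \<in> W" using V'W2 x by (auto simp: R_def R1_def R2_def R3_def W_def)
      then show "M (x, 1) = H x" by (simp add: M_def H_def val_def) }
    { assume "x \<in> cube j" "j \<le> a + card {i. i < j \<and> x i \<in> collapsed V}"
      then show "H x \<noteq> None" by (simp add: H_def W_def W1_def) }
    { fix t :: real assume "x \<in> cube_bd j" "x \<in> core j U (2 * \<delta>)" "t \<in> {0..1}"
      then show "M (x, t) \<noteq> None" by (simp add: M_def R_def R2_def V'_def) }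
  qed
qed

end

section \<open>The join of two spaces\<close>

definition join2 :: "'q topology \<Rightarrow> 'p topology \<Rightarrow> ('q option \<times> 'p option) topology" where
  "join2 Q P = subtopology
     (topology_generated_by (insert UNIV ({{h. \<exists>q\<in>W. fst h = Some q} | W. openin Q W} \<union>
        {{h. \<exists>p\<in>W. snd h = Some p} | W. openin P W})))
     {h. h \<noteq> (None, None) \<and> (\<forall>q. fst h = Some q \<longrightarrow> q \<in> topspace Q) \<and> (\<forall>p. snd h = Some p \<longrightarrow> p \<in> topspace P)}"

lemma continuous_map_join2_iff:
  "continuous_map Z (join2 Q P) h \<longleftrightarrow> (\<forall>z\<in>topspace Z. h z \<noteq> (None, None)) \<and>
     partial_map Z Q (\<lambda>z. fst (h z)) \<and> partial_map Z P (\<lambda>z. snd (h z))"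
proof -
  have eq: "h -` {h. \<exists>q\<in>W. fst h = Some q} \<inter> topspace Z = {z \<in> topspace Z. \<exists>q\<in>W. fst (h z) = Some q}"
    "h -` {h. \<exists>p\<in>W'. snd h = Some p} \<inter> topspace Z = {z \<in> topspace Z. \<exists>p\<in>W'. snd (h z) = Some p}" for W W'
    by auto
  have "(\<forall>U. U \<in> insert UNIV ({{h. \<exists>q\<in>W. fst h = Some q} | W. openin Q W} \<union>
        {{h. \<exists>p\<in>W. snd h = Some p} | W. openin P W}) \<longrightarrow> openin Z (h -` U \<inter> topspace Z)) \<longleftrightarrow>
     (\<forall>W. openin Q W \<longrightarrow> openin Z (h -` {h. \<exists>q\<in>W. fst h = Some q} \<inter> topspace Z)) \<and>
     (\<forall>W. openin P W \<longrightarrow> openin Z (h -` {h. \<exists>p\<in>W. snd h = Some p} \<inter> topspace Z))"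
    (is "?L \<longleftrightarrow> ?R")
  proof
    assume L: ?L
    show ?R by (intro conjI allI impI L[rule_format] insertI2) blast+
  next
    assume R: ?R
    have "openin Z (h -` UNIV \<inter> topspace Z)" by simp
    then show ?L using R by blast
  qed
  moreover have "h ` topspace Z \<subseteq> \<Union>(insert UNIV ({{h. \<exists>q\<in>W. fst h = Some q} | W. openin Q W} \<union>
        {{h. \<exists>p\<in>W. snd h = Some p} | W. openin P W}))" by simp
  moreover have "h \<in> topspace Z \<rightarrow> {h. h \<noteq> (None, None) \<and> (\<forall>q. fst h = Some q \<longrightarrow> q \<in> topspace Q) \<and>
        (\<forall>p. snd h = Some p \<longrightarrow> p \<in> topspace P)} \<longleftrightarrow>
      (\<forall>z\<in>topspace Z. h z \<noteq> (None, None)) \<and> (\<forall>z\<in>topspace Z. \<forall>q. fst (h z) = Some q \<longrightarrow> q \<in> topspace Q) \<and>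
      (\<forall>z\<in>topspace Z. \<forall>p. snd (h z) = Some p \<longrightarrow> p \<in> topspace P)"
    by (simp only: Pi_iff mem_Collect_eq ball_conj_distrib)
  ultimately show ?thesis
    unfolding join2_def continuous_map_in_subtopology continuous_on_generated_topo_iff partial_map_def eq
    by argo
qed

text \<open>The two partial maps are extended along interleaved grids, over the points with at least
  j - a coordinates collapsed in the first grid and at least j - c in the second; by the pigeonhole
  every point of the cube is of one kind. The homotopies on the boundary that this requires stay in
  the join because the cores of the two domains cover it.\<close>

lemma join2_connected:
  assumes Q: "cube_connected a Q" and P: "cube_connected c P"
  shows "cube_connected (a + c + 1) (join2 Q P)"
  unfolding cube_connected_def
proof (intro allI impI)
  fix j h assume j: "j \<le> a + c + 1" and h: "continuous_map (top_of_set (cube_bd j)) (join2 Q P) h"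
  have h0: "partial_map (top_of_set (cube_bd j)) Q (\<lambda>x. fst (h x))"
    and h1: "partial_map (top_of_set (cube_bd j)) P (\<lambda>x. snd (h x))"
    and hn: "\<And>x. x \<in> cube_bd j \<Longrightarrow> h x \<noteq> (None, None)"
    using h unfolding continuous_map_join2_iff by auto
  define U where "U = {x \<in> cube_bd j. fst (h x) \<noteq> None}"
  define U' where "U' = {x \<in> cube_bd j. snd (h x) \<noteq> None}"
  have "openin (top_of_set (cube_bd j)) U" "openin (top_of_set (cube_bd j)) U'"
    using partial_map_dom[OF h0] partial_map_dom[OF h1] by (auto simp: U_def U'_def)
  moreover have "cube_bd j \<subseteq> U \<union> U'" using hn by (auto simp: U_def U'_def prod_eq_iff)
  ultimately obtain r where r: "0 < r" "cube_bd j \<subseteq> core j U r \<union> core j U' r" by (rule core_cover)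
  \<comment> \<open>Mesh r / 2 is chosen so that the homotopies keep their domains on the cores of
    radius 2 * (r / 2) = r.\<close>
  then have "0 < r / 2" by simp
  then obtain V W g g' where V: "grid V g (r / 2)" and W: "grid W g' (r / 2)"
    and VW: "collapsed V \<union> collapsed W = {-1..1}"
    by (rule interleaved_grids)
  obtain H M where H: "partial_map (top_of_set (cube j)) Q H"
    "partial_map (cyl (top_of_set (cube_bd j))) Q M"
    "\<And>x. x \<in> cube_bd j \<Longrightarrow> M (x, 0) = fst (h x)" "\<And>x. x \<in> cube_bd j \<Longrightarrow> M (x, 1) = H x"
    "\<And>x. x \<in> cube j \<Longrightarrow> j \<le> a + card {i. i < j \<and> x i \<in> collapsed V} \<Longrightarrow> H x \<noteq> None"
    "\<And>x t. x \<in> cube_bd j \<Longrightarrow> x \<in> core j U (2 * (r / 2)) \<Longrightarrow> t \<in> {0..1} \<Longrightarrow> M (x, t) \<noteq> None"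
    using grid.partial_extension[OF V Q h0 U_def] by blast
  obtain H' M' where H': "partial_map (top_of_set (cube j)) P H'"
    "partial_map (cyl (top_of_set (cube_bd j))) P M'"
    "\<And>x. x \<in> cube_bd j \<Longrightarrow> M' (x, 0) = snd (h x)" "\<And>x. x \<in> cube_bd j \<Longrightarrow> M' (x, 1) = H' x"
    "\<And>x. x \<in> cube j \<Longrightarrow> j \<le> c + card {i. i < j \<and> x i \<in> collapsed W} \<Longrightarrow> H' x \<noteq> None"
    "\<And>x t. x \<in> cube_bd j \<Longrightarrow> x \<in> core j U' (2 * (r / 2)) \<Longrightarrow> t \<in> {0..1} \<Longrightarrow> M' (x, t) \<noteq> None"
    using grid.partial_extension[OF W P h1 U'_def] by blast
  have "fillable j (join2 Q P) (\<lambda>x. (M (x, 0), M' (x, 0)))"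
  proof (rule fillable_homotopy[where m = "\<lambda>z. (M z, M' z)"])
    show "continuous_map (cyl (top_of_set (cube_bd j))) (join2 Q P) (\<lambda>z. (M z, M' z))"
      unfolding continuous_map_join2_iff using H(2,6) H'(2,6) r(2) by auto
    have "H x \<noteq> None \<or> H' x \<noteq> None" if "x \<in> cube j" for x
    proof -
      have "x i \<in> collapsed V \<union> collapsed W" if "i < j" for i
        using grid.cube_coord[OF V \<open>x \<in> cube j\<close> that] VW by blast
      from card_complement[OF j, of x, OF this] show ?thesis using H(5) H'(5) that by blast
    qed
    then have "continuous_map (top_of_set (cube j)) (join2 Q P) (\<lambda>x. (H x, H' x))"
      unfolding continuous_map_join2_iff using H(1) H'(1) by auto
    then show "fillable j (join2 Q P) (\<lambda>x. (M (x, 1), M' (x, 1)))"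
      unfolding fillable_def using H(4) H'(4) by (intro exI[of _ "\<lambda>x. (H x, H' x)"]) auto
  qed
  then show "fillable j (join2 Q P) h"
    by (rule fillable_cong) (simp add: H(3) H'(3))
qed

text \<open>For a constant second argument, \<open>join_space\<close> is the ordinary join of \<open>m\<close> copies.\<close>

lemma join_connected:
  fixes P :: "'p topology"
  assumes "cube_connected k P"
  shows "cube_connected (Suc m * (k + 1) - 1) (join_space P (\<lambda>_. ()) (Suc m))"
proof (induction m)
  case 0
  show ?case
  proof (rule cube_connected_retract)
    show "cube_connected (Suc 0 * (k + 1) - 1) P" using assms by simp
    have pm: "partial_map (join_space P (\<lambda>_. ()) (Suc 0)) P (\<lambda>h. h 0)"
      using continuous_map_join_iff[of "join_space P (\<lambda>_. ()) (Suc 0)" P "\<lambda>_. ()" "Suc 0" "\<lambda>h. h"] by simp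
    have n0: "h 0 \<noteq> None" if "h \<in> topspace (join_space P (\<lambda>_. ()) (Suc 0))" for h
      using that unfolding topspace_join_space by (elim join_carrierE) auto
    then have "{h \<in> topspace (join_space P (\<lambda>_. ()) (Suc 0)). h 0 \<noteq> None} = topspace (join_space P (\<lambda>_. ()) (Suc 0))"
      by blast
    then show "continuous_map (join_space P (\<lambda>_. ()) (Suc 0)) P (\<lambda>h. the (h 0))"
      using partial_map_continuous[OF pm] by simp
    show "continuous_map P (join_space P (\<lambda>_. ()) (Suc 0)) (\<lambda>p i. if i = 0 then Some p else None)"
      unfolding continuous_map_join_iff
    proof (intro conjI ballI allI)
      fix i :: nat
      show "partial_map P P (\<lambda>p. if i = 0 then Some p else None)"
        by (cases "i = 0") (auto simp: partial_map_const_None intro!: partial_mapI[of P "topspace P" P id])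
    qed (auto simp: join_carrier_def split: if_splits)
    show "(\<lambda>i. if i = 0 then Some (the (h 0)) else None) = h"
      if "h \<in> topspace (join_space P (\<lambda>_. ()) (Suc 0))" for h
    proof
      fix i :: nat
      show "(if i = 0 then Some (the (h 0)) else None) = h i"
        using that n0[OF that] by (cases "i = 0") (auto simp: topspace_join_space join_carrier_def)
    qed
  qed
next
  case (Suc m)
  let ?J = "join_space P (\<lambda>_. ()) (Suc (Suc m))"
  let ?Q = "join_space P (\<lambda>_. ()) (Suc m)"
  define cut where "cut = (\<lambda>h::nat \<Rightarrow> 'p option. \<lambda>i. if i < Suc m then h i else None)"
  have pm: "partial_map ?J P (\<lambda>h. h i)" for i
    using continuous_map_join_iff[of ?J P "\<lambda>_. ()" "Suc (Suc m)" "\<lambda>h. h"] by simp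
  have conn: "cube_connected ((Suc m * (k + 1) - 1) + k + 1) (join2 ?Q P)"
    by (rule join2_connected[OF Suc assms])
  show ?case
  proof (rule cube_connected_retract)
    have "Suc (Suc m) * (k + 1) - 1 = (Suc m * (k + 1) - 1) + k + 1" by simp
    then show "cube_connected (Suc (Suc m) * (k + 1) - 1) (join2 ?Q P)" using conn by (simp only:)
    \<comment> \<open>The join of m + 2 copies is a retract of the join of the first m + 1 with the
      last one: \<open>?i\<close> splits off the last entry, with \<open>None\<close> for a first
      part without any entry, and \<open>?q\<close> puts the parts together again.\<close>
    let ?i = "\<lambda>h. (if \<exists>i<Suc m. h i \<noteq> None then Some (cut h) else None, h (Suc m))"
    let ?q = "\<lambda>(a, b) i. if i < Suc m then (case a of None \<Rightarrow> None | Some h \<Rightarrow> h i) else if i = Suc m then b else None"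
    define U where "U = (\<Union>i\<in>{..<Suc m}. {h \<in> topspace ?J. h i \<noteq> None})"
    have U: "openin ?J U"
      unfolding U_def by (rule openin_Union) (elim imageE, simp only: partial_map_dom[OF pm])
    show "continuous_map ?J (join2 ?Q P) ?i"
      unfolding continuous_map_join2_iff fst_conv snd_conv
    proof (intro conjI ballI pm)
      fix h assume "h \<in> topspace ?J"
      then have "h \<in> join_carrier P (\<lambda>_. ()) (Suc (Suc m))" by (simp add: topspace_join_space)
      then obtain i p where "h i = Some p" "i < Suc (Suc m)" by (rule join_carrierE)
      then show "?i h \<noteq> (None, None)" by (cases "i = Suc m") (auto simp: less_Suc_eq)
    next
      show "partial_map ?J ?Q (\<lambda>h. if \<exists>i<Suc m. h i \<noteq> None then Some (cut h) else None)"
      proof (rule partial_mapI[OF U])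
        show "continuous_map (subtopology ?J U) ?Q cut"
          unfolding continuous_map_join_iff
        proof (intro conjI ballI allI)
          fix i
          show "partial_map (subtopology ?J U) P (\<lambda>h. cut h i)"
            using partial_map_subtopology[OF pm[of i]] partial_map_const_None unfolding cut_def
            by (cases "i < Suc m") auto
        next
          fix h assume "h \<in> topspace (subtopology ?J U)"
          then show "cut h \<in> join_carrier P (\<lambda>_. ()) (Suc m)"
            unfolding U_def by (auto simp: topspace_join_space join_carrier_def cut_def)
        qed
      qed (auto simp: U_def)
    qed
    show "continuous_map (join2 ?Q P) ?J ?q"
      unfolding continuous_map_join_iff
    proof (intro conjI ballI allI)
      have id: "continuous_map (join2 ?Q P) (join2 ?Q P) (\<lambda>z. z)" by simp
      then have f: "partial_map (join2 ?Q P) ?Q fst" and s: "partial_map (join2 ?Q P) P snd"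
        and n: "\<And>z. z \<in> topspace (join2 ?Q P) \<Longrightarrow> z \<noteq> (None, None)"
        unfolding continuous_map_join2_iff by auto
      fix i
      show "partial_map (join2 ?Q P) P (\<lambda>z. ?q z i)"
      proof (cases "i < Suc m")
        case True
        have pq: "partial_map ?Q P (\<lambda>h. h i)"
          using continuous_map_join_iff[of ?Q P "\<lambda>_. ()" "Suc m" "\<lambda>h. h"] by simp
        have "partial_map (join2 ?Q P) P (\<lambda>z. case fst z of None \<Rightarrow> None | Some h \<Rightarrow> h i)"
          unfolding partial_map_def
        proof (intro conjI ballI allI impI)
          fix z p assume "z \<in> topspace (join2 ?Q P)" "(case fst z of None \<Rightarrow> None | Some h \<Rightarrow> h i) = Some p"
          then show "p \<in> topspace P"
            using f pq unfolding partial_map_def by (auto split: option.splits)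
        next
          fix O' assume "openin P O'"
          then have "openin ?Q {h \<in> topspace ?Q. \<exists>p\<in>O'. h i = Some p}" using pq unfolding partial_map_def by blast
          then have "openin (join2 ?Q P) {z \<in> topspace (join2 ?Q P). \<exists>h\<in>{h \<in> topspace ?Q. \<exists>p\<in>O'. h i = Some p}. fst z = Some h}"
            using f unfolding partial_map_def by blast
          moreover have "{z \<in> topspace (join2 ?Q P). \<exists>h\<in>{h \<in> topspace ?Q. \<exists>p\<in>O'. h i = Some p}. fst z = Some h}
             = {z \<in> topspace (join2 ?Q P). \<exists>p\<in>O'. (case fst z of None \<Rightarrow> None | Some h \<Rightarrow> h i) = Some p}"
            using f unfolding partial_map_def by (auto split: option.splits)
          ultimately show "openin (join2 ?Q P) {z \<in> topspace (join2 ?Q P). \<exists>p\<in>O'. (case fst z of None \<Rightarrow> None | Some h \<Rightarrow> h i) = Some p}"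
            by simp
        qed
        then show ?thesis using True by (simp add: case_prod_unfold)
      next
        case False
        then show ?thesis using s partial_map_const_None by (cases "i = Suc m") (auto simp: case_prod_unfold)
      qed
    next
      have id: "continuous_map (join2 ?Q P) (join2 ?Q P) (\<lambda>z. z)" by simp
      then have f: "partial_map (join2 ?Q P) ?Q fst" and s: "partial_map (join2 ?Q P) P snd"
        and n: "\<And>z. z \<in> topspace (join2 ?Q P) \<Longrightarrow> z \<noteq> (None, None)"
        unfolding continuous_map_join2_iff by auto
      fix z assume z: "z \<in> topspace (join2 ?Q P)"
      obtain a b where ab: "z = (a, b)" by (cases z)
      have a: "h \<in> join_carrier P (\<lambda>_. ()) (Suc m)" if "a = Some h" for h
        using f z that unfolding partial_map_def topspace_join_space ab by auto
      have b: "p \<in> topspace P" if "b = Some p" for p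
        using s z that unfolding partial_map_def ab by auto
      have "\<exists>i. ?q z i \<noteq> None"
      proof (cases b)
        case (Some p)
        then show ?thesis by (intro exI[of _ "Suc m"]) (simp add: ab)
      next
        case None
        then obtain h where h: "a = Some h" using n[OF z] ab by (cases a) auto
        then obtain i p where "h i = Some p" "i < Suc m" using join_carrierE[OF a[OF h]] by metis
        then show ?thesis using h by (intro exI[of _ i]) (simp add: ab)
      qed
      moreover have "p \<in> topspace P" if "?q z i = Some p" for i p
        using that a b by (auto simp: ab join_carrier_def split: if_splits option.splits)
      ultimately show "?q z \<in> join_carrier P (\<lambda>_. ()) (Suc (Suc m))"
        unfolding join_carrier_def by (auto simp: ab)
    qed
    show "?q (?i h) = h" if "h \<in> topspace ?J" for h
    proof
      fix i
      have "h i = None" if "i \<ge> Suc (Suc m)"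
        using that \<open>h \<in> topspace ?J\<close> by (simp add: topspace_join_space join_carrier_def)
      then show "?q (?i h) i = h i"
        by (cases "i = Suc m"; cases "i < Suc m"; cases "\<exists>k<Suc m. h k \<noteq> None") (simp_all add: cut_def)
    qed
  qed
qed

section \<open>Homotopy fibres of a \<open>k\<close>-equivalence\<close>

lemma cube_sphere_homeomorphism:
  obtains \<theta> \<theta>' where "continuous_map (top_of_set (cube_bd (Suc n))) (nsphere n) \<theta>"
    "continuous_map (nsphere n) (top_of_set (cube_bd (Suc n))) \<theta>'"
    "\<And>x. x \<in> cube_bd (Suc n) \<Longrightarrow> \<theta>' (\<theta> x) = x" "\<And>y. y \<in> topspace (nsphere n) \<Longrightarrow> \<theta> (\<theta>' y) = y"
    "\<theta> sphere_base = sphere_base" "\<theta>' sphere_base = sphere_base"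
proof -
  obtain \<theta> \<theta>' where h: "homeomorphism (cube (Suc n)) (disc (Suc n)) \<theta> \<theta>'"
    and e: "\<And>x. x \<in> cube (Suc n) \<Longrightarrow> enorm (Suc n) (\<theta> x) = cnorm (Suc n) x" "\<theta> sphere_base = sphere_base"
    using cube_disc_homeomorphism[of "Suc n"] by (metis zero_less_Suc)
  let ?S = "{x \<in> disc (Suc n). enorm (Suc n) x = 1}"
  have t: "\<theta> x \<in> ?S" if "x \<in> cube_bd (Suc n)" for x
  proof -
    have "x \<in> cube (Suc n)" "cnorm (Suc n) x = 1" using that by (auto simp only: cube_bd_def)
    moreover from this have "\<theta> x \<in> disc (Suc n)" using h unfolding homeomorphism_def by blast
    ultimately show ?thesis using e(1) by simp
  qed
  have t': "\<theta>' y \<in> cube_bd (Suc n)" if "y \<in> ?S" for y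
  proof -
    have 1: "\<theta>' y \<in> cube (Suc n)" "\<theta> (\<theta>' y) = y" using that h unfolding homeomorphism_def by auto
    then have "cnorm (Suc n) (\<theta>' y) = 1" using e(1)[OF 1(1)] that by simp
    then show ?thesis using 1 by (simp add: cube_bd_def)
  qed
  show thesis
  proof
    show "continuous_map (top_of_set (cube_bd (Suc n))) (nsphere n) \<theta>"
      unfolding nsphere_eq continuous_map_top_of_set using t h cube_bd_subset
      by (auto simp: homeomorphism_def intro: continuous_on_subset)
    show "continuous_map (nsphere n) (top_of_set (cube_bd (Suc n))) \<theta>'"
      unfolding nsphere_eq continuous_map_top_of_set using t' h
      by (auto simp: homeomorphism_def intro: continuous_on_subset)
    show "\<theta>' (\<theta> x) = x" if "x \<in> cube_bd (Suc n)" for x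
      using that h cube_bd_subset unfolding homeomorphism_def by blast
    show "\<theta> (\<theta>' y) = y" if "y \<in> topspace (nsphere n)" for y
      using that h unfolding homeomorphism_def nsphere_eq by auto
    show "\<theta> sphere_base = sphere_base" by (rule e)
    have "sphere_base \<in> cube (Suc n)" using sphere_base_in_cube_bd cube_bd_subset by blast
    then show "\<theta>' sphere_base = sphere_base" using h e(2) unfolding homeomorphism_def by metis
  qed
qed

lemma fillable_const: "y \<in> topspace T \<Longrightarrow> fillable j T (\<lambda>_. y)"
  unfolding fillable_def by (intro exI[of _ "\<lambda>_. y"]) auto

text \<open>A filling of f \<circ> e gives at first only a free nullhomotopy. Contracting the cube
  along segments to \<open>sphere_base\<close> makes it pointed, as the segment from that point is
  constant; injectivity then yields a nullhomotopy of e.\<close>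

lemma pi_injective_fill:
  assumes inj: "pi_injective i E X f (e sphere_base)" and f: "continuous_map E X f"
    and e: "continuous_map (top_of_set (cube_bd (Suc i))) E e"
    and fill: "fillable (Suc i) X (\<lambda>x. f (e x))"
  shows "fillable (Suc i) E e"
proof -
  let ?b = sphere_base and ?e0 = "e sphere_base"
  have b: "?b \<in> cube_bd (Suc i)" "?b \<in> cube (Suc i)"
    using sphere_base_in_cube_bd cube_bd_subset by blast+
  have e0: "?e0 \<in> topspace E" using continuous_map_funspace[OF e] b by auto
  obtain \<theta> \<theta>' where \<theta>: "continuous_map (top_of_set (cube_bd (Suc i))) (nsphere i) \<theta>"
    "continuous_map (nsphere i) (top_of_set (cube_bd (Suc i))) \<theta>'"
    "\<And>x. x \<in> cube_bd (Suc i) \<Longrightarrow> \<theta>' (\<theta> x) = x" "\<And>y. y \<in> topspace (nsphere i) \<Longrightarrow> \<theta> (\<theta>' y) = y"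
    "\<theta> ?b = ?b" "\<theta>' ?b = ?b"
    using cube_sphere_homeomorphism by blast
  obtain g where g: "continuous_map (top_of_set (cube (Suc i))) X g" "\<And>x. x \<in> cube_bd (Suc i) \<Longrightarrow> g x = f (e x)"
    using fill unfolding fillable_def by blast
  have \<theta>'t: "\<theta>' y \<in> cube_bd (Suc i)" "\<theta>' y \<in> cube (Suc i)" if "y \<in> topspace (nsphere i)" for y
    using continuous_map_funspace[OF \<theta>(2)] that cube_bd_subset by auto
  have bt: "?b \<in> topspace (nsphere i)" using continuous_map_funspace[OF \<theta>(1)] b \<theta>(5) by force
  have e\<theta>: "continuous_map (nsphere i) E (\<lambda>y. e (\<theta>' y))" by (rule continuous_map_compose'[OF \<theta>(2) e])
  have "homotopic_with (\<lambda>h. h ?b = f ?e0) (nsphere i) X (f \<circ> (\<lambda>y. e (\<theta>' y))) (f \<circ> (\<lambda>_. ?e0))"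
  proof (subst homotopic_with)
    fix h k :: "(nat \<Rightarrow> real) \<Rightarrow> 'b" assume "\<And>x. x \<in> topspace (nsphere i) \<Longrightarrow> h x = k x"
    then show "(h ?b = f ?e0) = (k ?b = f ?e0)" using bt by simp
  next
    define hh where "hh = (\<lambda>(t, y). g (\<lambda>j. (1 - t) * \<theta>' y j + t * ?b j))"
    show "\<exists>h. continuous_map (prod_topology (top_of_set {0..1::real}) (nsphere i)) X h \<and>
       (\<forall>x\<in>topspace (nsphere i). h (0, x) = (f \<circ> (\<lambda>y. e (\<theta>' y))) x) \<and>
       (\<forall>x\<in>topspace (nsphere i). h (1, x) = (f \<circ> (\<lambda>_. ?e0)) x) \<and> (\<forall>t\<in>{0..1}. h (t, ?b) = f ?e0)"
    proof (rule exI[of _ hh], intro conjI ballI)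
      have "continuous_map (prod_topology (top_of_set {0..1}) (nsphere i)) X
             (\<lambda>z. g (\<lambda>j. (1 - fst z) * \<theta>' (snd z) j + fst z * ?b j))"
      proof (rule continuous_map_compose'[OF _ g(1)])
        have 1: "continuous_map (prod_topology (top_of_set {0..1}) (nsphere i)) (top_of_set ({0..1} \<times> cube_bd (Suc i)))
                (\<lambda>z. (fst z, \<theta>' (snd z)))"
          unfolding prod_topology_subtopology_eu[symmetric]
          by (intro continuous_map_pairedI continuous_map_fst continuous_map_compose'[OF continuous_map_snd \<theta>(2)])
        have 2: "continuous_map (top_of_set ({0..1::real} \<times> cube_bd (Suc i))) (top_of_set (cube (Suc i)))
                (\<lambda>z j. (1 - fst z) * snd z j + fst z * ?b j)"
          unfolding continuous_map_top_of_set
        proof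
          show "continuous_on ({0..1} \<times> cube_bd (Suc i)) (\<lambda>z j. (1 - fst z) * snd z j + fst z * ?b j)"
          proof (rule continuous_on_coordinatewise_then_product)
            fix k
            have "continuous_on ({0..1} \<times> cube_bd (Suc i)) (\<lambda>z::real \<times> (nat \<Rightarrow> real). snd z k)"
              by (rule continuous_on_product_then_coordinatewise) (intro continuous_intros)
            then show "continuous_on ({0..1} \<times> cube_bd (Suc i)) (\<lambda>z. (1 - fst z) * snd z k + fst z * ?b k)"
              by (intro continuous_intros)
          qed
          show "(\<lambda>z j. (1 - fst z) * snd z j + fst z * ?b j) \<in> {0..1} \<times> cube_bd (Suc i) \<rightarrow> cube (Suc i)"
            using cube_convex[OF subsetD[OF cube_bd_subset] b(2)] by auto
        qed
        show "continuous_map (prod_topology (top_of_set {0..1}) (nsphere i)) (top_of_set (cube (Suc i)))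
          (\<lambda>z j. (1 - fst z) * \<theta>' (snd z) j + fst z * ?b j)"
          using continuous_map_compose'[OF 1 2] by simp
      qed
      then show "continuous_map (prod_topology (top_of_set {0..1}) (nsphere i)) X hh"
        by (simp add: case_prod_unfold hh_def)
    qed (use g(2) \<theta>'t b \<theta>(6) in \<open>auto simp: hh_def algebra_simps\<close>)
  qed
  then have "pointed_homotopic i X (f ?e0) (f \<circ> (\<lambda>y. e (\<theta>' y))) (f \<circ> (\<lambda>_. ?e0))"
    by (simp add: pointed_homotopic_def)
  moreover have "pointed_sphere_map i E ?e0 (\<lambda>y. e (\<theta>' y))" "pointed_sphere_map i E ?e0 (\<lambda>_. ?e0)"
    using e\<theta> \<theta>(6) e0 by (auto simp: pointed_sphere_map_def)
  ultimately have "pointed_homotopic i E ?e0 (\<lambda>y. e (\<theta>' y)) (\<lambda>_. ?e0)"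
    using inj unfolding pi_injective_def by blast
  then obtain h where h: "continuous_map (prod_topology (top_of_set {0..1::real}) (nsphere i)) E h"
    "\<And>y. h (0, y) = e (\<theta>' y)" "\<And>y. h (1, y) = ?e0"
    unfolding pointed_homotopic_def homotopic_with_def by blast
  have "fillable (Suc i) E (\<lambda>x. h (0, \<theta> x))"
  proof (rule fillable_homotopy[where m = "\<lambda>z. h (snd z, \<theta> (fst z))", unfolded fst_conv snd_conv])
    show "continuous_map (cyl (top_of_set (cube_bd (Suc i)))) E (\<lambda>z. h (snd z, \<theta> (fst z)))"
      by (rule continuous_map_compose'[OF _ h(1)])
         (intro continuous_map_pairedI continuous_map_snd continuous_map_compose'[OF continuous_map_fst \<theta>(1)])
    show "fillable (Suc i) E (\<lambda>x. h (1, \<theta> x))" unfolding h(3) by (rule fillable_const[OF e0])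
  qed
  then show ?thesis by (rule fillable_cong) (simp add: h(2) \<theta>(3))
qed

text \<open>Pushes the face \<open>y 0 = 1\<close> of the cube into its centre as \<open>s\<close> goes from \<open>0\<close> to \<open>1\<close>.\<close>

definition squeeze :: "nat \<Rightarrow> real \<times> (nat \<Rightarrow> real) \<Rightarrow> nat \<Rightarrow> real" where
  "squeeze n = (\<lambda>(s, y). let z = (\<lambda>i. if i = 0 then y 0 else (1 - s * max 0 (y 0)) * y i)
     in (\<lambda>i. z i / cnorm n z))"

lemma squeeze_props:
  shows "continuous_map (top_of_set ({0..1} \<times> cube_bd (Suc n))) (top_of_set (cube_bd (Suc n))) (squeeze (Suc n))"
    and "y \<in> cube_bd (Suc n) \<Longrightarrow> squeeze (Suc n) (0, y) = y"
    and "y \<in> cube_bd (Suc n) \<Longrightarrow> y 0 = 1 \<Longrightarrow> s \<in> {0..1} \<Longrightarrow> squeeze (Suc n) (s, y) 0 = 1"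
    and "y \<in> cube_bd (Suc n) \<Longrightarrow> y 0 = 1 \<Longrightarrow> squeeze (Suc n) (1, y) = sphere_base"
proof -
  define z where "z = (\<lambda>(s::real, y::nat \<Rightarrow> real) i. if i = 0 then y 0 else (1 - s * max 0 (y 0)) * y i)"
  have sq: "squeeze (Suc n) w = (\<lambda>i. z w i / cnorm (Suc n) (z w))" for w
    by (simp add: squeeze_def z_def case_prod_unfold Let_def)
  \<comment> \<open>The normalisation is legitimate: coordinate 0 is kept, and where it is zero
    nothing is shrunk.\<close>
  have z0: "0 < cnorm (Suc n) (z (s, y))" if "y \<in> cube_bd (Suc n)" for s y
  proof (cases "y 0 = 0")
    case True
    then have "z (s, y) = y" by (auto simp: z_def)
    then show ?thesis using that by (simp add: cube_bd_def)
  next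
    case False
    then have "0 < \<bar>z (s, y) 0\<bar>" by (simp add: z_def)
    then show ?thesis using abs_le_cnorm[of 0 "Suc n" "z (s, y)"] by simp
  qed
  have cz: "continuous_on S z" for S :: "(real \<times> (nat \<Rightarrow> real)) set"
  proof (rule continuous_on_coordinatewise_then_product)
    fix i
    have c: "continuous_on S (\<lambda>w. snd w k)" for k
      by (rule continuous_on_product_then_coordinatewise) (intro continuous_intros)
    show "continuous_on S (\<lambda>w. z w i)"
      by (cases "i = 0") (auto simp: z_def case_prod_unfold intro!: continuous_intros c)
  qed
  show "continuous_map (top_of_set ({0..1} \<times> cube_bd (Suc n))) (top_of_set (cube_bd (Suc n))) (squeeze (Suc n))"
    unfolding continuous_map_top_of_set
  proof
    have "continuous_on ({0..1} \<times> cube_bd (Suc n)) (\<lambda>w i. z w i / cnorm (Suc n) (z w))"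
    proof (rule continuous_on_coordinatewise_then_product)
      fix i
      have "cnorm (Suc n) (z w) \<noteq> 0" if "w \<in> {0..1} \<times> cube_bd (Suc n)" for w
        using z0[of "snd w" "fst w"] that by (auto simp: less_le)
      then show "continuous_on ({0..1} \<times> cube_bd (Suc n)) (\<lambda>w. z w i / cnorm (Suc n) (z w))"
        by (intro continuous_on_divide continuous_on_cnorm cz continuous_on_product_then_coordinatewise[OF cz]) auto
    qed
    then show "continuous_on ({0..1} \<times> cube_bd (Suc n)) (squeeze (Suc n))" by (simp only: sq[abs_def])
    show "squeeze (Suc n) \<in> {0..1} \<times> cube_bd (Suc n) \<rightarrow> cube_bd (Suc n)"
    proof
      fix w :: "real \<times> (nat \<Rightarrow> real)" assume w: "w \<in> {0..1} \<times> cube_bd (Suc n)"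
      then have "snd w \<in> cube_bd (Suc n)" by auto
      then have "\<forall>i\<ge>Suc n. z w i = 0" by (auto simp: z_def case_prod_unfold cube_bd_def cube_def)
      then show "squeeze (Suc n) w \<in> cube_bd (Suc n)"
        unfolding sq using z0[of "snd w" "fst w"] w by (intro cube_normalize) auto
    qed
  qed
  show "squeeze (Suc n) (0, y) = y" if "y \<in> cube_bd (Suc n)"
  proof -
    have "z (0, y) = y" by (auto simp: z_def)
    then show ?thesis using that by (simp add: sq cube_bd_def)
  qed
  have n1: "cnorm (Suc n) (z (s, y)) = 1" if "y \<in> cube_bd (Suc n)" "y 0 = 1" "s \<in> {0..1}" for s
  proof (rule antisym)
    have "\<bar>z (s, y) i\<bar> \<le> 1" if i: "i < Suc n" for i
    proof -
      have "\<bar>y i\<bar> \<le> 1" using \<open>y \<in> cube_bd (Suc n)\<close> i by (auto simp: cube_bd_def cube_iff)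
      then show ?thesis using \<open>y 0 = 1\<close> \<open>s \<in> {0..1}\<close> by (auto simp: z_def abs_mult mult_le_one)
    qed
    then show "cnorm (Suc n) (z (s, y)) \<le> 1" unfolding cnorm_le_iff by simp
    show "1 \<le> cnorm (Suc n) (z (s, y))"
      using abs_le_cnorm[of 0 "Suc n" "z (s, y)"] that by (simp add: z_def del: cnorm.simps)
  qed
  show "squeeze (Suc n) (s, y) 0 = 1" if "y \<in> cube_bd (Suc n)" "y 0 = 1" "s \<in> {0..1}"
    unfolding sq n1[OF that] using that by (simp add: z_def)
  show "squeeze (Suc n) (1, y) = sphere_base" if "y \<in> cube_bd (Suc n)" "y 0 = 1"
  proof -
    have "cnorm (Suc n) (z (1, y)) = 1" by (rule n1) (use that in auto)
    then show ?thesis unfolding sq using that by (simp only:) (auto simp: z_def sphere_base_def)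
  qed
qed

text \<open>Surjectivity on \<open>\<pi>\<^sub>j\<close> replaces the map \<open>\<psi>\<close> given by \<open>\<Gamma>\<close> and constants on the boundary of
  the prism, up to homotopy, by \<open>f \<circ> h\<close>; after squeezing, both are constant on the bottom face, so
  \<open>h\<close> folded down onto that face gives the required \<open>e'\<close>.\<close>

lemma pi_surjective_fill:
  assumes sur: "pi_surjective j E X f e0" and f: "continuous_map E X f" and e0: "e0 \<in> topspace E"
    and x0: "x0 \<in> topspace X" and j: "j = Suc i"
    and \<Gamma>: "continuous_map (cyl (top_of_set (cube_bd j))) X \<Gamma>"
    and \<Gamma>0: "\<And>x. x \<in> cube_bd j \<Longrightarrow> \<Gamma> (x, 0) = f e0" and \<Gamma>1: "\<And>x. x \<in> cube_bd j \<Longrightarrow> \<Gamma> (x, 1) = x0"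
  obtains e' \<Theta> where "continuous_map (top_of_set (cube j)) E e'" "continuous_map (cyl (top_of_set (cube j))) X \<Theta>"
    "\<And>x. x \<in> cube_bd j \<Longrightarrow> e' x = e0" "\<And>x. x \<in> cube j \<Longrightarrow> \<Theta> (x, 0) = f (e' x)"
    "\<And>x. x \<in> cube j \<Longrightarrow> \<Theta> (x, 1) = x0" "\<And>x t. x \<in> cube_bd j \<Longrightarrow> t \<in> {0..1} \<Longrightarrow> \<Theta> (x, t) = \<Gamma> (x, t)"
proof -
  let ?S = "cube_bd (Suc j)" and ?b = sphere_base
  define fy where "fy = (\<lambda>y. fst (unprism y))"
  have fe0: "f e0 \<in> topspace X" using f e0 by (auto simp: continuous_map_def)
  \<comment> \<open>On the boundary of the prism: \<Gamma> on the sides, the constant f e0 on the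
    face t = 0, which is \<open>y 0 = 1\<close>, and the constant x0 on the face t = 1.\<close>
  define \<psi> where "\<psi> = (\<lambda>y. if cnorm j (fy y) = 1 then \<Gamma> (unprism y) else if y 0 = 1 then f e0 else x0)"
  have yS: "fy y \<in> cube j" "snd (unprism y) \<in> {0..1}" "fy y \<in> cube_bd j \<or> y 0 = 1 \<or> y 0 = -1" if "y \<in> ?S" for y
  proof -
    have "prism (fy y, snd (unprism y)) \<in> ?S" using that by (simp add: fy_def)
    then show "fy y \<in> cube j" "snd (unprism y) \<in> {0..1}" "fy y \<in> cube_bd j \<or> y 0 = 1 \<or> y 0 = -1"
      unfolding prism_in_cube_bd by (auto simp: unprism_def)
  qed
  have y1: "snd (unprism y) = 0 \<longleftrightarrow> y 0 = 1" "snd (unprism y) = 1 \<longleftrightarrow> y 0 = -1" for y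
    by (auto simp: unprism_def)
  have cu: "continuous_on T fy" for T unfolding fy_def by (intro continuous_intros continuous_on_unprism)
  have fyu: "fst (unprism y) = fy y" for y by (simp add: fy_def)
  define S1 where "S1 = {y \<in> ?S. fy y \<in> cube_bd j}"
  define S2 where "S2 = {y \<in> ?S. y 0 = 1}"
  define S3 where "S3 = {y \<in> ?S. y 0 = -1}"
  have cl: "closedin (top_of_set ?S) S1" "closedin (top_of_set ?S) S2" "closedin (top_of_set ?S) S3"
  proof -
    have "S1 = ?S \<inter> fy -` cube_bd j" "S2 = ?S \<inter> (\<lambda>y. y 0) -` {1}" "S3 = ?S \<inter> (\<lambda>y. y 0) -` {-1}"
      by (auto simp: S1_def S2_def S3_def)
    then show "closedin (top_of_set ?S) S1" "closedin (top_of_set ?S) S2" "closedin (top_of_set ?S) S3"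
      by (simp_all add: continuous_closedin_preimage cu closed_cube_bd continuous_on_nth)
  qed
  have cover: "?S = S1 \<union> S2 \<union> S3" using yS by (auto simp: S1_def S2_def S3_def)
  have \<psi>1: "\<psi> y = \<Gamma> (unprism y)" if "y \<in> S1" for y using that by (auto simp: S1_def \<psi>_def cube_bd_def)
  have \<psi>2: "\<psi> y = f e0" if "y \<in> S2" for y
  proof -
    have "unprism y = (fy y, 0)" using that y1 by (auto simp: S2_def fy_def prod_eq_iff)
    then show ?thesis using that \<Gamma>0[of "fy y"] yS[of y] by (auto simp: S2_def \<psi>_def cube_bd_def)
  qed
  have \<psi>3: "\<psi> y = x0" if "y \<in> S3" for y
  proof -
    have "unprism y = (fy y, 1)" using that y1 by (auto simp: S3_def fy_def prod_eq_iff)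
    then show ?thesis using that \<Gamma>1[of "fy y"] yS[of y] by (auto simp: S3_def \<psi>_def cube_bd_def)
  qed
  have \<psi>c: "continuous_map (top_of_set ?S) X \<psi>"
  proof (rule pasting_lemma_closed[where I = "{S1, S2, S3}" and T = id and f = "\<lambda>_. \<psi>"])
    fix A assume A: "A \<in> {S1, S2, S3}"
    then show "closedin (top_of_set ?S) (id A)" using cl by auto
    have "continuous_map (top_of_set S1) X (\<lambda>y. \<Gamma> (unprism y))"
      by (rule continuous_map_compose'[OF _ \<Gamma>])
         (use yS in \<open>auto simp: continuous_map_top_of_set continuous_on_unprism S1_def fyu mem_Times_iff\<close>)
    then have 1: "continuous_map (top_of_set S1) X \<psi>" by (rule continuous_map_eq) (simp add: \<psi>1)
    have 2: "continuous_map (top_of_set S2) X \<psi>"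
      by (rule continuous_map_eq[of _ _ "\<lambda>_. f e0"]) (auto simp: \<psi>2 fe0)
    have 3: "continuous_map (top_of_set S3) X \<psi>"
      by (rule continuous_map_eq[of _ _ "\<lambda>_. x0"]) (auto simp: \<psi>3 x0)
    have "A \<subseteq> ?S" using A by (auto simp: S1_def S2_def S3_def)
    then show "continuous_map (subtopology (top_of_set ?S) (id A)) X \<psi>"
      using 1 2 3 A by (auto simp: subtopology_subtopology Int_absorb1)
  qed (use cover in auto)
  obtain \<rho> where \<rho>: "continuous_map (cyl (top_of_set (cube j))) (cyl (top_of_set (cube j))) \<rho>"
      "\<And>x. x \<in> cube j \<times> {0..1} \<Longrightarrow> \<rho> x \<in> cube j \<times> {0} \<union> cube_bd j \<times> {0..1}"
      "\<And>x. x \<in> cube j \<times> {0} \<union> cube_bd j \<times> {0..1} \<Longrightarrow> \<rho> x = x"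
    using cofibred_pair_cube[of j] unfolding cofibred_pair_def by auto
  \<comment> \<open>The retraction of the cylinder turned upside down: onto the sides and the face t
    = 1.\<close>
  define R where "R = (\<lambda>z::(nat \<Rightarrow> real) \<times> real. (fst (\<rho> (fst z, 1 - snd z)), 1 - snd (\<rho> (fst z, 1 - snd z))))"
  have Rc: "continuous_on (cube j \<times> {0..1}) R"
  proof -
    have "continuous_on (cube j \<times> {0..1}) \<rho>" using \<rho>(1) by (auto simp: continuous_map_top_of_set)
    then have "continuous_on (cube j \<times> {0..1}) (\<lambda>z. \<rho> (fst z, 1 - snd z))"
      by (rule continuous_on_compose2) (auto intro!: continuous_intros)
    then show ?thesis unfolding R_def by (intro continuous_intros)
  qed
  have Rim: "R z \<in> cube_bd j \<times> {0..1} \<union> cube j \<times> {1}" if "z \<in> cube j \<times> {0..1}" for z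
    using \<rho>(2)[of "(fst z, 1 - snd z)"] that by (auto simp: R_def)
  have Rfix: "R z = z" if "z \<in> cube_bd j \<times> {0..1} \<union> cube j \<times> {1}" for z
    using \<rho>(3)[of "(fst z, 1 - snd z)"] that by (auto simp: R_def)
  have PR: "prism (R z) \<in> ?S" if "z \<in> cube j \<times> {0..1}" for z
    using Rim[OF that] cube_bd_subset[of j] by (cases "R z") (auto simp: prism_in_cube_bd)
  \<comment> \<open>The face t = 0 folded onto the sides and the opposite face, with its rim
    fixed.\<close>
  define \<kappa> where "\<kappa> = (\<lambda>x. prism (R (x, 0)))"
  have \<kappa>S: "\<kappa> x \<in> ?S" if "x \<in> cube j" for x using PR[of "(x, 0)"] that by (simp add: \<kappa>_def)
  have \<kappa>c: "continuous_on (cube j) \<kappa>"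
    unfolding \<kappa>_def
    by (rule continuous_on_compose2[OF continuous_on_prism[of UNIV]],
        rule continuous_on_compose2[OF Rc]) (auto intro!: continuous_intros)
  have \<kappa>bd: "\<kappa> x \<in> S2" if "x \<in> cube_bd j" for x
    using Rfix[of "(x, 0)"] that \<kappa>S[of x] cube_bd_subset by (auto simp: \<kappa>_def S2_def prism_def)
  \<comment> \<open>The map \<psi> with its values on the face t = 0 replaced by stage s of K. This
    fits together when K has the value f e0 on the rim, and then fillability passes from time 1 to
    time 0.\<close>
  define glue where "glue = (\<lambda>K (y, s). if y 0 = 1 then K (fy y, s::real) else \<psi> y)"
  have glue_fill: "fillable (Suc j) X (\<lambda>y. glue K (y, 0))"
    if K: "continuous_map (cyl (top_of_set (cube j))) X K" "\<And>x s. x \<in> cube_bd j \<Longrightarrow> s \<in> {0..1} \<Longrightarrow> K (x, s) = f e0"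
      and fill: "fillable (Suc j) X (\<lambda>y. glue K (y, 1))" for K
  proof (rule fillable_homotopy[OF _ fill])
    have e13: "glue K z = \<psi> (fst z)" if "z \<in> (S1 \<union> S3) \<times> {0..1}" for z
    proof (cases "fst z 0 = 1")
      case True
      then have "fst z \<in> S1" "fst z \<in> S2" "fy (fst z) \<in> cube_bd j" using that by (auto simp: S1_def S2_def S3_def)
      then show ?thesis using K(2)[of "fy (fst z)" "snd z"] \<psi>2[of "fst z"] that
        by (auto simp: glue_def case_prod_unfold)
    qed (simp add: glue_def case_prod_unfold)
    have "continuous_map (top_of_set (?S \<times> {0..1})) X (glue K)"
    proof (rule continuous_map_glue_closed)
      show "closedin (top_of_set (?S \<times> {0..1::real})) (S2 \<times> {0..1})"
        "closedin (top_of_set (?S \<times> {0..1::real})) ((S1 \<union> S3) \<times> {0..1})"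
        unfolding prod_topology_subtopology_eu[symmetric] closedin_prod_Times_iff
        using cl by (auto simp: closedin_Un)
      show "topspace (top_of_set (?S \<times> {0..1::real})) \<subseteq> S2 \<times> {0..1} \<union> (S1 \<union> S3) \<times> {0..1}" using cover by auto
      have "continuous_on (S2 \<times> {0..1::real}) (\<lambda>z. fy (fst z))"
        by (rule continuous_on_compose2[OF cu[of UNIV]]) (auto intro: continuous_intros)
      then have "continuous_on (S2 \<times> {0..1::real}) (\<lambda>z. (fy (fst z), snd z))"
        by (rule continuous_on_Pair) (intro continuous_intros)
      then have "continuous_map (top_of_set (S2 \<times> {0..1})) X (\<lambda>z. K (fy (fst z), snd z))"
        by (intro continuous_map_compose'[OF _ K(1)]) (auto simp: continuous_map_top_of_set S2_def yS)
      then have "continuous_map (top_of_set (S2 \<times> {0..1})) X (glue K)"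
        by (rule continuous_map_eq) (auto simp: glue_def S2_def)
      then show "continuous_map (subtopology (top_of_set (?S \<times> {0..1})) (S2 \<times> {0..1})) X (glue K)"
        by (simp add: subtopology_subtopology S2_def Times_Int_Times Int_absorb1 Collect_conj_eq)
      have "continuous_map (top_of_set (?S \<times> {0..1::real})) X (\<lambda>z. \<psi> (fst z))"
        by (rule continuous_map_compose'[OF _ \<psi>c]) (auto simp: continuous_map_top_of_set intro!: continuous_intros)
      then have "continuous_map (subtopology (top_of_set (?S \<times> {0..1::real})) ((S1 \<union> S3) \<times> {0..1})) X (\<lambda>z. \<psi> (fst z))"
        by (rule continuous_map_from_subtopology)
      then show "continuous_map (subtopology (top_of_set (?S \<times> {0..1})) ((S1 \<union> S3) \<times> {0..1})) X (glue K)"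
        by (rule continuous_map_eq) (simp add: e13)
    qed
    then show "continuous_map (cyl (top_of_set ?S)) X (glue K)" by simp
  qed
  obtain \<theta> \<theta>' where \<theta>: "continuous_map (top_of_set ?S) (nsphere j) \<theta>"
    "continuous_map (nsphere j) (top_of_set ?S) \<theta>'"
    "\<And>x. x \<in> ?S \<Longrightarrow> \<theta>' (\<theta> x) = x" "\<And>y. y \<in> topspace (nsphere j) \<Longrightarrow> \<theta> (\<theta>' y) = y"
    "\<theta> ?b = ?b" "\<theta>' ?b = ?b"
    using cube_sphere_homeomorphism by blast
  have bS2: "?b \<in> S2" using sphere_base_in_cube_bd[of j] by (simp add: S2_def sphere_base_def)
  have "pointed_sphere_map j X (f e0) (\<lambda>y. \<psi> (\<theta>' y))"
    unfolding pointed_sphere_map_def \<theta>(6) using \<psi>2[OF bS2] continuous_map_compose'[OF \<theta>(2) \<psi>c] by simp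
  then obtain h where h: "pointed_sphere_map j E e0 h" "pointed_homotopic j X (f e0) (f \<circ> h) (\<lambda>y. \<psi> (\<theta>' y))"
    using sur unfolding pi_surjective_def by blast
  obtain k where k: "continuous_map (prod_topology (top_of_set {0..1::real}) (nsphere j)) X k"
    "\<And>y. k (0, y) = f (h y)" "\<And>y. k (1, y) = \<psi> (\<theta>' y)" "\<And>t. t \<in> {0..1} \<Longrightarrow> k (t, ?b) = f e0"
    using h(2) unfolding pointed_homotopic_def homotopic_with_def by auto
  let ?sq = "squeeze (Suc j)"
  note sq = squeeze_props[where n = j]
  have \<kappa>sq: "continuous_map (cyl (top_of_set (cube j))) (top_of_set ?S) (\<lambda>z. ?sq (snd z, \<kappa> (fst z)))"
  proof (rule continuous_map_compose'[OF _ sq(1)])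
    show "continuous_map (cyl (top_of_set (cube j))) (top_of_set ({0..1} \<times> ?S)) (\<lambda>z. (snd z, \<kappa> (fst z)))"
    proof -
      have "continuous_on (cube j \<times> {0..1::real}) (\<lambda>z. \<kappa> (fst z))"
        by (rule continuous_on_compose2[OF \<kappa>c]) (auto intro: continuous_intros)
      then have "continuous_on (cube j \<times> {0..1::real}) (\<lambda>z. (snd z, \<kappa> (fst z)))"
        by (intro continuous_on_Pair) (auto intro: continuous_intros)
      then show ?thesis by (auto simp: continuous_map_top_of_set \<kappa>S)
    qed
  qed
  define c where "c = (\<lambda>x. ?sq (1, \<kappa> x))"
  have cc: "continuous_map (top_of_set (cube j)) (top_of_set ?S) c"
    unfolding c_def using continuous_map_slice[OF \<kappa>sq, of 1] by simp
  have cbd: "c x = ?b" if "x \<in> cube_bd j" for x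
    using sq(4) \<kappa>bd[OF that] by (simp add: c_def S2_def)
  define e' where "e' = (\<lambda>x. h (\<theta> (c x)))"
  have e'c: "continuous_map (top_of_set (cube j)) E e'"
    unfolding e'_def
    by (rule continuous_map_compose'[OF continuous_map_compose'[OF cc \<theta>(1)]])
       (use h(1) in \<open>simp add: pointed_sphere_map_def\<close>)
  have e'bd: "e' x = e0" if "x \<in> cube_bd j" for x
    using h(1) cbd[OF that] \<theta>(5) by (simp add: e'_def pointed_sphere_map_def)
  \<comment> \<open>K1 undoes the squeezing: \<psi> \<circ> c at time 0, \<psi> \<circ> \<kappa> at
    time 1. K2 is the homotopy supplied by surjectivity: f \<circ> e' at time 0, \<psi> \<circ> c at
    time 1. They meet in \<psi> \<circ> c, so fillability travels from \<psi> \<circ> \<kappa> to f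
    \<circ> e'.\<close>
  define K1 where "K1 = (\<lambda>z. \<psi> (?sq (1 - snd z, \<kappa> (fst z))))"
  define K2 where "K2 = (\<lambda>z. k (snd z, \<theta> (c (fst z))))"
  have flip: "continuous_map (cyl (top_of_set (cube j))) (cyl (top_of_set (cube j))) (\<lambda>z. (fst z, 1 - snd z))"
    by (auto simp: continuous_map_top_of_set intro!: continuous_intros)
  \<comment> \<open>With \<psi> \<circ> \<kappa> on the face t = 0, the map on the boundary of the
    prism extends inside through the retraction R.\<close>
  have "fillable (Suc j) X (\<lambda>y. glue K1 (y, 1))"
    unfolding fillable_def
  proof (intro exI conjI ballI)
    show "continuous_map (top_of_set (cube (Suc j))) X (\<lambda>y. \<psi> (prism (R (unprism y))))"
    proof (rule continuous_map_compose'[OF _ \<psi>c])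
      have un: "unprism y \<in> cube j \<times> {0..1}" if "y \<in> cube (Suc j)" for y
        using that prism_in_cube[of "fst (unprism y)" "snd (unprism y)" j] by (auto simp: mem_Times_iff)
      have "continuous_on (cube (Suc j)) (\<lambda>y. prism (R (unprism y)))"
        by (rule continuous_on_compose2[OF continuous_on_prism[of UNIV]],
            rule continuous_on_compose2[OF Rc continuous_on_unprism]) (auto dest: un)
      then show "continuous_map (top_of_set (cube (Suc j))) (top_of_set ?S) (\<lambda>y. prism (R (unprism y)))"
        using PR[OF un] by (auto simp: continuous_map_top_of_set)
    qed
    fix y assume y: "y \<in> ?S"
    show "\<psi> (prism (R (unprism y))) = glue K1 (y, 1)"
    proof (cases "y 0 = 1")
      case True
      then have u: "unprism y = (fy y, 0)" using y1 by (auto simp: fy_def prod_eq_iff)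
      have "?sq (0, \<kappa> (fy y)) = \<kappa> (fy y)" using sq(2) \<kappa>S yS[OF y] by simp
      then show ?thesis using True by (simp add: glue_def K1_def \<kappa>_def u)
    next
      case False
      have "unprism y = (fy y, snd (unprism y))" by (simp add: fy_def)
      then have "unprism y \<in> cube_bd j \<times> {0..1} \<union> cube j \<times> {1}"
        using yS[OF y] False y1[of y] by (metis (no_types, lifting) SigmaI UnI1 UnI2 insertI1)
      then have "R (unprism y) = unprism y" by (rule Rfix)
      then show ?thesis using False by (simp add: glue_def)
    qed
  qed
  then have "fillable (Suc j) X (\<lambda>y. glue K1 (y, 0))"
  proof (rule glue_fill[rotated 2])
    show "continuous_map (cyl (top_of_set (cube j))) X K1"
      unfolding K1_def using continuous_map_compose'[OF flip continuous_map_compose'[OF \<kappa>sq \<psi>c]] by simp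
    fix x s assume "x \<in> cube_bd j" "s \<in> {0..1::real}"
    then have "?sq (1 - s, \<kappa> x) \<in> ?S" "?sq (1 - s, \<kappa> x) 0 = 1"
      using \<kappa>bd[of x] sq(3)[of "\<kappa> x" "1 - s"] continuous_map_funspace[OF sq(1)] by (auto simp: S2_def)
    then show "K1 (x, s) = f e0" using \<psi>2 by (simp add: K1_def S2_def)
  qed
  then have "fillable (Suc j) X (\<lambda>y. glue K2 (y, 1))"
  proof (rule fillable_cong)
    fix y assume y: "y \<in> ?S"
    have "c (fy y) \<in> ?S" using continuous_map_funspace[OF cc] yS(1)[OF y] by auto
    then have "\<theta>' (\<theta> (c (fy y))) = c (fy y)" by (rule \<theta>(3))
    then show "glue K1 (y, 0) = glue K2 (y, 1)"
      by (simp add: glue_def K1_def K2_def k(3) c_def)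
  qed
  then have "fillable (Suc j) X (\<lambda>y. glue K2 (y, 0))"
  proof (rule glue_fill[rotated 2])
    show "continuous_map (cyl (top_of_set (cube j))) X K2"
      unfolding K2_def
      by (rule continuous_map_compose'[OF _ k(1)])
         (intro continuous_map_pairedI continuous_map_snd
           continuous_map_compose'[OF continuous_map_compose'[OF continuous_map_fst cc] \<theta>(1)])
    show "K2 (x, s) = f e0" if "x \<in> cube_bd j" "s \<in> {0..1}" for x s
      using k(4)[OF that(2)] by (simp add: K2_def cbd[OF that(1)] \<theta>(5))
  qed
  then obtain \<Theta>' where \<Theta>': "continuous_map (top_of_set (cube (Suc j))) X \<Theta>'" "\<And>y. y \<in> ?S \<Longrightarrow> \<Theta>' y = glue K2 (y, 0)"
    unfolding fillable_def by blast
  define \<Theta> where "\<Theta> = (\<lambda>z. \<Theta>' (prism z))"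
  have fyp: "fy (prism (x, t)) = x" for x t by (simp add: fy_def)
  have pS: "prism (x, t) \<in> ?S" if "x \<in> cube j" "t \<in> {0..1}" "x \<in> cube_bd j \<or> t = 0 \<or> t = 1" for x t
    using that by (auto simp: prism_in_cube_bd)
  have p0: "prism (x, t) 0 = 1 - 2 * t" for x t by (simp add: prism_def)
  show thesis
  proof
    show "continuous_map (top_of_set (cube j)) E e'" by (rule e'c)
    show "e' x = e0" if "x \<in> cube_bd j" for x by (rule e'bd[OF that])
    show "continuous_map (cyl (top_of_set (cube j))) X \<Theta>"
      unfolding \<Theta>_def
      by (rule continuous_map_compose'[OF _ \<Theta>'(1)])
         (auto simp: continuous_map_top_of_set continuous_on_prism prism_in_cube)
    show b: "\<Theta> (x, 0) = f (e' x)" if "x \<in> cube j" for x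
      using \<Theta>'(2)[OF pS[OF that, of 0]] by (simp add: \<Theta>_def glue_def p0 fyp K2_def k(2) e'_def)
    show "\<Theta> (x, 1) = x0" if "x \<in> cube j" for x
      using \<Theta>'(2)[OF pS[OF that, of 1]] \<psi>3[of "prism (x, 1)"] pS[OF that, of 1]
      by (simp add: \<Theta>_def glue_def p0 S3_def)
    show "\<Theta> (x, t) = \<Gamma> (x, t)" if x: "x \<in> cube_bd j" and t: "t \<in> {0..1}" for x t
    proof (cases "t = 0")
      case True
      then show ?thesis using b[of x] x cube_bd_subset \<Gamma>0[OF x] e'bd[OF x] by auto
    next
      case False
      have p: "prism (x, t) \<in> ?S" using pS x t cube_bd_subset by blast
      then have "prism (x, t) \<in> S1" using x by (simp add: S1_def fyp)
      then show ?thesis using \<Theta>'(2)[OF p] \<psi>1 False by (simp add: \<Theta>_def glue_def p0)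
    qed
  qed
qed

section \<open>Homotopy fibres, ordinary and fibrewise\<close>

definition fibre :: "'p topology \<Rightarrow> ('p \<Rightarrow> 'x) \<Rightarrow> 'x \<Rightarrow> 'p topology" where
  "fibre P \<pi> x = subtopology P {p. \<pi> p = x}"

lemma continuous_map_fibre:
  "continuous_map Z (fibre P \<pi> x) g \<longleftrightarrow> continuous_map Z P g \<and> (\<forall>z\<in>topspace Z. \<pi> (g z) = x)"
  by (auto simp: fibre_def continuous_map_in_subtopology)

text \<open>Exactness by hand. A map of the boundary into the homotopy fibre is a map e to E with a
  homotopy \<Gamma> from f \<circ> e to a constant. Injectivity one degree down extends e over the
  cube; contracting e inside this extension, while the paths are lengthened accordingly, leaves the
  case of constant e, which surjectivity in degree j settles.\<close>

lemma homotopy_fibre_fill: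
  assumes keq: "k_equivalence k E X f" and j: "j = Suc i" "j \<le> k"
    and u: "continuous_map (top_of_set (cube_bd j))
        (fibre (mapping_paths E X (\<lambda>_. ()) (\<lambda>_. ()) f) (\<lambda>z. snd z 1) x0) u"
  shows "fillable j (fibre (mapping_paths E X (\<lambda>_. ()) (\<lambda>_. ()) f) (\<lambda>z. snd z 1) x0) u"
proof -
  let ?M = "mapping_paths E X (\<lambda>_. ()) (\<lambda>_. ()) f" and ?b = sphere_base
  let ?F = "fibre ?M (\<lambda>z. snd z 1) x0"
  have f: "continuous_map E X f" using keq by (simp add: k_equivalence_def)
  have uM: "continuous_map (top_of_set (cube_bd j)) ?M u" and u1: "\<And>x. x \<in> cube_bd j \<Longrightarrow> snd (u x) 1 = x0"
    using u by (auto simp: continuous_map_fibre)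
  have ut: "u x \<in> topspace ?M" if "x \<in> cube_bd j" for x using continuous_map_funspace[OF uM] that by auto
  note uD = mapping_pathsD[OF ut]
  define e where "e = (\<lambda>x. fst (u x))"
  define \<Gamma> where "\<Gamma> = (\<lambda>z. snd (u (fst z)) (snd z))"
  have ec: "continuous_map (top_of_set (cube_bd j)) E e"
    unfolding e_def by (rule continuous_map_compose'[OF uM mapping_paths_fst])
  have \<Gamma>c: "continuous_map (cyl (top_of_set (cube_bd j))) X \<Gamma>"
    unfolding \<Gamma>_def by (rule mapping_paths_eval[OF continuous_map_compose'[OF continuous_map_fst uM] continuous_map_snd])
  have \<Gamma>0: "\<Gamma> (x, 0) = f (e x)" and \<Gamma>1: "\<Gamma> (x, 1) = x0" if "x \<in> cube_bd j" for x
    using uD(2)[OF that] u1[OF that] by (auto simp: \<Gamma>_def e_def)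
  have b: "?b \<in> cube_bd j" "?b \<in> cube j" using sphere_base_in_cube_bd cube_bd_subset j(1) by blast+
  have x0: "x0 \<in> topspace X" using uD(4)[OF b(1), of 1] u1[OF b(1)] by simp
  define e0 where "e0 = e ?b"
  have e0: "e0 \<in> topspace E" using continuous_map_funspace[OF ec] b by (auto simp: e0_def)
  \<comment> \<open>Injectivity is used in degree j - 1 and surjectivity in degree j; the bijections
    below k and the surjection in degree k supply these for all j up to k.\<close>
  have inj: "pi_injective i E X f e0" and sur: "pi_surjective j E X f e0"
    using keq e0 j unfolding k_equivalence_def by (auto simp: le_less)
  have "fillable j X (\<lambda>x. \<Gamma> (x, 0))"
    by (rule fillable_homotopy[OF \<Gamma>c], rule fillable_cong[OF fillable_const[OF x0]]) (simp add: \<Gamma>1)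
  then have "fillable j X (\<lambda>x. f (e x))" by (rule fillable_cong) (simp add: \<Gamma>0)
  then have "fillable j E e"
    using pi_injective_fill[of i E X f e] inj f ec unfolding j(1) e0_def by blast
  then obtain e2 where e2: "continuous_map (top_of_set (cube j)) E e2" "\<And>x. x \<in> cube_bd j \<Longrightarrow> e2 x = e x"
    unfolding fillable_def by blast
  define mix where "mix = (\<lambda>(x::nat \<Rightarrow> real, r) i. (1 - r) * x i + r * ?b i)"
  have mixq: "mix (x, r) \<in> cube j" if "x \<in> cube_bd j" "r \<in> {0..1}" for x r
    using cube_convex[OF _ b(2), of x r] that cube_bd_subset by (auto simp: mix_def)
  have mixc: "continuous_map (cyl (top_of_set (cube_bd j))) (top_of_set (cube j)) mix"
    unfolding prod_topology_subtopology_eu continuous_map_top_of_set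
  proof
    show "continuous_on (cube_bd j \<times> {0..1}) mix"
      unfolding mix_def case_prod_unfold by (intro continuous_on_coordinatewise_then_product continuous_intros)
    show "mix \<in> cube_bd j \<times> {0..1} \<rightarrow> cube j" using mixq by auto
  qed
  \<comment> \<open>At stage s the path first runs back along the contraction to f (e x), which
    takes time s, and then along \<Gamma>; the total duration 1 + s is rescaled to 1.\<close>
  define N where "N = (\<lambda>z::((nat \<Rightarrow> real) \<times> real) \<times> real. let x = fst (fst z); s = snd (fst z); t = snd z in
       if t * (1 + s) \<le> s then f (e2 (mix (x, s - t * (1 + s)))) else \<Gamma> (x, t * (1 + s) - s))"
  let ?Z = "top_of_set ((cube_bd j \<times> {0..1::real}) \<times> {0..1::real})"
  have Zeq: "cyl (cyl (top_of_set (cube_bd j))) = ?Z" by simp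
  have Nc: "continuous_map ?Z X N"
    unfolding N_def Let_def
  proof (rule continuous_map_cases_le)
    show "continuous_map ?Z euclideanreal (\<lambda>z. snd z * (1 + snd (fst z)))"
      "continuous_map ?Z euclideanreal (\<lambda>z. snd (fst z))"
      by (auto intro!: continuous_intros)
    have "continuous_map (top_of_set {z \<in> (cube_bd j \<times> {0..1::real}) \<times> {0..1::real}. snd z * (1 + snd (fst z)) \<le> snd (fst z)})
       (cyl (top_of_set (cube_bd j))) (\<lambda>z. (fst (fst z), snd (fst z) - snd z * (1 + snd (fst z))))"
      unfolding prod_topology_subtopology_eu continuous_map_top_of_set
    proof
      show "(\<lambda>z. (fst (fst z), snd (fst z) - snd z * (1 + snd (fst z)))) \<in>
         {z \<in> (cube_bd j \<times> {0..1::real}) \<times> {0..1::real}. snd z * (1 + snd (fst z)) \<le> snd (fst z)} \<rightarrow> cube_bd j \<times> {0..1}"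
      proof
        fix z :: "((nat \<Rightarrow> real) \<times> real) \<times> real"
        assume z: "z \<in> {z \<in> (cube_bd j \<times> {0..1::real}) \<times> {0..1::real}. snd z * (1 + snd (fst z)) \<le> snd (fst z)}"
        then have "0 \<le> snd z * (1 + snd (fst z))" by (intro mult_nonneg_nonneg) auto
        then show "(fst (fst z), snd (fst z) - snd z * (1 + snd (fst z))) \<in> cube_bd j \<times> {0..1}"
          using z by auto
      qed
    qed (intro continuous_intros)
    from continuous_map_compose'[OF continuous_map_compose'[OF continuous_map_compose'[OF this mixc] e2(1)] f]
    show "continuous_map (subtopology ?Z {z \<in> topspace ?Z. snd z * (1 + snd (fst z)) \<le> snd (fst z)}) X
      (\<lambda>z. f (e2 (mix (fst (fst z), snd (fst z) - snd z * (1 + snd (fst z))))))"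
      by (simp add: subtopology_subtopology Collect_conj_eq Int_absorb1)
    have "continuous_map (top_of_set {z \<in> (cube_bd j \<times> {0..1::real}) \<times> {0..1::real}. snd (fst z) \<le> snd z * (1 + snd (fst z))})
       (cyl (top_of_set (cube_bd j))) (\<lambda>z. (fst (fst z), snd z * (1 + snd (fst z)) - snd (fst z)))"
      unfolding prod_topology_subtopology_eu continuous_map_top_of_set
    proof
      show "(\<lambda>z. (fst (fst z), snd z * (1 + snd (fst z)) - snd (fst z))) \<in>
         {z \<in> (cube_bd j \<times> {0..1::real}) \<times> {0..1::real}. snd (fst z) \<le> snd z * (1 + snd (fst z))} \<rightarrow> cube_bd j \<times> {0..1}"
      proof
        fix z :: "((nat \<Rightarrow> real) \<times> real) \<times> real"
        assume z: "z \<in> {z \<in> (cube_bd j \<times> {0..1::real}) \<times> {0..1::real}. snd (fst z) \<le> snd z * (1 + snd (fst z))}"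
        then have "snd z * (1 + snd (fst z)) \<le> 1 * (1 + snd (fst z))" by (intro mult_right_mono) auto
        then show "(fst (fst z), snd z * (1 + snd (fst z)) - snd (fst z)) \<in> cube_bd j \<times> {0..1}"
          using z by auto
      qed
    qed (intro continuous_intros)
    from continuous_map_compose'[OF this \<Gamma>c]
    show "continuous_map (subtopology ?Z {z \<in> topspace ?Z. snd (fst z) \<le> snd z * (1 + snd (fst z))}) X
      (\<lambda>z. \<Gamma> (fst (fst z), snd z * (1 + snd (fst z)) - snd (fst z)))"
      by (simp add: subtopology_subtopology Collect_conj_eq Int_absorb1)
    fix z assume "z \<in> topspace ?Z" "snd z * (1 + snd (fst z)) = snd (fst z)"
    then show "f (e2 (mix (fst (fst z), snd (fst z) - snd z * (1 + snd (fst z))))) =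
        \<Gamma> (fst (fst z), snd z * (1 + snd (fst z)) - snd (fst z))"
      by (auto simp: mix_def \<Gamma>0 e2(2))
  qed
  define m where "m = (\<lambda>z. (e2 (mix z), restrict (\<lambda>t. N (z, t)) {0..1}))"
  have mc: "continuous_map (cyl (top_of_set (cube_bd j))) ?F m"
    unfolding continuous_map_fibre
  proof
    show "continuous_map (cyl (top_of_set (cube_bd j))) ?M m"
      unfolding m_def
    proof (rule continuous_map_mapping_paths[OF continuous_map_compose'[OF mixc e2(1)]])
      show "continuous_map (cyl (cyl (top_of_set (cube_bd j)))) X N" using Nc by simp
    qed (auto simp: N_def mix_def)
    show "\<forall>z\<in>topspace (cyl (top_of_set (cube_bd j))). snd (m z) 1 = x0"
      by (auto simp: m_def N_def \<Gamma>1)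
  qed
  have "fillable j ?F (\<lambda>x. m (x, 1))"
  proof -
    define \<Gamma>' where "\<Gamma>' = (\<lambda>z. N ((fst z, 1), snd z))"
    have "continuous_map (cyl (top_of_set (cube_bd j))) X \<Gamma>'"
      unfolding \<Gamma>'_def by (rule continuous_map_compose'[OF _ Nc])
        (auto simp: continuous_map_top_of_set intro!: continuous_intros)
    moreover have mb: "mix (x, 1) = ?b" for x by (simp add: mix_def)
    have "\<Gamma>' (x, 0) = f e0" "\<Gamma>' (x, 1) = x0" if "x \<in> cube_bd j" for x
      using that by (simp_all add: \<Gamma>'_def N_def mb \<Gamma>1 e2(2)[OF b(1)] e0_def)
    ultimately obtain e' \<Theta> where \<Theta>: "continuous_map (top_of_set (cube j)) E e'" "continuous_map (cyl (top_of_set (cube j))) X \<Theta>"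
      "\<And>x. x \<in> cube_bd j \<Longrightarrow> e' x = e0" "\<And>x. x \<in> cube j \<Longrightarrow> \<Theta> (x, 0) = f (e' x)"
      "\<And>x. x \<in> cube j \<Longrightarrow> \<Theta> (x, 1) = x0" "\<And>x t. x \<in> cube_bd j \<Longrightarrow> t \<in> {0..1} \<Longrightarrow> \<Theta> (x, t) = \<Gamma>' (x, t)"
      using pi_surjective_fill[OF sur f e0 x0 j(1), of \<Gamma>'] by blast
    show ?thesis unfolding fillable_def
    proof (intro exI conjI ballI)
      show "continuous_map (top_of_set (cube j)) ?F (\<lambda>x. (e' x, restrict (\<lambda>t. \<Theta> (x, t)) {0..1}))"
        unfolding continuous_map_fibre using \<Theta> by (auto intro!: continuous_map_mapping_paths)
      fix x assume x: "x \<in> cube_bd j"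
      have "restrict (\<lambda>t. \<Theta> (x, t)) {0..1} = restrict (\<lambda>t. N ((x, 1), t)) {0..1}"
        by (rule restrict_ext) (simp add: \<Theta>(6)[OF x] \<Gamma>'_def)
      then show "(e' x, restrict (\<lambda>t. \<Theta> (x, t)) {0..1}) = m (x, 1)"
        by (simp add: m_def \<Theta>(3)[OF x] mb e2(2)[OF b(1)] e0_def)
    qed
  qed
  then have "fillable j ?F (\<lambda>x. m (x, 0))" by (rule fillable_homotopy[OF mc])
  then show ?thesis
  proof (rule fillable_cong)
    fix x assume x: "x \<in> cube_bd j"
    have mx: "mix (x, 0) = x" by (simp add: mix_def)
    have "N ((x, 0), t) = \<Gamma> (x, t)" if "t \<in> {0..1}" for t
      using that by (auto simp: N_def mx e2(2)[OF x] \<Gamma>0[OF x])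
    then have "restrict (\<lambda>t. N ((x, 0), t)) {0..1} = restrict (snd (u x)) {0..1}"
      by (intro restrict_ext) (simp add: \<Gamma>_def)
    also have "\<dots> = snd (u x)" using uD(5)[OF x] by (rule extensional_restrict)
    finally show "m (x, 0) = u x" by (simp add: m_def mx e2(2)[OF x] e_def)
  qed
qed

text \<open>The ordinary homotopy fibre provides a filling G whose paths need not stay in fibres
  over B, although those on the boundary do. Shrunk to their starting points, the paths become
  constant and so fibrewise; relative lifting in the fibrewise mapping path fibration carries them
  back over the points of the paths of G, keeping the boundary.\<close>

lemma mapping_paths_fibre_connected:
  assumes fE: "hurewicz_fibration E B pE" and fX: "hurewicz_fibration X B pX"
    and f: "continuous_map E X f" "\<And>e. e \<in> topspace E \<Longrightarrow> pX (f e) = pE e"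
    and keq: "k_equivalence k E X f"
    and ne: "topspace (fibre (mapping_paths E X pE pX f) (\<lambda>z. snd z 1) x0) \<noteq> {}"
  shows "cube_connected k (fibre (mapping_paths E X pE pX f) (\<lambda>z. snd z 1) x0)"
  unfolding cube_connected_def
proof (intro allI impI)
  let ?M = "mapping_paths E X pE pX f" and ?MT = "mapping_paths E X (\<lambda>_. ()) (\<lambda>_. ()) f"
  let ?F = "fibre ?M (\<lambda>z. snd z 1) x0" and ?FT = "fibre ?MT (\<lambda>z. snd z 1) x0"
  fix j u assume jk: "j \<le> k" and u: "continuous_map (top_of_set (cube_bd j)) ?F u"
  show "fillable j ?F u"
  proof (cases j)
    case 0
    \<comment> \<open>The boundary of the 0-cube is empty, so filling means only that the fibre has
      a point.\<close>
    obtain y where "y \<in> topspace ?F" using ne by blast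
    from fillable_const[OF this] show ?thesis unfolding 0 by (rule fillable_cong) (simp add: cube_bd_0)
  next
    case (Suc i)
    have uM: "continuous_map (top_of_set (cube_bd j)) ?M u" and u1: "\<And>x. x \<in> cube_bd j \<Longrightarrow> snd (u x) 1 = x0"
      using u by (auto simp: continuous_map_fibre)
    have ut: "u x \<in> topspace ?M" if "x \<in> cube_bd j" for x using continuous_map_funspace[OF uM] that by auto
    note uD = mapping_pathsD[OF ut]
    have "continuous_map (top_of_set (cube_bd j)) ?FT u"
      using uM u1 uD(2) unfolding continuous_map_fibre mapping_paths_def continuous_map_in_subtopology
      by (auto simp: case_prod_unfold)
    then have "fillable j ?FT u" using homotopy_fibre_fill[OF keq Suc jk] by blast
    then obtain G where G: "continuous_map (top_of_set (cube j)) ?MT G" "\<And>x. x \<in> cube j \<Longrightarrow> snd (G x) 1 = x0"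
       "\<And>x. x \<in> cube_bd j \<Longrightarrow> G x = u x"
      unfolding fillable_def continuous_map_fibre by auto
    have Gt: "G x \<in> topspace ?MT" if "x \<in> cube j" for x using continuous_map_funspace[OF G(1)] that by auto
    note GD = mapping_pathsD[OF Gt]
    define D where "D = topspace (top_of_set (cube j)) \<times> {0} \<union> cube_bd j \<times> {0..1::real}"
    define q where "q = (\<lambda>z::(nat \<Rightarrow> real) \<times> real. snd (G (fst z)) (snd z))"
    have q: "continuous_map (cyl (top_of_set (cube j))) X q"
      unfolding q_def by (rule mapping_paths_eval[OF continuous_map_compose'[OF continuous_map_fst G(1)] continuous_map_snd])
    \<comment> \<open>The path of G cut off at parameter \<open>snd (fst z)\<close>. Over D it is
      fibrewise: a constant path at parameter 0, and an initial part of a path of u over the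
      boundary.\<close>
    define Q where "Q = (\<lambda>z::((nat \<Rightarrow> real) \<times> real) \<times> real. snd (G (fst (fst z))) (snd (fst z) * snd z))"
    define \<sigma> where "\<sigma> = (\<lambda>z. (fst (G (fst z)), restrict (\<lambda>t. Q (z, t)) {0..1}))"
    have Dsub: "D \<subseteq> cube j \<times> {0..1}" using cube_bd_subset by (auto simp: D_def)
    have "continuous_map (subtopology (cyl (top_of_set (cube j))) D) ?M \<sigma>"
      unfolding \<sigma>_def
    proof (rule continuous_map_mapping_paths)
      show "continuous_map (subtopology (cyl (top_of_set (cube j))) D) E (\<lambda>z. fst (G (fst z)))"
        by (rule continuous_map_compose'[OF continuous_map_compose'[OF continuous_map_fst_sub G(1)] mapping_paths_fst])
      have s: "continuous_map (cyl (subtopology (cyl (top_of_set (cube j))) D)) (top_of_set {0..1}) (\<lambda>z. snd (fst z) * snd z)"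
        unfolding unit_interval_real
      proof
        show "continuous_map (cyl (subtopology (cyl (top_of_set (cube j))) D)) euclideanreal (\<lambda>z. snd (fst z) * snd z)"
          by (intro continuous_intros unit_interval_realD[OF continuous_map_snd]
              unit_interval_realD[OF continuous_map_compose'[OF continuous_map_fst continuous_map_snd_sub]])
        show "\<forall>z\<in>topspace (cyl (subtopology (cyl (top_of_set (cube j))) D)). 0 \<le> snd (fst z) * snd z \<and> snd (fst z) * snd z \<le> 1"
          by (auto simp: mult_le_one)
      qed
      show "continuous_map (cyl (subtopology (cyl (top_of_set (cube j))) D)) X Q"
        unfolding Q_def
        by (rule mapping_paths_eval[OF continuous_map_compose'[OF continuous_map_compose'[OF continuous_map_fst continuous_map_fst_sub] G(1)] s])
      fix z assume "z \<in> topspace (subtopology (cyl (top_of_set (cube j))) D)"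
      then have z: "z \<in> D" "fst z \<in> cube j" "snd z \<in> {0..1}" by auto
      show "Q (z, 0) = f (fst (G (fst z)))" using GD(2)[OF z(2)] by (simp add: Q_def)
      fix t :: real assume t: "t \<in> {0..1}"
      show "pX (Q (z, t)) = pE (fst (G (fst z)))"
      proof (cases "fst z \<in> cube_bd j")
        case True
        have "snd z * t \<in> {0..1}" using z t by (auto simp: mult_le_one)
        then show ?thesis using uD(3)[OF True] by (simp add: Q_def G(3)[OF True])
      next
        case False
        then have "snd z = 0" using z by (auto simp: D_def)
        then show ?thesis using GD(1,2)[OF z(2)] f(2) by (simp add: Q_def)
      qed
    qed
    moreover have "snd (\<sigma> z) 1 = q z" for z by (simp add: \<sigma>_def Q_def q_def)
    ultimately obtain \<sigma>' where \<sigma>': "continuous_map (cyl (top_of_set (cube j))) ?M \<sigma>'"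
      "\<And>z. z \<in> topspace (cyl (top_of_set (cube j))) \<Longrightarrow> snd (\<sigma>' z) 1 = q z" "\<And>z. z \<in> D \<Longrightarrow> \<sigma>' z = \<sigma> z"
      using relative_lifting[OF mapping_paths_fibration[OF fE fX f] cofibred_pair_cube q D_def, of \<sigma>] by blast
    show ?thesis unfolding fillable_def
    proof (intro exI conjI ballI)
      show "continuous_map (top_of_set (cube j)) ?F (\<lambda>x. \<sigma>' (x, 1))"
        unfolding continuous_map_fibre
        using continuous_map_slice[OF \<sigma>'(1), of 1] \<sigma>'(2) G(2) by (auto simp: q_def)
      fix x assume x: "x \<in> cube_bd j"
      have "\<sigma>' (x, 1) = \<sigma> (x, 1)" using x by (intro \<sigma>'(3)) (auto simp: D_def)
      also have "\<dots> = (fst (u x), restrict (snd (u x)) {0..1})" by (simp add: \<sigma>_def Q_def G(3)[OF x])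
      also have "\<dots> = u x" using extensional_restrict[OF uD(5)[OF x]] by simp
      finally show "\<sigma>' (x, 1) = u x" .
    qed
  qed
qed

section \<open>Fibres of the fibrewise join\<close>

lemma partial_map_subspace_iff:
  "partial_map Z (subtopology P A) h \<longleftrightarrow>
     partial_map Z P h \<and> (\<forall>z\<in>topspace Z. \<forall>p. h z = Some p \<longrightarrow> p \<in> A)"
proof
  assume L: "partial_map Z (subtopology P A) h"
  have "openin Z {z \<in> topspace Z. \<exists>p\<in>W. h z = Some p}" if "openin P W" for W
  proof -
    have "openin Z {z \<in> topspace Z. \<exists>p\<in>W \<inter> A. h z = Some p}"
      using L that openin_subtopology_Int unfolding partial_map_def by blast
    moreover have "{z \<in> topspace Z. \<exists>p\<in>W \<inter> A. h z = Some p} = {z \<in> topspace Z. \<exists>p\<in>W. h z = Some p}"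
      using L unfolding partial_map_def by auto
    ultimately show ?thesis by simp
  qed
  then show "partial_map Z P h \<and> (\<forall>z\<in>topspace Z. \<forall>p. h z = Some p \<longrightarrow> p \<in> A)"
    using L unfolding partial_map_def by auto
next
  assume R: "partial_map Z P h \<and> (\<forall>z\<in>topspace Z. \<forall>p. h z = Some p \<longrightarrow> p \<in> A)"
  have "openin Z {z \<in> topspace Z. \<exists>p\<in>W. h z = Some p}" if W: "openin (subtopology P A) W" for W
  proof -
    obtain W' where W': "openin P W'" "W = W' \<inter> A" using W by (auto simp: openin_subtopology)
    have "{z \<in> topspace Z. \<exists>p\<in>W. h z = Some p} = {z \<in> topspace Z. \<exists>p\<in>W'. h z = Some p}"
      using R by (auto simp: W'(2))
    then show ?thesis using R W'(1) unfolding partial_map_def by simp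
  qed
  then show "partial_map Z (subtopology P A) h"
    using R unfolding partial_map_def by auto
qed

text \<open>The fibre of the fibrewise join is the join of copies of the fibre: both have the same
  points, and the identity is continuous in both directions.\<close>

lemma join_fibre_connected:
  assumes "cube_connected k (fibre P \<pi> x)"
  shows "cube_connected (Suc n * (k + 1) - 1) (fibre (join_space P \<pi> (Suc n)) (join_proj \<pi>) x)"
proof (rule cube_connected_retract)
  let ?J = "join_space P \<pi> (Suc n)"
  let ?F = "fibre ?J (join_proj \<pi>) x" and ?T = "join_space (fibre P \<pi> x) (\<lambda>_. ()) (Suc n)"
  show "cube_connected (Suc n * (k + 1) - 1) ?T" by (rule join_connected[OF assms])
  have memF: "h \<in> join_carrier P \<pi> (Suc n) \<and> join_proj \<pi> h = x" if "h \<in> topspace ?F" for h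
    using that by (auto simp: fibre_def topspace_join_space)
  have val: "\<pi> p = x" if "h \<in> topspace ?F" "h i = Some p" for h i p
    using memF[OF that(1)] join_proj_eq[of h P \<pi> "Suc n" i p] that(2) by auto
  show "continuous_map ?F ?T (\<lambda>h. h)"
    unfolding continuous_map_join_iff
  proof (intro conjI ballI allI)
    fix h assume h: "h \<in> topspace ?F"
    show "h \<in> join_carrier (fibre P \<pi> x) (\<lambda>_. ()) (Suc n)"
    proof -
      have c: "\<forall>i\<ge>Suc n. h i = None" "\<exists>i. h i \<noteq> None" "\<And>i p. h i = Some p \<Longrightarrow> p \<in> topspace P"
        using memF[OF h] unfolding join_carrier_def by blast+
      moreover have "p \<in> topspace (fibre P \<pi> x)" if "h i = Some p" for i p
        using c(3)[OF that] val[OF h that] by (simp add: fibre_def)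
      ultimately show ?thesis unfolding join_carrier_def by blast
    qed
  next
    fix i
    have "continuous_map ?F ?J (\<lambda>h. h)"
      unfolding fibre_def by (intro continuous_map_from_subtopology) simp
    then have "partial_map ?F P (\<lambda>h. h i)" unfolding continuous_map_join_iff by blast
    then show "partial_map ?F (fibre P \<pi> x) (\<lambda>h. h i)"
      unfolding fibre_def[of P] partial_map_subspace_iff using val by blast
  qed
  have car: "h \<in> join_carrier P \<pi> (Suc n)" and pr: "join_proj \<pi> h = x" if h: "h \<in> topspace ?T" for h
  proof -
    have h': "h \<in> join_carrier (fibre P \<pi> x) (\<lambda>_. ()) (Suc n)" using h by (simp only: topspace_join_space)
    then have v: "p \<in> topspace P \<and> \<pi> p = x" if "h i = Some p" for i p
      using that by (auto simp: join_carrier_def fibre_def)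
    have "\<forall>i\<ge>Suc n. h i = None" "\<exists>i. h i \<noteq> None" using h' unfolding join_carrier_def by blast+
    then show c: "h \<in> join_carrier P \<pi> (Suc n)" using v unfolding join_carrier_def by blast
    obtain i p where "h i = Some p" using h' by (rule join_carrierE)
    then show "join_proj \<pi> h = x" using join_proj_eq[OF c] v by auto
  qed
  show "continuous_map ?T ?F (\<lambda>h. h)"
    unfolding continuous_map_fibre continuous_map_join_iff
  proof (intro conjI ballI allI car pr)
    fix i
    have "continuous_map ?T ?T (\<lambda>h. h)" by simp
    then have "partial_map ?T (fibre P \<pi> x) (\<lambda>h. h i)" unfolding continuous_map_join_iff by blast
    then show "partial_map ?T P (\<lambda>h. h i)"
      unfolding fibre_def[of P] partial_map_subspace_iff by blast
  qed
qed simp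

section \<open>Lifting over cubes and CW complexes\<close>

text \<open>The lift on the boundary is carried along the radial contraction of the cube into the
  fibre over the image of the centre, filled there, and brought back by relative lifting.\<close>

lemma cube_lifting:
  assumes fib: "hurewicz_fibration J X p" and con: "cube_connected r (fibre J p (q (\<lambda>_. 0)))" and "j \<le> r"
    and q: "continuous_map (top_of_set (cube j)) X q"
    and \<sigma>: "continuous_map (top_of_set (cube_bd j)) J \<sigma>" "\<And>x. x \<in> cube_bd j \<Longrightarrow> p (\<sigma> x) = q x"
  obtains \<sigma>' where "continuous_map (top_of_set (cube j)) J \<sigma>'" "\<And>x. x \<in> cube j \<Longrightarrow> p (\<sigma>' x) = q x"
    "\<And>x. x \<in> cube_bd j \<Longrightarrow> \<sigma>' x = \<sigma> x"
proof -
  define sc where "sc = (\<lambda>z::(nat \<Rightarrow> real) \<times> real. \<lambda>i. snd z * fst z i)"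
  have scc: "continuous_on S sc" for S
    unfolding sc_def by (intro continuous_on_coordinatewise_then_product continuous_intros)
  have scq: "sc z \<in> cube j" if "z \<in> cube j \<times> {0..1}" for z
    using that cube_scale[of "fst z" j "snd z"] by (auto simp: sc_def)
  have q1: "continuous_map (cyl (top_of_set (cube j))) X (\<lambda>z. q (sc z))"
    by (rule continuous_map_compose'[OF _ q]) (auto simp: continuous_map_top_of_set scc scq)
  have flip: "continuous_map (cyl (top_of_set (cube_bd j))) (cyl (top_of_set (cube j))) (\<lambda>z. (fst z, 1 - snd z))"
    using cube_bd_subset[of j] by (auto simp: continuous_map_top_of_set intro!: continuous_intros)
  have l1: "continuous_map (cyl (top_of_set (cube_bd j))) X (\<lambda>z. q (sc (fst z, 1 - snd z)))"
    by (rule continuous_map_compose'[OF flip q1])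
  have l2: "q (sc (fst (x, 0::real), 1 - snd (x, 0::real))) = p (\<sigma> x)" if "x \<in> topspace (top_of_set (cube_bd j))" for x
    using that \<sigma>(2) by (simp add: sc_def)
  obtain G where G: "continuous_map (cyl (top_of_set (cube_bd j))) J G"
    "\<And>x t. x \<in> cube_bd j \<Longrightarrow> t \<in> {0..1} \<Longrightarrow> p (G (x, t)) = q (sc (x, 1 - t))" "\<And>x. x \<in> cube_bd j \<Longrightarrow> G (x, 0) = \<sigma> x"
    using HLP_lift[OF hurewicz_fibration_HLP[OF fib] \<sigma>(1) l1 l2] by auto
  have sc0: "sc (x, 0) = (\<lambda>_. 0)" for x by (simp add: sc_def)
  have "continuous_map (top_of_set (cube_bd j)) (fibre J p (q (\<lambda>_. 0))) (\<lambda>x. G (x, 1))"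
    unfolding continuous_map_fibre using continuous_map_slice[OF G(1), of 1] G(2)[of _ 1] by (simp add: sc0)
  then have "fillable j (fibre J p (q (\<lambda>_. 0))) (\<lambda>x. G (x, 1))"
    using con \<open>j \<le> r\<close> unfolding cube_connected_def by blast
  then obtain F where F: "continuous_map (top_of_set (cube j)) J F" "\<And>x. x \<in> cube j \<Longrightarrow> p (F x) = q (\<lambda>_. 0)"
    "\<And>x. x \<in> cube_bd j \<Longrightarrow> F x = G (x, 1)"
    unfolding fillable_def continuous_map_fibre by auto
  define D where "D = topspace (top_of_set (cube j)) \<times> {0} \<union> cube_bd j \<times> {0..1::real}"
  \<comment> \<open>At time 0 the filling over the centre, on the sides the transport of the
    boundary lift run backwards. At time 1 a lift with these values covers q and restricts to
    \<sigma> on the boundary.\<close>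
  define \<zeta> where "\<zeta> = (\<lambda>z. if snd z = 0 then F (fst z) else G (fst z, 1 - snd z))"
  have Ds: "D \<subseteq> cube j \<times> {0..1}" using cube_bd_subset by (auto simp: D_def)
  have \<zeta>c: "continuous_map (subtopology (cyl (top_of_set (cube j))) D) J \<zeta>"
  proof (rule continuous_map_glue_closed)
    have c: "closed (cube j \<times> {0::real})" "closed (cube_bd j \<times> {0..1::real})"
      by (auto intro!: closed_Times closed_cube_bd compact_imp_closed[OF compact_cube])
    show "closedin (subtopology (cyl (top_of_set (cube j))) D) (cube j \<times> {0})"
      "closedin (subtopology (cyl (top_of_set (cube j))) D) (cube_bd j \<times> {0..1})"
      using c Ds by (auto simp: subtopology_subtopology Int_absorb1 D_def intro!: closed_subset)
    have "continuous_map (top_of_set (cube j \<times> {0::real})) J (\<lambda>z. F (fst z))"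
      by (rule continuous_map_compose'[OF _ F(1)]) (auto simp: continuous_map_top_of_set intro!: continuous_intros)
    then have 1: "continuous_map (top_of_set (cube j \<times> {0::real})) J \<zeta>"
      by (rule continuous_map_eq) (auto simp: \<zeta>_def)
    have "continuous_map (top_of_set (cube_bd j \<times> {0..1})) J (\<lambda>z. G (fst z, 1 - snd z))"
      by (rule continuous_map_compose'[OF _ G(1)]) (auto simp: continuous_map_top_of_set intro!: continuous_intros)
    then have 2: "continuous_map (top_of_set (cube_bd j \<times> {0..1})) J \<zeta>"
      by (rule continuous_map_eq) (auto simp: \<zeta>_def F(3))
    have s: "cube j \<times> {0} \<subseteq> D" "cube_bd j \<times> {0..1} \<subseteq> D" by (auto simp: D_def)
    have e: "subtopology (subtopology (cyl (top_of_set (cube j))) D) A = top_of_set A" if "A \<subseteq> D" for A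
    proof -
      have "cube j \<times> {0..1} \<inter> (D \<inter> A) = A" using that Ds by blast
      then show ?thesis by (simp add: subtopology_subtopology Int_assoc)
    qed
    show "continuous_map (subtopology (subtopology (cyl (top_of_set (cube j))) D) (cube j \<times> {0})) J \<zeta>"
      "continuous_map (subtopology (subtopology (cyl (top_of_set (cube j))) D) (cube_bd j \<times> {0..1})) J \<zeta>"
      using 1 2 unfolding e[OF s(1)] e[OF s(2)] by simp_all
  qed (auto simp: D_def)
  have \<zeta>p: "p (\<zeta> z) = q (sc z)" if "z \<in> D" for z
  proof (cases "snd z = 0")
    case True
    then show ?thesis using that Ds F(2)[of "fst z"] sc0[of "fst z"] by (auto simp: \<zeta>_def)
  next
    case False
    then have "fst z \<in> cube_bd j" "snd z \<in> {0..1}" using that by (auto simp: D_def)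
    then show ?thesis using False G(2)[of "fst z" "1 - snd z"] by (auto simp: \<zeta>_def)
  qed
  obtain \<zeta>' where \<zeta>': "continuous_map (cyl (top_of_set (cube j))) J \<zeta>'"
    "\<And>z. z \<in> topspace (cyl (top_of_set (cube j))) \<Longrightarrow> p (\<zeta>' z) = q (sc z)" "\<And>z. z \<in> D \<Longrightarrow> \<zeta>' z = \<zeta> z"
    using relative_lifting[OF fib cofibred_pair_cube q1 D_def \<zeta>c \<zeta>p] by blast
  show thesis
  proof
    show "continuous_map (top_of_set (cube j)) J (\<lambda>x. \<zeta>' (x, 1))"
      using continuous_map_slice[OF \<zeta>'(1), of 1] by simp
    show "p (\<zeta>' (x, 1)) = q x" if "x \<in> cube j" for x using \<zeta>'(2)[of "(x, 1)"] that by (simp add: sc_def)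
    show "\<zeta>' (x, 1) = \<sigma> x" if "x \<in> cube_bd j" for x
      using \<zeta>'(3)[of "(x, 1)"] that G(3) by (simp add: D_def \<zeta>_def)
  qed
qed

text \<open>The product of the m-disc with the interval is a cube of dimension m + 1 whose boundary
  is S; hence the condition \<open>Suc m \<le> r\<close>.\<close>

lemma disc_lifting:
  assumes fib: "hurewicz_fibration J X p"
    and con: "\<And>z. z \<in> disc m \<times> {0..1} \<Longrightarrow> cube_connected r (fibre J p (q z))" and "Suc m \<le> r"
    and q: "continuous_map (top_of_set (disc m \<times> {0..1})) X q"
    and S: "S = {z \<in> disc m \<times> {0..1::real}. enorm m (fst z) = 1 \<or> snd z = 0 \<or> snd z = 1}"
    and \<sigma>: "continuous_map (top_of_set S) J \<sigma>" "\<And>z. z \<in> S \<Longrightarrow> p (\<sigma> z) = q z"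
  obtains \<sigma>' where "continuous_map (top_of_set (disc m \<times> {0..1})) J \<sigma>'"
    "\<And>z. z \<in> disc m \<times> {0..1} \<Longrightarrow> p (\<sigma>' z) = q z" "\<And>z. z \<in> S \<Longrightarrow> \<sigma>' z = \<sigma> z"
proof -
  obtain \<theta> \<theta>' where h: "homeomorphism (cube m) (disc m) \<theta> \<theta>'"
    and e: "\<And>x. x \<in> cube m \<Longrightarrow> enorm m (\<theta> x) = cnorm m x"
    using cube_disc_homeomorphism[of m] by metis
  have \<theta>: "continuous_on (cube m) \<theta>" "\<And>x. x \<in> cube m \<Longrightarrow> \<theta> x \<in> disc m"
    "continuous_on (disc m) \<theta>'" "\<And>x. x \<in> disc m \<Longrightarrow> \<theta>' x \<in> cube m \<and> \<theta> (\<theta>' x) = x"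
    using h unfolding homeomorphism_def by auto
  define \<phi> where "\<phi> = (\<lambda>y. (\<theta> (fst (unprism y)), snd (unprism y)))"
  define \<phi>' where "\<phi>' = (\<lambda>z. prism (\<theta>' (fst z), snd z))"
  have un: "fst (unprism y) \<in> cube m" "snd (unprism y) \<in> {0..1}" if "y \<in> cube (Suc m)" for y
    using that prism_in_cube[of "fst (unprism y)" "snd (unprism y)" m] by auto
  have \<phi>m: "\<phi> y \<in> disc m \<times> {0..1}" if "y \<in> cube (Suc m)" for y
    using un[OF that] \<theta>(2) by (auto simp: \<phi>_def)
  have \<phi>S: "\<phi> y \<in> S" if y: "y \<in> cube_bd (Suc m)" for y
  proof -
    have yq: "y \<in> cube (Suc m)" using y cube_bd_subset by blast
    have "prism (fst (unprism y), snd (unprism y)) \<in> cube_bd (Suc m)" using y by simp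
    then have "fst (unprism y) \<in> cube_bd m \<or> snd (unprism y) = 0 \<or> snd (unprism y) = 1"
      unfolding prism_in_cube_bd by blast
    then have "enorm m (fst (\<phi> y)) = 1 \<or> snd (\<phi> y) = 0 \<or> snd (\<phi> y) = 1"
      using e[OF un(1)[OF yq]] by (auto simp: \<phi>_def cube_bd_def)
    then show ?thesis using \<phi>m[OF yq] by (simp add: S)
  qed
  have \<phi>c: "continuous_on (cube (Suc m)) \<phi>"
    unfolding \<phi>_def
    by (intro continuous_on_Pair continuous_on_compose2[OF \<theta>(1)] continuous_on_fst continuous_on_snd continuous_on_unprism)
       (use un in auto)
  have \<phi>'m: "\<phi>' z \<in> cube (Suc m)" "\<phi> (\<phi>' z) = z" if "z \<in> disc m \<times> {0..1}" for z
    using that \<theta>(4)[of "fst z"] by (auto simp: \<phi>'_def \<phi>_def prism_in_cube)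
  have \<phi>'S: "\<phi>' z \<in> cube_bd (Suc m)" if z: "z \<in> S" for z
  proof -
    have zd: "fst z \<in> disc m" "snd z \<in> {0..1}" using z by (auto simp: S)
    have "cnorm m (\<theta>' (fst z)) = enorm m (fst z)" using e[of "\<theta>' (fst z)"] \<theta>(4)[OF zd(1)] by simp
    then have "\<theta>' (fst z) \<in> cube_bd m \<or> snd z = 0 \<or> snd z = 1"
      using z \<theta>(4)[OF zd(1)] unfolding S cube_bd_def by auto
    then show ?thesis using zd \<theta>(4)[OF zd(1)] unfolding \<phi>'_def prism_in_cube_bd by blast
  qed
  have \<phi>'c: "continuous_on (disc m \<times> {0..1}) \<phi>'"
  proof -
    have "continuous_on (disc m \<times> {0..1::real}) (\<lambda>z. \<theta>' (fst z))"
      by (rule continuous_on_compose2[OF \<theta>(3)]) (auto intro: continuous_intros)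
    from continuous_on_Pair[OF this continuous_on_snd[OF continuous_on_id]]
    show ?thesis unfolding \<phi>'_def by (rule continuous_on_compose2[OF continuous_on_prism[of UNIV]]) simp
  qed
  have q': "continuous_map (top_of_set (cube (Suc m))) X (\<lambda>y. q (\<phi> y))"
    by (rule continuous_map_compose'[OF _ q]) (use \<phi>c \<phi>m in \<open>auto simp: continuous_map_top_of_set\<close>)
  have \<sigma>1: "continuous_map (top_of_set (cube_bd (Suc m))) J (\<lambda>y. \<sigma> (\<phi> y))"
    by (rule continuous_map_compose'[OF _ \<sigma>(1)])
       (use continuous_on_subset[OF \<phi>c cube_bd_subset] \<phi>S in \<open>auto simp: continuous_map_top_of_set\<close>)
  have \<sigma>2: "p (\<sigma> (\<phi> y)) = q (\<phi> y)" if "y \<in> cube_bd (Suc m)" for y using \<sigma>(2) \<phi>S[OF that] by blast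
  obtain \<zeta> where \<zeta>: "continuous_map (top_of_set (cube (Suc m))) J \<zeta>" "\<And>y. y \<in> cube (Suc m) \<Longrightarrow> p (\<zeta> y) = q (\<phi> y)"
    "\<And>y. y \<in> cube_bd (Suc m) \<Longrightarrow> \<zeta> y = \<sigma> (\<phi> y)"
    using cube_lifting[OF fib con[OF \<phi>m[OF zero_in_cube]] \<open>Suc m \<le> r\<close> q' \<sigma>1 \<sigma>2] by blast
  show thesis
  proof
    show "continuous_map (top_of_set (disc m \<times> {0..1})) J (\<lambda>z. \<zeta> (\<phi>' z))"
      by (rule continuous_map_compose'[OF _ \<zeta>(1)]) (use \<phi>'c \<phi>'m(1) in \<open>auto simp: continuous_map_top_of_set\<close>)
    show "p (\<zeta> (\<phi>' z)) = q z" if "z \<in> disc m \<times> {0..1}" for z using \<zeta>(2)[OF \<phi>'m(1)[OF that]] \<phi>'m(2)[OF that] by simp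
    show "\<zeta> (\<phi>' z) = \<sigma> z" if "z \<in> S" for z using \<zeta>(3)[OF \<phi>'S[OF that]] \<phi>'m(2)[of z] that by (simp add: S)
  qed
qed

section \<open>Lifting cell by cell over a CW complex\<close>

definition skel :: "'b set set \<Rightarrow> ('b set \<Rightarrow> nat) \<Rightarrow> nat \<Rightarrow> 'b set" where
  "skel cs d m = \<Union>{c \<in> cs. d c < m}"

context
  fixes B :: "'b topology" and cs d \<Phi>
  assumes cw: "cw_structure B cs d \<Phi>"
begin

lemma cw_facts:
  assumes c: "c \<in> cs"
  shows "continuous_map (top_of_set (disc (d c))) B (\<Phi> c)"
    and "\<Phi> c ` {x \<in> disc (d c). enorm (d c) x < 1} = c" and "inj_on (\<Phi> c) {x \<in> disc (d c). enorm (d c) x < 1}"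
    and "\<And>x. x \<in> disc (d c) \<Longrightarrow> enorm (d c) x = 1 \<Longrightarrow> \<Phi> c x \<in> skel cs d (d c)"
    and "finite {c'\<in>cs. c' \<inter> \<Phi> c ` disc (d c) \<noteq> {}}"
proof -
  have e: "(\<Sum>i<d c. (x i)\<^sup>2) < 1 \<longleftrightarrow> enorm (d c) x < 1" "(\<Sum>i<d c. (x i)\<^sup>2) = 1 \<longleftrightarrow> enorm (d c) x = 1" for x
    by (auto simp: enorm_def)
  have cB: "c \<subseteq> topspace B" using c cw unfolding cw_structure_def by blast
  have 1: "continuous_map (ndisc (d c)) B (\<Phi> c)"
    "homeomorphic_map (subtopology (ndisc (d c)) {x. (\<Sum>i<d c. x i ^ 2) < 1}) (subtopology B c) (\<Phi> c)"
    "\<Phi> c ` {x \<in> topspace (ndisc (d c)). (\<Sum>i<d c. x i ^ 2) = 1} \<subseteq> \<Union>{c'\<in>cs. d c' < d c}"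
    "finite {c'\<in>cs. c' \<inter> \<Phi> c ` topspace (ndisc (d c)) \<noteq> {}}"
    using c cw unfolding cw_structure_def by blast+
  show "continuous_map (top_of_set (disc (d c))) B (\<Phi> c)" using 1(1) by (simp add: ndisc_eq)
  have t: "topspace (subtopology (ndisc (d c)) {x. (\<Sum>i<d c. x i ^ 2) < 1}) = {x \<in> disc (d c). enorm (d c) x < 1}"
    by (auto simp: ndisc_eq e)
  show "\<Phi> c ` {x \<in> disc (d c). enorm (d c) x < 1} = c"
    using homeomorphic_imp_surjective_map[OF 1(2)] cB unfolding t by (simp add: Int_absorb1)
  show "inj_on (\<Phi> c) {x \<in> disc (d c). enorm (d c) x < 1}"
    using homeomorphic_imp_injective_map[OF 1(2)] unfolding t .
  show "\<Phi> c x \<in> skel cs d (d c)" if "x \<in> disc (d c)" "enorm (d c) x = 1" for x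
    using 1(3) that unfolding skel_def by (auto simp: ndisc_eq e)
  show "finite {c'\<in>cs. c' \<inter> \<Phi> c ` disc (d c) \<noteq> {}}" using 1(4) by (simp add: ndisc_eq)
qed

lemma cw_cells_disjoint: "c \<in> cs \<Longrightarrow> c' \<in> cs \<Longrightarrow> b \<in> c \<Longrightarrow> b \<in> c' \<Longrightarrow> c = c'"
  using cw unfolding cw_structure_def pairwise_def disjnt_def by blast

lemma skel_sub: "skel cs d m \<subseteq> topspace B"
  using cw unfolding cw_structure_def skel_def by blast

lemma cell_closure_skel:
  assumes "c \<in> cs" "d c < m" "x \<in> disc (d c)"
  shows "\<Phi> c x \<in> skel cs d m"
proof (cases "enorm (d c) x < 1")
  case True
  then have "\<Phi> c x \<in> c" using cw_facts(2)[OF assms(1)] assms(3) by blast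
  then show ?thesis using assms by (auto simp: skel_def)
next
  case False
  then have "enorm (d c) x = 1" using assms(3) by (simp add: disc_def)
  then have "\<Phi> c x \<in> skel cs d (d c)" using cw_facts(4)[OF assms(1,3)] by blast
  then show ?thesis using assms(2) by (auto simp: skel_def)
qed

lemma compact_disc: "compact (disc n)"
proof -
  obtain \<theta> \<theta>' where "homeomorphism (cube n) (disc n) \<theta> \<theta>'" using cube_disc_homeomorphism[of n] by metis
  then show ?thesis using compact_continuous_image[OF _ compact_cube, of n \<theta>] unfolding homeomorphism_def by auto
qed

text \<open>The weak topology has to be tested against all cells of B, also those of dimension at
  least m. By closure finiteness the closure of any cell meets only finitely many cells of the
  skeleton, and on the closure of each of these the trace of the set is the image of a compact set,
  hence closed in the Hausdorff space B.\<close>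

lemma continuous_map_skeleton:
  assumes g: "\<And>c. c \<in> cs \<Longrightarrow> d c < m \<Longrightarrow> continuous_map (top_of_set (disc (d c))) T (\<lambda>x. g (\<Phi> c x))"
  shows "continuous_map (subtopology B (skel cs d m)) T g"
  unfolding continuous_map_closedin
proof (intro conjI allI impI funcsetI)
  have ts: "topspace (subtopology B (skel cs d m)) = skel cs d m" using skel_sub by auto
  show "g b \<in> topspace T" if "b \<in> topspace (subtopology B (skel cs d m))" for b
  proof -
    have "b \<in> skel cs d m" using that ts by blast
    then obtain c where c: "c \<in> cs" "d c < m" "b \<in> c" by (auto simp: skel_def)
    then obtain x where "x \<in> disc (d c)" "b = \<Phi> c x" using cw_facts(2)[OF c(1)] by blast
    then show ?thesis using continuous_map_funspace[OF g[OF c(1,2)]] by auto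
  qed
  fix C assume C: "closedin T C"
  define K where "K = {b \<in> skel cs d m. g b \<in> C}"
  have Hd: "Hausdorff_space B" using cw by (simp add: cw_structure_def)
  have KB: "K \<subseteq> topspace B" using skel_sub by (auto simp: K_def)
  have img: "closedin B (\<Phi> c ` A)" if "c \<in> cs" "closedin (top_of_set (disc (d c))) A" for c A
  proof -
    have "compact A" by (rule closedin_compact[OF compact_disc that(2)])
    then have "compactin (top_of_set (disc (d c))) A"
      using closedin_subset[OF that(2)] by (simp add: compactin_subtopology)
    then have "compactin B (\<Phi> c ` A)" by (rule image_compactin[OF _ cw_facts(1)[OF that(1)]])
    then show ?thesis by (rule compactin_imp_closedin[OF Hd])
  qed
  have Kc: "closedin B (K \<inter> \<Phi> c ` disc (d c))" if c: "c \<in> cs" "d c < m" for c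
  proof -
    have "closedin (top_of_set (disc (d c))) {x \<in> disc (d c). g (\<Phi> c x) \<in> C}"
      using closedin_continuous_map_preimage[OF g[OF c] C] by simp
    then have "closedin B (\<Phi> c ` {x \<in> disc (d c). g (\<Phi> c x) \<in> C})" by (rule img[OF c(1)])
    moreover have "\<Phi> c ` {x \<in> disc (d c). g (\<Phi> c x) \<in> C} = K \<inter> \<Phi> c ` disc (d c)"
      using cell_closure_skel[OF c] by (auto simp: K_def)
    ultimately show ?thesis by simp
  qed
  have "closedin (subtopology B (\<Phi> c ` topspace (ndisc (d c)))) (K \<inter> \<Phi> c ` topspace (ndisc (d c)))" if c: "c \<in> cs" for c
  proof -
    define F where "F = {c'\<in>cs. c' \<inter> \<Phi> c ` disc (d c) \<noteq> {} \<and> d c' < m}"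
    have "finite F" by (rule finite_subset[OF _ cw_facts(5)[OF c]]) (auto simp: F_def)
    moreover have cl: "closedin B (\<Phi> c ` disc (d c))"
      by (rule img[OF c]) simp
    ultimately have "closedin B (\<Union>c'\<in>F. (K \<inter> \<Phi> c' ` disc (d c')) \<inter> \<Phi> c ` disc (d c))"
      by (intro closedin_Union finite_imageI) (auto simp: F_def intro!: closedin_Int Kc)
    moreover have "(\<Union>c'\<in>F. (K \<inter> \<Phi> c' ` disc (d c')) \<inter> \<Phi> c ` disc (d c)) = K \<inter> \<Phi> c ` disc (d c)"
    proof
      show "K \<inter> \<Phi> c ` disc (d c) \<subseteq> (\<Union>c'\<in>F. (K \<inter> \<Phi> c' ` disc (d c')) \<inter> \<Phi> c ` disc (d c))"
      proof
        fix b assume b: "b \<in> K \<inter> \<Phi> c ` disc (d c)"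
        then obtain c' where c': "c' \<in> cs" "d c' < m" "b \<in> c'" by (auto simp: K_def skel_def)
        then have "c' \<in> F" using b by (auto simp: F_def)
        moreover have "b \<in> \<Phi> c' ` disc (d c')" using c' cw_facts(2)[OF c'(1)] by blast
        ultimately show "b \<in> (\<Union>c'\<in>F. (K \<inter> \<Phi> c' ` disc (d c')) \<inter> \<Phi> c ` disc (d c))" using b by blast
      qed
    qed blast
    ultimately have "closedin B (K \<inter> \<Phi> c ` disc (d c))" by simp
    then show ?thesis by (simp add: ndisc_eq closedin_subset_topspace)
  qed
  then have "closedin B K" using cw KB unfolding cw_structure_def by blast
  then have "closedin (subtopology B (skel cs d m)) K"
    by (rule closedin_subset_topspace) (auto simp: K_def)
  then show "closedin (subtopology B (skel cs d m)) {x \<in> topspace (subtopology B (skel cs d m)). g x \<in> C}"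
    unfolding ts K_def .
qed

text \<open>Over an m-cell the lift is prescribed at both ends and on the boundary, a problem on
  disc x [0,1]. Continuity on the product of the skeleton with the interval is checked through the
  adjoint into the path space, so only the weak topology of B itself enters.\<close>

lemma cw_lifting_skeleton:
  assumes fib: "hurewicz_fibration J X p" and q: "continuous_map (cyl B) X q"
    and con: "\<And>z. z \<in> topspace (cyl B) \<Longrightarrow> cube_connected r (fibre J p (q z))"
    and \<sigma>0: "continuous_map B J \<sigma>0" "\<And>b. b \<in> topspace B \<Longrightarrow> p (\<sigma>0 b) = q (b, 0)"
    and \<sigma>1: "continuous_map B J \<sigma>1" "\<And>b. b \<in> topspace B \<Longrightarrow> p (\<sigma>1 b) = q (b, 1)"
    and "m \<le> r"
  shows "\<exists>L. continuous_map (cyl (subtopology B (skel cs d m))) J L \<and>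
     (\<forall>b\<in>skel cs d m. (\<forall>t\<in>{0..1}. p (L (b, t)) = q (b, t)) \<and> L (b, 0) = \<sigma>0 b \<and> L (b, 1) = \<sigma>1 b)"
  using \<open>m \<le> r\<close>
proof (induction m)
  case 0
  \<comment> \<open>\<open>skel cs d 0\<close> is empty because its cells have dimension strictly
    below 0; any function serves.\<close>
  show ?case by (rule exI[of _ undefined]) (simp add: skel_def continuous_map_def)
next
  case (Suc m)
  then obtain L where L: "continuous_map (cyl (subtopology B (skel cs d m))) J L"
     "\<And>b t. b \<in> skel cs d m \<Longrightarrow> t \<in> {0..1} \<Longrightarrow> p (L (b, t)) = q (b, t)"
     "\<And>b. b \<in> skel cs d m \<Longrightarrow> L (b, 0) = \<sigma>0 b" "\<And>b. b \<in> skel cs d m \<Longrightarrow> L (b, 1) = \<sigma>1 b"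
    by auto
  define Q where "Q = (\<lambda>c \<Lambda>. continuous_map (top_of_set (disc m \<times> {0..1})) J \<Lambda> \<and>
      (\<forall>x\<in>disc m. \<forall>t\<in>{0..1}. p (\<Lambda> (x, t)) = q (\<Phi> c x, t)) \<and>
      (\<forall>x\<in>disc m. \<Lambda> (x, 0) = \<sigma>0 (\<Phi> c x) \<and> \<Lambda> (x, 1) = \<sigma>1 (\<Phi> c x)) \<and>
      (\<forall>x\<in>disc m. enorm m x = 1 \<longrightarrow> (\<forall>t\<in>{0..1}. \<Lambda> (x, t) = L (\<Phi> c x, t))))"
  have "\<exists>\<Lambda>. Q c \<Lambda>" if c: "c \<in> cs" "d c = m" for c
  proof -
    note cf = cw_facts[OF c(1), unfolded c(2)]
    have \<Phi>t: "\<Phi> c x \<in> topspace B" if "x \<in> disc m" for x using continuous_map_funspace[OF cf(1)] that by auto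
    define S where "S = {z \<in> disc m \<times> {0..1::real}. enorm m (fst z) = 1 \<or> snd z = 0 \<or> snd z = 1}"
    \<comment> \<open>The three prescriptions agree where they meet, since over the old skeleton L
      already has the values \<sigma>0 and \<sigma>1 at the ends.\<close>
    define \<sigma> where "\<sigma> = (\<lambda>z. if snd z = 0 then \<sigma>0 (\<Phi> c (fst z)) else if snd z = 1 then \<sigma>1 (\<Phi> c (fst z)) else L (\<Phi> c (fst z), snd z))"
    have \<Phi>f: "continuous_map (top_of_set (disc m \<times> T)) B (\<lambda>z. \<Phi> c (fst z))" for T :: "real set"
      by (rule continuous_map_compose'[OF _ cf(1)]) (auto simp: continuous_map_top_of_set intro!: continuous_intros)
    have q': "continuous_map (top_of_set (disc m \<times> {0..1})) X (\<lambda>z. q (\<Phi> c (fst z), snd z))"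
      by (rule continuous_map_compose'[OF _ q])
         (intro continuous_map_pairedI \<Phi>f, auto simp: continuous_map_top_of_set intro!: continuous_intros)
    define S1 where "S1 = {x \<in> disc m. enorm m x = 1} \<times> {0..1::real}"
    have clS: "closed S1" "closed (disc m \<times> {0::real})" "closed (disc m \<times> {1::real})"
    proof -
      have "{x \<in> disc m. enorm m x = 1} = disc m \<inter> (\<lambda>x. enorm m x) -` {1}" by auto
      moreover have "closed (disc m \<inter> (\<lambda>x. enorm m x) -` {1})"
        by (rule continuous_closed_preimage) (auto intro!: continuous_intros compact_imp_closed compact_disc)
      ultimately show "closed S1" by (auto simp: S1_def intro!: closed_Times)
      show "closed (disc m \<times> {0::real})" "closed (disc m \<times> {1::real})"
        by (auto intro!: closed_Times intro: compact_imp_closed[OF compact_disc])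
    qed
    have Sq: "S = S1 \<union> disc m \<times> {0} \<union> disc m \<times> {1}" by (auto simp: S_def S1_def)
    have 1: "continuous_map (top_of_set S1) J \<sigma>"
    proof (rule continuous_map_eq)
      have "continuous_map (top_of_set {x \<in> disc m. enorm m x = 1}) (subtopology B (skel cs d m)) (\<Phi> c)"
        using continuous_map_from_subtopology_mono[OF cf(1), of "{x \<in> disc m. enorm m x = 1}"] cf(4)
        by (auto simp: continuous_map_in_subtopology)
      then have a: "continuous_map (top_of_set S1) (subtopology B (skel cs d m)) (\<lambda>z. \<Phi> c (fst z))"
        by (rule continuous_map_compose'[rotated])
           (auto simp: continuous_map_top_of_set S1_def intro!: continuous_on_fst continuous_on_id)
      have b: "continuous_map (top_of_set S1) (top_of_set {0..1}) snd"
        by (auto simp: continuous_map_top_of_set S1_def intro!: continuous_on_snd continuous_on_id)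
      show "continuous_map (top_of_set S1) J (\<lambda>z. L (\<Phi> c (fst z), snd z))"
        by (rule continuous_map_compose'[OF continuous_map_pairedI[OF a b] L(1)])
      show "L (\<Phi> c (fst z), snd z) = \<sigma> z" if "z \<in> topspace (top_of_set S1)" for z
        using that cf(4) L(3,4) by (auto simp: S1_def \<sigma>_def)
    qed
    have 2: "continuous_map (top_of_set (disc m \<times> {0::real})) J \<sigma>"
      by (rule continuous_map_eq[OF continuous_map_compose'[OF \<Phi>f \<sigma>0(1)]]) (auto simp: \<sigma>_def)
    have 3: "continuous_map (top_of_set (disc m \<times> {1::real})) J \<sigma>"
      by (rule continuous_map_eq[OF continuous_map_compose'[OF \<Phi>f \<sigma>1(1)]]) (auto simp: \<sigma>_def)
    have \<sigma>c: "continuous_map (top_of_set S) J \<sigma>"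
    proof (rule pasting_lemma_closed[where I = "{S1, disc m \<times> {0}, disc m \<times> {1}}" and T = id and f = "\<lambda>_. \<sigma>"])
      fix A assume A: "A \<in> {S1, disc m \<times> {0::real}, disc m \<times> {1}}"
      then have AS: "A \<subseteq> S" by (auto simp: Sq)
      then show "closedin (top_of_set S) (id A)" using A clS by (auto intro!: closed_subset)
      show "continuous_map (subtopology (top_of_set S) (id A)) J \<sigma>"
        using A AS 1 2 3 by (auto simp: subtopology_subtopology Int_absorb1)
    qed (auto simp: Sq)
    have \<sigma>p: "p (\<sigma> z) = q (\<Phi> c (fst z), snd z)" if "z \<in> S" for z
      using that \<sigma>0(2)[OF \<Phi>t] \<sigma>1(2)[OF \<Phi>t] L(2)[OF cf(4)] by (auto simp: S_def \<sigma>_def)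
    have con': "cube_connected r (fibre J p (q (\<Phi> c (fst z), snd z)))" if "z \<in> disc m \<times> {0..1}" for z
      by (rule con) (use that \<Phi>t in auto)
    obtain \<Lambda> where \<Lambda>: "continuous_map (top_of_set (disc m \<times> {0..1})) J \<Lambda>"
      "\<And>z. z \<in> disc m \<times> {0..1} \<Longrightarrow> p (\<Lambda> z) = q (\<Phi> c (fst z), snd z)" "\<And>z. z \<in> S \<Longrightarrow> \<Lambda> z = \<sigma> z"
      using disc_lifting[OF fib con' Suc.prems q' S_def \<sigma>c \<sigma>p] by blast
    have "\<Lambda> (x, t) = L (\<Phi> c x, t)" if "x \<in> disc m" "enorm m x = 1" "t \<in> {0..1}" for x t
      using \<Lambda>(3)[of "(x, t)"] that L(3,4) cf(4)[OF that(1,2)] by (auto simp: S_def \<sigma>_def)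
    then show ?thesis
      using \<Lambda>(1,2) \<Lambda>(3)[of "(_, 0)"] \<Lambda>(3)[of "(_, 1)"] by (intro exI[of _ \<Lambda>]) (auto simp: Q_def S_def \<sigma>_def)
  qed
  then obtain \<Lambda> where "\<And>c. c \<in> cs \<Longrightarrow> d c = m \<Longrightarrow> Q c (\<Lambda> c)" by metis
  then have \<Lambda>: "\<And>c. c \<in> cs \<Longrightarrow> d c = m \<Longrightarrow> continuous_map (top_of_set (disc m \<times> {0..1})) J (\<Lambda> c)"
      "\<And>c x t. c \<in> cs \<Longrightarrow> d c = m \<Longrightarrow> x \<in> disc m \<Longrightarrow> t \<in> {0..1} \<Longrightarrow> p (\<Lambda> c (x, t)) = q (\<Phi> c x, t)"
      "\<And>c x. c \<in> cs \<Longrightarrow> d c = m \<Longrightarrow> x \<in> disc m \<Longrightarrow> \<Lambda> c (x, 0) = \<sigma>0 (\<Phi> c x)"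
      "\<And>c x. c \<in> cs \<Longrightarrow> d c = m \<Longrightarrow> x \<in> disc m \<Longrightarrow> \<Lambda> c (x, 1) = \<sigma>1 (\<Phi> c x)"
      "\<And>c x t. c \<in> cs \<Longrightarrow> d c = m \<Longrightarrow> x \<in> disc m \<Longrightarrow> enorm m x = 1 \<Longrightarrow> t \<in> {0..1} \<Longrightarrow> \<Lambda> c (x, t) = L (\<Phi> c x, t)"
    unfolding Q_def by blast+
  \<comment> \<open>A new point lies in exactly one open m-cell, \<open>cl b\<close>, and has
    exactly one preimage in the open disc, \<open>\<iota> (cl b) b\<close>.\<close>
  define cl where "cl = (\<lambda>b. THE c. c \<in> cs \<and> b \<in> c)"
  define \<iota> where "\<iota> = (\<lambda>c. inv_into {x \<in> disc m. enorm m x < 1} (\<Phi> c))"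
  define L' where "L' = (\<lambda>(b, t). if b \<in> skel cs d m then L (b, t) else \<Lambda> (cl b) (\<iota> (cl b) b, t))"
  have clb: "cl b = c" if "c \<in> cs" "b \<in> c" for b c
    unfolding cl_def using that cw_cells_disjoint by (intro the_equality) blast+
  have L'old: "L' (\<Phi> c x, t) = L (\<Phi> c x, t)" if "c \<in> cs" "d c < m" "x \<in> disc (d c)" for c x t
    using cell_closure_skel[OF that] by (simp add: L'_def)
  have L'new: "L' (\<Phi> c x, t) = \<Lambda> c (x, t)" if c: "c \<in> cs" "d c = m" "x \<in> disc m" "t \<in> {0..1}" for c x t
  proof (cases "enorm m x < 1")
    case True
    note cf = cw_facts[OF c(1), unfolded c(2)]
    have xc: "\<Phi> c x \<in> c" using cf(2) c(3) True by blast
    then have "\<Phi> c x \<notin> skel cs d m" using cw_cells_disjoint[OF c(1) _ xc] c(2) by (auto simp: skel_def)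
    moreover have "\<iota> c (\<Phi> c x) = x" unfolding \<iota>_def by (rule inv_into_f_f[OF cf(3)]) (use c True in auto)
    ultimately show ?thesis using clb[OF c(1) xc] by (simp add: L'_def)
  next
    case False
    then have 1: "enorm m x = 1" using c(3) by (simp add: disc_def)
    then have "\<Phi> c x \<in> skel cs d m" using cw_facts(4)[OF c(1)] c by simp
    then show ?thesis using \<Lambda>(5)[OF c(1,2,3) 1 c(4)] by (simp add: L'_def)
  qed
  define g where "g = (\<lambda>b. restrict (\<lambda>t. L' (b, t)) {0..1})"
  have gc: "continuous_map (subtopology B (skel cs d (Suc m))) (path_space J) g"
  proof (rule continuous_map_skeleton)
    fix c assume c: "c \<in> cs" "d c < Suc m"
    show "continuous_map (top_of_set (disc (d c))) (path_space J) (\<lambda>x. g (\<Phi> c x))"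
    proof (cases "d c = m")
      case True
      have "continuous_map (cyl (top_of_set (disc m))) J (\<Lambda> c)" using \<Lambda>(1)[OF c(1) True] by simp
      from path_space_curry[OF this]
      show ?thesis unfolding True
        by (rule continuous_map_eq) (auto simp: g_def L'new[OF c(1) True] intro!: restrict_ext)
    next
      case False
      then have dm: "d c < m" using c by simp
      have "continuous_map (top_of_set (disc (d c))) (subtopology B (skel cs d m)) (\<Phi> c)"
        using cw_facts(1)[OF c(1)] cell_closure_skel[OF c(1) dm] by (auto simp: continuous_map_in_subtopology)
      then have "continuous_map (cyl (top_of_set (disc (d c)))) J (\<lambda>z. L (\<Phi> c (fst z), snd z))"
        by (intro continuous_map_compose'[OF _ L(1)] continuous_map_pairedI continuous_map_snd
            continuous_map_compose'[OF continuous_map_fst])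
      from path_space_curry[OF this]
      show ?thesis
        by (rule continuous_map_eq) (auto simp: g_def L'old[OF c(1) dm] intro!: restrict_ext)
    qed
  qed
  have "continuous_map (cyl (subtopology B (skel cs d (Suc m)))) J (\<lambda>z. g (fst z) (snd z))"
    by (rule path_space_eval_compose[OF continuous_map_compose'[OF continuous_map_fst gc] continuous_map_snd])
  then have "continuous_map (cyl (subtopology B (skel cs d (Suc m)))) J L'"
    by (rule continuous_map_eq) (auto simp: g_def)
  moreover have "(\<forall>t\<in>{0..1}. p (L' (b, t)) = q (b, t)) \<and> L' (b, 0) = \<sigma>0 b \<and> L' (b, 1) = \<sigma>1 b"
    if b: "b \<in> skel cs d (Suc m)" for b
  proof (cases "b \<in> skel cs d m")
    case True
    then show ?thesis using L by (simp add: L'_def)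
  next
    case False
    then obtain c where c: "c \<in> cs" "d c = m" "b \<in> c" using b by (auto simp: skel_def less_Suc_eq)
    then obtain x where x: "x \<in> disc m" "b = \<Phi> c x" using cw_facts(2)[OF c(1)] by blast
    show ?thesis unfolding x(2)
      using L'new[OF c(1,2) x(1)] \<Lambda>(2,3,4)[OF c(1,2) x(1)] by auto
  qed
  ultimately show ?case by blast
qed

text \<open>When all cells have dimension below r, \<open>skel cs d r\<close> is all of B, and the
  product of a cell with the interval has dimension at most r, the largest that the fibres can
  fill.\<close>

lemma cw_lifting:
  assumes fib: "hurewicz_fibration J X p" and q: "continuous_map (cyl B) X q"
    and con: "\<And>z. z \<in> topspace (cyl B) \<Longrightarrow> cube_connected r (fibre J p (q z))"
    and \<sigma>0: "continuous_map B J \<sigma>0" "\<And>b. b \<in> topspace B \<Longrightarrow> p (\<sigma>0 b) = q (b, 0)"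
    and \<sigma>1: "continuous_map B J \<sigma>1" "\<And>b. b \<in> topspace B \<Longrightarrow> p (\<sigma>1 b) = q (b, 1)"
    and dim: "\<And>c. c \<in> cs \<Longrightarrow> d c < r"
  obtains L where "continuous_map (cyl B) J L" "\<And>b t. b \<in> topspace B \<Longrightarrow> t \<in> {0..1} \<Longrightarrow> p (L (b, t)) = q (b, t)"
    "\<And>b. b \<in> topspace B \<Longrightarrow> L (b, 0) = \<sigma>0 b" "\<And>b. b \<in> topspace B \<Longrightarrow> L (b, 1) = \<sigma>1 b"
proof -
  have "skel cs d r = topspace B" using cw dim unfolding cw_structure_def skel_def by blast
  then show thesis
    using cw_lifting_skeleton[OF fib q con \<sigma>0 \<sigma>1 order_refl] that by auto
qed

end

section \<open>Sections that are closed cofibrations\<close>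

text \<open>The quotient topology written out: (a, 0) is represented by \<open>Inl (i a)\<close>, so
  \<open>Inr\<close> carries only positive times. The type is that of the test spaces in
  \<open>closed_cofibration\<close>.\<close>

definition mapping_cylinder :: "'a topology \<Rightarrow> 'x topology \<Rightarrow> ('a \<Rightarrow> 'x) \<Rightarrow> ('x + 'a \<times> real) topology" where
  "mapping_cylinder A X i = topology (\<lambda>U. U \<subseteq> Inl ` topspace X \<union> Inr ` (topspace A \<times> {0<..1}) \<and>
     openin X {x \<in> topspace X. Inl x \<in> U} \<and>
     openin (cyl A) {z \<in> topspace (cyl A). (if snd z = 0 then Inl (i (fst z)) else Inr z) \<in> U})"

lemma openin_mapping_cylinder:
  "openin (mapping_cylinder A X i) U \<longleftrightarrow> U \<subseteq> Inl ` topspace X \<union> Inr ` (topspace A \<times> {0<..1}) \<and>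
     openin X {x \<in> topspace X. Inl x \<in> U} \<and>
     openin (cyl A) {z \<in> topspace (cyl A). (if snd z = 0 then Inl (i (fst z)) else Inr z) \<in> U}"
proof -
  define j where "j = (\<lambda>z. if snd z = (0::real) then Inl (i (fst z)) else Inr z)"
  let ?P = "\<lambda>U. U \<subseteq> Inl ` topspace X \<union> Inr ` (topspace A \<times> {0<..1}) \<and> openin X {x \<in> topspace X. Inl x \<in> U} \<and>
     openin (cyl A) {z \<in> topspace (cyl A). j z \<in> U}"
  have "istopology ?P"
    unfolding istopology_def
  proof (intro conjI allI impI)
    fix S T assume S: "?P S" and T: "?P T"
    have "{x \<in> topspace X. Inl x \<in> S \<inter> T} = {x \<in> topspace X. Inl x \<in> S} \<inter> {x \<in> topspace X. Inl x \<in> T}"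
      "{z \<in> topspace (cyl A). j z \<in> S \<inter> T} = {z \<in> topspace (cyl A). j z \<in> S} \<inter> {z \<in> topspace (cyl A). j z \<in> T}"
      by auto
    then show "S \<inter> T \<subseteq> Inl ` topspace X \<union> Inr ` (topspace A \<times> {0<..1})"
      "openin X {x \<in> topspace X. Inl x \<in> S \<inter> T}" "openin (cyl A) {z \<in> topspace (cyl A). j z \<in> S \<inter> T}"
      using S T by (auto simp only: openin_Int)
  next
    fix K assume K: "\<forall>S\<in>K. ?P S"
    have "{x \<in> topspace X. Inl x \<in> \<Union>K} = (\<Union>S\<in>K. {x \<in> topspace X. Inl x \<in> S})"
      "{z \<in> topspace (cyl A). j z \<in> \<Union>K} = (\<Union>S\<in>K. {z \<in> topspace (cyl A). j z \<in> S})"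
      by auto
    moreover have "openin X (\<Union>S\<in>K. {x \<in> topspace X. Inl x \<in> S})"
      "openin (cyl A) (\<Union>S\<in>K. {z \<in> topspace (cyl A). j z \<in> S})"
      using K by (blast intro: openin_Union)+
    ultimately show "openin X {x \<in> topspace X. Inl x \<in> \<Union>K}" "openin (cyl A) {z \<in> topspace (cyl A). j z \<in> \<Union>K}"
      by simp_all
    show "\<Union>K \<subseteq> Inl ` topspace X \<union> Inr ` (topspace A \<times> {0<..1})" using K by blast
  qed
  then show ?thesis unfolding mapping_cylinder_def j_def by (simp add: topology_inverse')
qed

lemma topspace_mapping_cylinder:
  assumes "i \<in> topspace A \<rightarrow> topspace X"
  shows "topspace (mapping_cylinder A X i) = Inl ` topspace X \<union> Inr ` (topspace A \<times> {0<..1})"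
proof
  show "topspace (mapping_cylinder A X i) \<subseteq> Inl ` topspace X \<union> Inr ` (topspace A \<times> {0<..1})"
    using openin_topspace[of "mapping_cylinder A X i"] unfolding openin_mapping_cylinder by blast
  have e1: "{x \<in> topspace X. Inl x \<in> Inl ` topspace X \<union> Inr ` (topspace A \<times> {0<..1})} = topspace X" for A :: "'a topology"
    by auto
  have e2: "{z \<in> topspace (cyl A). (if snd z = 0 then Inl (i (fst z)) else Inr z)
      \<in> Inl ` topspace X \<union> Inr ` (topspace A \<times> {0<..1})} = topspace (cyl A)"
    using assms by auto
  have "openin (mapping_cylinder A X i) (Inl ` topspace X \<union> Inr ` (topspace A \<times> {0<..1}))"
    unfolding openin_mapping_cylinder e1 e2 by (intro conjI subset_refl openin_topspace)
  then show "Inl ` topspace X \<union> Inr ` (topspace A \<times> {0<..1}) \<subseteq> topspace (mapping_cylinder A X i)"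
    by (rule openin_subset)
qed

text \<open>Homotopy extension into the mapping cylinder is the universal case. It gives a map from
  X x [0,1] to the cylinder, and the canonical map k back to X x [0,1] turns it into the
  retraction.\<close>

lemma cofibration_retraction:
  assumes cof: "closed_cofibration A X i"
  obtains \<rho> where "continuous_map (cyl X) (cyl X) \<rho>"
    "\<And>z. z \<in> topspace (cyl X) \<Longrightarrow> \<rho> z \<in> topspace X \<times> {0} \<union> i ` topspace A \<times> {0..1}"
    "\<And>z. z \<in> topspace X \<times> {0} \<union> i ` topspace A \<times> {0..1} \<Longrightarrow> \<rho> z = z"
proof -
  let ?M = "mapping_cylinder A X i"
  define j where "j = (\<lambda>z. if snd z = (0::real) then Inl (i (fst z)) else Inr z)"
  have i: "continuous_map A X i" using cof by (simp add: closed_cofibration_def)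
  have it: "i \<in> topspace A \<rightarrow> topspace X" by (rule continuous_map_funspace[OF i])
  note tM = topspace_mapping_cylinder[OF it]
  have 1: "continuous_map X ?M Inl"
    unfolding continuous_map_def by (auto simp: tM openin_mapping_cylinder)
  have 2: "continuous_map (cyl A) ?M j"
    unfolding continuous_map_def
  proof (intro conjI allI impI)
    show "j \<in> topspace (cyl A) \<rightarrow> topspace ?M" using it by (auto simp: tM j_def Pi_iff)
    show "openin (cyl A) {z \<in> topspace (cyl A). j z \<in> U}" if "openin ?M U" for U
      using that unfolding openin_mapping_cylinder j_def by blast
  qed
  have 3: "\<forall>a\<in>topspace A. j (a, 0) = Inl (i a)" by (simp add: j_def)
  have "HEP_wrt ?M A X i" using cof unfolding closed_cofibration_def by blast
  from this[unfolded HEP_wrt_def, THEN spec, THEN spec, THEN mp, OF conjI[OF 1 conjI[OF 2 3]]]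
  obtain G where G: "continuous_map (cyl X) ?M G" "\<And>x. x \<in> topspace X \<Longrightarrow> G (x, 0) = Inl x"
     "\<And>a t. a \<in> topspace A \<Longrightarrow> t \<in> {0..1} \<Longrightarrow> G (i a, t) = j (a, t)"
    by blast
  define k where "k = (\<lambda>w. case w of Inl x \<Rightarrow> (x, 0) | Inr z \<Rightarrow> (i (fst z), snd z::real))"
  have kj: "k (j z) = (i (fst z), snd z)" for z by (simp add: k_def j_def)
  have kc: "continuous_map ?M (cyl X) k"
    unfolding continuous_map_def
  proof (intro conjI allI impI)
    show kt: "k \<in> topspace ?M \<rightarrow> topspace (cyl X)" using it by (auto simp: tM k_def)
    fix U assume U: "openin (cyl X) U"
    have c1: "continuous_map X (cyl X) (\<lambda>x. (x, 0))" by (intro continuous_map_pairedI) auto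
    have c2: "continuous_map (cyl A) (cyl X) (\<lambda>z. (i (fst z), snd z))"
      by (intro continuous_map_pairedI continuous_map_snd continuous_map_compose'[OF continuous_map_fst i])
    have "{x \<in> topspace X. Inl x \<in> {w \<in> topspace ?M. k w \<in> U}} = {x \<in> topspace X. (x, 0) \<in> U}"
      by (auto simp: tM k_def)
    moreover have "{z \<in> topspace (cyl A). j z \<in> {w \<in> topspace ?M. k w \<in> U}}
        = {z \<in> topspace (cyl A). (i (fst z), snd z) \<in> U}"
      using continuous_map_funspace[OF 2] by (auto simp: kj)
    ultimately have "openin X {x \<in> topspace X. Inl x \<in> {w \<in> topspace ?M. k w \<in> U}}"
      "openin (cyl A) {z \<in> topspace (cyl A). j z \<in> {w \<in> topspace ?M. k w \<in> U}}"
      using openin_continuous_map_preimage[OF c1 U] openin_continuous_map_preimage[OF c2 U] by simp_all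
    then show "openin ?M {w \<in> topspace ?M. k w \<in> U}"
      unfolding openin_mapping_cylinder j_def[symmetric] using tM by (auto simp: j_def)
  qed
  show thesis
  proof
    show "continuous_map (cyl X) (cyl X) (\<lambda>z. k (G z))" by (rule continuous_map_compose'[OF G(1) kc])
    show "k (G z) \<in> topspace X \<times> {0} \<union> i ` topspace A \<times> {0..1}" if "z \<in> topspace (cyl X)" for z
    proof -
      have "G z \<in> topspace ?M" using continuous_map_funspace[OF G(1)] that by blast
      then show ?thesis by (auto simp: tM k_def)
    qed
    show "k (G z) = z" if "z \<in> topspace X \<times> {0} \<union> i ` topspace A \<times> {0..1}" for z
      using that G(2,3) kj by (auto simp: k_def)
  qed
qed

text \<open>The function u(x) is the largest difference, over all t, between t and the height of
  \<rho>(x, t). If it vanishes, then \<rho>(x, t) has height t and so lies over A for every t > 0;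
  letting t tend to 0 puts x in A, which is closed.\<close>

lemma closed_cofibration_cofibred_pair:
  assumes cof: "closed_cofibration A X i"
  shows "cofibred_pair X (i ` topspace A)"
proof -
  let ?A = "i ` topspace A"
  obtain \<rho> where \<rho>: "continuous_map (cyl X) (cyl X) \<rho>"
    "\<And>z. z \<in> topspace (cyl X) \<Longrightarrow> \<rho> z \<in> topspace X \<times> {0} \<union> ?A \<times> {0..1}"
    "\<And>z. z \<in> topspace X \<times> {0} \<union> ?A \<times> {0..1} \<Longrightarrow> \<rho> z = z"
    using cofibration_retraction[OF cof] by blast
  have clA: "closedin X ?A" using cof by (simp add: closed_cofibration_def)
  define \<delta> where "\<delta> = (\<lambda>z. \<bar>snd z - snd (\<rho> z)\<bar>)"
  have \<delta>c: "continuous_map (cyl X) euclideanreal \<delta>"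
    unfolding \<delta>_def
    by (intro continuous_intros unit_interval_realD[OF continuous_map_snd]
        unit_interval_realD[OF continuous_map_compose'[OF \<rho>(1) continuous_map_snd]])
  have \<delta>01: "\<delta> z \<in> {0..1}" if "z \<in> topspace (cyl X)" for z
    using \<rho>(2)[OF that] that by (auto simp: \<delta>_def abs_le_iff)
  define u where "u = (\<lambda>x. SUP t\<in>{0..1}. \<delta> (x, t))"
  have att: "\<exists>t\<in>{0..1}. u x = \<delta> (x, t)" and ub: "\<And>t. t \<in> {0..1} \<Longrightarrow> \<delta> (x, t) \<le> u x" if x: "x \<in> topspace X" for x
  proof -
    have "continuous_map (top_of_set {0..1}) euclideanreal (\<lambda>t. \<delta> (x, t))"
      by (rule continuous_map_compose'[OF _ \<delta>c]) (intro continuous_map_pairedI, use x in auto)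
    then have "continuous_on {0..1} (\<lambda>t. \<delta> (x, t))" by simp
    then obtain t where t: "t \<in> {0..1}" "\<And>s. s \<in> {0..1} \<Longrightarrow> \<delta> (x, s) \<le> \<delta> (x, t)"
      using continuous_attains_sup[of "{0..1::real}" "\<lambda>t. \<delta> (x, t)"] by force
    have "u x = \<delta> (x, t)" unfolding u_def
      by (rule cSup_eq_maximum) (use t in auto)
    then show "\<exists>t\<in>{0..1}. u x = \<delta> (x, t)" "\<And>t. t \<in> {0..1} \<Longrightarrow> \<delta> (x, t) \<le> u x" using t by auto
  qed
  have u01: "u x \<in> {0..1}" if "x \<in> topspace X" for x using att[OF that] \<delta>01 that by force
  \<comment> \<open>Superlevel sets are closed as projections along the compact interval, sublevel
    sets as intersections of closed sets.\<close>
  have "continuous_map X euclideanreal u"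
    unfolding continuous_map_upper_lower_semicontinuous_le
  proof (intro conjI allI)
    fix a
    have "closedin (cyl X) {z \<in> topspace (cyl X). \<delta> z \<in> {a..}}"
      by (rule closedin_continuous_map_preimage[OF \<delta>c]) simp
    then have "closedin X (fst ` {z \<in> topspace (cyl X). \<delta> z \<in> {a..}})"
      using closed_map_fst[OF compact_space_unit_interval, of X] by (simp add: closed_map_def)
    moreover have "fst ` {z \<in> topspace (cyl X). \<delta> z \<in> {a..}} = {x \<in> topspace X. a \<le> u x}"
    proof
      show "fst ` {z \<in> topspace (cyl X). \<delta> z \<in> {a..}} \<subseteq> {x \<in> topspace X. a \<le> u x}"
        using ub by (auto intro: order_trans)
      show "{x \<in> topspace X. a \<le> u x} \<subseteq> fst ` {z \<in> topspace (cyl X). \<delta> z \<in> {a..}}"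
      proof
        fix x assume x: "x \<in> {x \<in> topspace X. a \<le> u x}"
        then obtain t where "t \<in> {0..1}" "u x = \<delta> (x, t)" using att by blast
        then show "x \<in> fst ` {z \<in> topspace (cyl X). \<delta> z \<in> {a..}}"
          using x by (intro image_eqI[of _ _ "(x, t)"]) auto
      qed
    qed
    ultimately show "closedin X {x \<in> topspace X. a \<le> u x}" by simp
    have "closedin X {x \<in> topspace X. \<delta> (x, t) \<in> {..a}}" if "t \<in> {0..1}" for t
      by (rule closedin_continuous_map_preimage[OF continuous_map_slice[OF \<delta>c]]) (use that in auto)
    then have "closedin X (\<Inter>t\<in>{0..1}. {x \<in> topspace X. \<delta> (x, t) \<in> {..a}})"
      by (intro closedin_INT) auto
    moreover have "(\<Inter>t\<in>{0..1}. {x \<in> topspace X. \<delta> (x, t) \<in> {..a}}) = {x \<in> topspace X. u x \<le> a}"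
    proof
      show "(\<Inter>t\<in>{0..1}. {x \<in> topspace X. \<delta> (x, t) \<in> {..a}}) \<subseteq> {x \<in> topspace X. u x \<le> a}"
      proof
        fix x assume x: "x \<in> (\<Inter>t\<in>{0..1}. {x \<in> topspace X. \<delta> (x, t) \<in> {..a}})"
        then have "x \<in> topspace X" by force
        then show "x \<in> {x \<in> topspace X. u x \<le> a}" using x att by fastforce
      qed
      show "{x \<in> topspace X. u x \<le> a} \<subseteq> (\<Inter>t\<in>{0..1}. {x \<in> topspace X. \<delta> (x, t) \<in> {..a}})"
      proof
        fix x assume x: "x \<in> {x \<in> topspace X. u x \<le> a}"
        then have "\<delta> (x, t) \<le> a" if "t \<in> {0..1}" for t using ub[of x t] that by auto
        then show "x \<in> (\<Inter>t\<in>{0..1}. {x \<in> topspace X. \<delta> (x, t) \<in> {..a}})" using x by auto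
      qed
    qed
    ultimately show "closedin X {x \<in> topspace X. u x \<le> a}" by simp
  qed
  then have uc: "continuous_map X (top_of_set {0..1}) u" using u01 by (auto simp: unit_interval_real)
  have "?A = {x \<in> topspace X. u x = 0}"
  proof (intro equalityI subsetI)
    fix x assume x: "x \<in> ?A"
    then have xX: "x \<in> topspace X" using closedin_subset[OF clA] by blast
    obtain t where t: "t \<in> {0..1}" "u x = \<delta> (x, t)" using att[OF xX] by blast
    then have "\<rho> (x, t) = (x, t)" using x by (intro \<rho>(3)) auto
    then show "x \<in> {x \<in> topspace X. u x = 0}" using xX t by (simp add: \<delta>_def)
  next
    fix x assume "x \<in> {x \<in> topspace X. u x = 0}"
    then have x: "x \<in> topspace X" "u x = 0" by auto
    have fA: "fst (\<rho> (x, t)) \<in> ?A" if "t \<in> {0<..1}" for t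
    proof -
      have "\<delta> (x, t) = 0" using ub[OF x(1), of t] \<delta>01[of "(x, t)"] x that by auto
      then have "snd (\<rho> (x, t)) = t" by (simp add: \<delta>_def)
      then show ?thesis using \<rho>(2)[of "(x, t)"] x that by (cases "\<rho> (x, t)") auto
    qed
    have c: "continuous_map (top_of_set {0..1}) X (\<lambda>t. fst (\<rho> (x, t)))"
      by (rule continuous_map_compose'[OF continuous_map_compose'[OF _ \<rho>(1)] continuous_map_fst])
         (intro continuous_map_pairedI, use x in auto)
    have "closedin (top_of_set {0..1}) {t \<in> {0..1}. fst (\<rho> (x, t)) \<in> ?A}"
      using closedin_continuous_map_preimage[OF c clA] by simp
    then have "closed {t \<in> {0..1}. fst (\<rho> (x, t)) \<in> ?A}" using closedin_closed_trans by blast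
    moreover have "{0<..<1} \<subseteq> {t \<in> {0..1}. fst (\<rho> (x, t)) \<in> ?A}" using fA by auto
    ultimately have "closure {0<..<1} \<subseteq> {t \<in> {0..1}. fst (\<rho> (x, t)) \<in> ?A}" by (rule closure_minimal[rotated])
    moreover have "(0::real) \<in> closure {0<..<1}" by simp
    ultimately have "0 \<in> {t \<in> {0..1}. fst (\<rho> (x, t)) \<in> ?A}" by (rule subsetD)
    then have "fst (\<rho> (x, 0)) \<in> ?A" by simp
    then show "x \<in> ?A" using \<rho>(3)[of "(x, 0)"] x by auto
  qed
  then show ?thesis unfolding cofibred_pair_def using uc \<rho> by blast
qed

section \<open>The comparison theorem\<close>

lemma Inf_enat_attained:
  assumes "Inf (enat ` S) = enat n"
  shows "n \<in> S"
proof -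
  have "enat ` S \<noteq> {}" using assms by (auto simp: Inf_enat_def)
  then have "Inf (enat ` S) \<in> enat ` S"
    unfolding Inf_enat_def by (auto intro: LeastI)
  then show ?thesis using assms by auto
qed

lemma secat_le_pointed: "secat_B E X pE pX f \<le> secat_B_pointed B E X pE sE pX sX f"
  unfolding secat_B_def secat_B_pointed_def
proof (intro Inf_superset_mono image_mono Collect_mono impI)
  fix n
  assume "\<exists>U. (\<forall>i\<le>n. openin X (U i) \<and> sX ` topspace B \<subseteq> U i) \<and> topspace X \<subseteq> (\<Union>i\<le>n. U i) \<and>
      (\<forall>i\<le>n. \<exists>s. continuous_map (subtopology X (U i)) E s \<and> (\<forall>x\<in>U i. pE (s x) = pX x) \<and>
        (\<forall>b\<in>topspace B. s (sX b) = sE b) \<and>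
        homotopic_with (\<lambda>h. (\<forall>x\<in>U i. pX (h x) = pX x) \<and> (\<forall>b\<in>topspace B. h (sX b) = sX b))
          (subtopology X (U i)) X (f \<circ> s) id)"
  then obtain U where U: "\<forall>i\<le>n. openin X (U i)" "topspace X \<subseteq> (\<Union>i\<le>n. U i)"
    and s: "\<And>i. i \<le> n \<Longrightarrow> \<exists>s. continuous_map (subtopology X (U i)) E s \<and> (\<forall>x\<in>U i. pE (s x) = pX x) \<and>
        homotopic_with (\<lambda>h. (\<forall>x\<in>U i. pX (h x) = pX x) \<and> (\<forall>b\<in>topspace B. h (sX b) = sX b))
          (subtopology X (U i)) X (f \<circ> s) id"
    by meson
  have "\<exists>s. continuous_map (subtopology X (U i)) E s \<and> (\<forall>x\<in>U i. pE (s x) = pX x) \<and>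
        homotopic_with (\<lambda>h. \<forall>x\<in>U i. pX (h x) = pX x) (subtopology X (U i)) X (f \<circ> s) id"
    if "i \<le> n" for i
  proof -
    obtain s where s: "continuous_map (subtopology X (U i)) E s" "\<forall>x\<in>U i. pE (s x) = pX x"
      "homotopic_with (\<lambda>h. (\<forall>x\<in>U i. pX (h x) = pX x) \<and> (\<forall>b\<in>topspace B. h (sX b) = sX b))
          (subtopology X (U i)) X (f \<circ> s) id"
      using s[OF \<open>i \<le> n\<close>] by blast
    have "homotopic_with (\<lambda>h. \<forall>x\<in>U i. pX (h x) = pX x) (subtopology X (U i)) X (f \<circ> s) id"
      by (rule homotopic_with_mono[OF s(3)]) blast
    then show ?thesis using s(1,2) by blast
  qed
  then show "\<exists>U. (\<forall>i\<le>n. openin X (U i)) \<and> topspace X \<subseteq> (\<Union>i\<le>n. U i) \<and>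
      (\<forall>i\<le>n. \<exists>s. continuous_map (subtopology X (U i)) E s \<and> (\<forall>x\<in>U i. pE (s x) = pX x) \<and>
        homotopic_with (\<lambda>h. \<forall>x\<in>U i. pX (h x) = pX x) (subtopology X (U i)) X (f \<circ> s) id)"
    using U by (intro exI[of _ U] conjI) simp_all
qed

theorem theorem4p4:
  fixes B :: "'b topology" and E :: "'e topology" and X :: "'x topology"
    and pE :: "'e \<Rightarrow> 'b" and sE :: "'b \<Rightarrow> 'e"
    and pX :: "'x \<Rightarrow> 'b" and sX :: "'b \<Rightarrow> 'x"
    and f :: "'e \<Rightarrow> 'x" and k :: nat
  assumes "pointed_fibrant_cofibrant E B pE sE"
    and "pointed_fibrant_cofibrant X B pX sX"
    and "fibrewise_pointed_map E X B pE sE pX sX f"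
    and "CW_complex B"
    and "paracompact_space X" and "Hausdorff_space X"
    and "k_equivalence k E X f"
    and "cw_dim B < (secat_B E X pE pX f + 1) * (enat k + 1) - 1"
  shows "secat_B E X pE pX f = secat_B_pointed B E X pE sE pX sX f"
proof (cases "secat_B E X pE pX f")
  case infinity
  then show ?thesis using secat_le_pointed[of E X pE pX f B sE sX] by simp
next
  case (enat n)
  have fE: "hurewicz_fibration E B pE" and fX: "hurewicz_fibration X B pX"
    and sE: "continuous_map B E sE" "\<And>b. b \<in> topspace B \<Longrightarrow> pE (sE b) = b"
    and sX: "continuous_map B X sX" "\<And>b. b \<in> topspace B \<Longrightarrow> pX (sX b) = b"
    and cof: "closed_cofibration B X sX"
    using assms(1,2) by (auto simp: pointed_fibrant_cofibrant_def fibrewise_pointed_space_def)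
  have f: "continuous_map E X f" "\<And>e. e \<in> topspace E \<Longrightarrow> pX (f e) = pE e"
    and fs: "\<And>b. b \<in> topspace B \<Longrightarrow> f (sE b) = sX b"
    using assms(3) by (auto simp: fibrewise_pointed_map_def)
  have pXc: "continuous_map X B pX" using fX by (simp add: hurewicz_fibration_def)
  have sEt: "sE b \<in> topspace E" and sXt: "sX b \<in> topspace X" if "b \<in> topspace B" for b
    using continuous_map_funspace[OF sE(1)] continuous_map_funspace[OF sX(1)] that by auto
  let ?P = "mapping_paths E X pE pX f"
  let ?\<pi> = "\<lambda>z::'e \<times> (real \<Rightarrow> 'x). snd z 1"
  let ?J = "join_space ?P ?\<pi> (Suc n)"
  have fibP: "hurewicz_fibration ?P X ?\<pi>" by (rule mapping_paths_fibration[OF fE fX f])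
  have fibJ: "hurewicz_fibration ?J X (join_proj ?\<pi>)" by (rule join_fibration[OF fibP])
  have "n \<in> {n. \<exists>U :: nat \<Rightarrow> 'x set.
      (\<forall>i\<le>n. openin X (U i)) \<and> topspace X \<subseteq> (\<Union>i\<le>n. U i) \<and>
      (\<forall>i\<le>n. \<exists>s. continuous_map (subtopology X (U i)) E s \<and> (\<forall>x\<in>U i. pE (s x) = pX x) \<and>
                  homotopic_with (\<lambda>h. \<forall>x\<in>U i. pX (h x) = pX x) (subtopology X (U i)) X (f \<circ> s) id)}"
    by (rule Inf_enat_attained) (use enat in \<open>simp add: secat_B_def\<close>)
  then obtain U where U: "\<And>i. i \<le> n \<Longrightarrow> openin X (U i)" "topspace X \<subseteq> (\<Union>i\<le>n. U i)"
    "\<forall>i\<le>n. \<exists>s. continuous_map (subtopology X (U i)) E s \<and> (\<forall>x\<in>U i. pE (s x) = pX x) \<and>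
                  homotopic_with (\<lambda>h. \<forall>x\<in>U i. pX (h x) = pX x) (subtopology X (U i)) X (f \<circ> s) id"
    by blast
  have Us: "U i \<subseteq> topspace X" if "i \<le> n" for i using openin_subset[OF U(1)[OF that]] .
  \<comment> \<open>A local section up to fibrewise homotopy becomes a strict local section of the
    end point map: the homotopy from f \<circ> s to the inclusion supplies the paths.\<close>
  have "\<exists>g. continuous_map (subtopology X (U i)) ?P g \<and> (\<forall>x\<in>U i. ?\<pi> (g x) = x)" if i: "i \<le> n" for i
  proof -
    obtain s where s: "continuous_map (subtopology X (U i)) E s" "\<forall>x\<in>U i. pE (s x) = pX x"
      "homotopic_with (\<lambda>h. \<forall>x\<in>U i. pX (h x) = pX x) (subtopology X (U i)) X (f \<circ> s) id"
      using U(3) i by blast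
    obtain h where h: "continuous_map (prod_topology (top_of_set {0..1::real}) (subtopology X (U i))) X h"
      "\<And>x. h (0, x) = f (s x)" "\<And>x. h (1, x) = x" "\<And>t x. t \<in> {0..1} \<Longrightarrow> x \<in> U i \<Longrightarrow> pX (h (t, x)) = pX x"
      using s(3) unfolding homotopic_with_def by auto
    have "continuous_map (cyl (subtopology X (U i))) X (\<lambda>z. h (snd z, fst z))"
      by (rule continuous_map_compose'[OF _ h(1)]) (intro continuous_map_pairedI continuous_map_fst continuous_map_snd)
    from continuous_map_mapping_paths[OF s(1) this, of f pX pE]
    have "continuous_map (subtopology X (U i)) ?P (\<lambda>x. (s x, restrict (\<lambda>t. h (t, x)) {0..1}))"
      using h(2,4) s(2) by auto
    then show ?thesis using h(3) by (intro exI[of _ "\<lambda>x. (s x, restrict (\<lambda>t. h (t, x)) {0..1})"]) auto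
  qed
  then obtain g where g: "\<And>i. i \<le> n \<Longrightarrow> continuous_map (subtopology X (U i)) ?P (g i)"
     "\<And>i x. i \<le> n \<Longrightarrow> x \<in> U i \<Longrightarrow> ?\<pi> (g i x) = x"
    by metis
  define \<sigma> where "\<sigma> = (\<lambda>x i. if i \<le> n \<and> x \<in> U i then Some (g i x) else None)"
  have gt: "g i x \<in> topspace ?P" if "i \<le> n" "x \<in> U i" for i x
    using continuous_map_funspace[OF g(1)[OF that(1)]] Us[OF that(1)] that(2) by auto
  have \<sigma>car: "\<sigma> x \<in> join_carrier ?P ?\<pi> (Suc n)" if x: "x \<in> topspace X" for x
  proof -
    obtain i where i: "i \<le> n" "x \<in> U i" using U(2) x by auto
    have "i \<le> n \<and> x \<in> U i \<and> p = g i x" if "\<sigma> x i = Some p" for i p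
      using that by (simp add: \<sigma>_def split: if_splits)
    then have "p \<in> topspace ?P \<and> ?\<pi> p = x" if "\<sigma> x i = Some p" for i p
      using that gt g(2) by blast
    then show ?thesis by (intro join_carrierI[of _ _ i]) (use i in \<open>auto simp: \<sigma>_def\<close>)
  qed
  have \<sigma>c: "continuous_map X ?J \<sigma>"
    unfolding continuous_map_join_iff
  proof (intro conjI ballI allI \<sigma>car)
    fix i
    show "partial_map X ?P (\<lambda>x. \<sigma> x i)"
    proof (cases "i \<le> n")
      case True
      show ?thesis by (rule partial_mapI[OF U(1)[OF True] g(1)[OF True]]) (auto simp: \<sigma>_def True)
    next
      case False
      then show ?thesis using partial_map_const_None by (simp add: \<sigma>_def)
    qed
  qed
  have \<sigma>p: "join_proj ?\<pi> (\<sigma> x) = x" if x: "x \<in> topspace X" for x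
  proof -
    obtain i where i: "i \<le> n" "x \<in> U i" using U(2) x by auto
    then have "\<sigma> x i = Some (g i x)" by (simp add: \<sigma>_def)
    from join_proj_eq[OF \<sigma>car[OF x] this] show ?thesis using g(2)[OF i] by simp
  qed
  \<comment> \<open>The lift of s_X given by s_E and constant paths. The map \<tau> uses it at all n
    + 1 indices, and this is what later puts s_X(B) into every member of the new cover.\<close>
  define base where "base = (\<lambda>b. (sE b, restrict (\<lambda>t::real. sX b) {0..1}))"
  define \<tau> where "\<tau> = (\<lambda>b i. if i \<le> n then Some (base b) else None)"
  have basec: "continuous_map B ?P base"
  proof -
    have "continuous_map (cyl B) X (\<lambda>z. sX (fst z))" by (rule continuous_map_compose'[OF continuous_map_fst sX(1)])
    from continuous_map_mapping_paths[OF sE(1) this, of f pX pE]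
    show ?thesis unfolding base_def using fs sX(2) sE(2) by simp
  qed
  have bt: "base b \<in> topspace ?P" if "b \<in> topspace B" for b
    using continuous_map_funspace[OF basec] that by blast
  have bp: "?\<pi> (base b) = sX b" for b by (simp add: base_def)
  have \<tau>car: "\<tau> b \<in> join_carrier ?P ?\<pi> (Suc n)" if "b \<in> topspace B" for b
  proof -
    have "p = base b" if "\<tau> b i = Some p" for i p
      using that by (simp add: \<tau>_def split: if_splits)
    then have "p \<in> topspace ?P \<and> ?\<pi> p = sX b" if "\<tau> b i = Some p" for i p
      using that bt[OF \<open>b \<in> topspace B\<close>] bp by blast
    then show ?thesis by (intro join_carrierI[of _ _ 0]) (auto simp: \<tau>_def)
  qed
  have \<tau>c: "continuous_map B ?J \<tau>"
    unfolding continuous_map_join_iff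
  proof (intro conjI ballI allI \<tau>car)
    fix i
    show "partial_map B ?P (\<lambda>b. \<tau> b i)"
    proof (cases "i \<le> n")
      case True
      show ?thesis
        by (rule partial_mapI[of B "topspace B" _ base]) (use True basec in \<open>auto simp: \<tau>_def\<close>)
    next
      case False
      then show ?thesis using partial_map_const_None by (simp add: \<tau>_def)
    qed
  qed
  have \<tau>p: "join_proj ?\<pi> (\<tau> b) = sX b" if b: "b \<in> topspace B" for b
  proof -
    have "\<tau> b 0 = Some (base b)" by (simp add: \<tau>_def)
    from join_proj_eq[OF \<tau>car[OF b] this] show ?thesis using bp by simp
  qed
  \<comment> \<open>In this notation the fibres of the join are \<open>cube_connected r\<close>,
    that is, (r - 1)-connected, and the hypothesis on the dimension provides a CW structure on B
    with all cells of dimension below r.\<close>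
  define r where "r = Suc n * (k + 1) - 1"
  have "(enat n + 1) * (enat k + 1) - 1 = enat r"
    by (simp add: r_def one_enat_def)
  then have "cw_dim B < enat r" using assms(8) enat by simp
  then obtain m cs d \<Phi> where m: "m < r" and cw: "cw_structure B cs d \<Phi>" and dm: "\<forall>c\<in>cs. d c \<le> m"
    unfolding cw_dim_def Inf_less_iff by auto
  have con: "cube_connected r (fibre ?J (join_proj ?\<pi>) (sX b))" if b: "b \<in> topspace B" for b
    unfolding r_def
  proof (rule join_fibre_connected, rule mapping_paths_fibre_connected[OF fE fX f assms(7)])
    \<comment> \<open>The constant path at s_X(b) shows that the fibre is nonempty, which
      connectivity presupposes.\<close>
    have "base b \<in> topspace (fibre ?P ?\<pi> (sX b))" using bt[OF b] bp by (simp add: fibre_def)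
    then show "topspace (fibre ?P ?\<pi> (sX b)) \<noteq> {}" by blast
  qed
  have q: "continuous_map (cyl B) X (\<lambda>z. sX (fst z))" by (rule continuous_map_compose'[OF continuous_map_fst sX(1)])
  have con': "cube_connected r (fibre ?J (join_proj ?\<pi>) (sX (fst z)))" if "z \<in> topspace (cyl B)" for z
    using con that by auto
  have \<sigma>s: "continuous_map B ?J (\<lambda>b. \<sigma> (sX b))" by (rule continuous_map_compose'[OF sX(1) \<sigma>c])
  have \<sigma>s': "join_proj ?\<pi> (\<sigma> (sX b)) = sX (fst (b, 0::real))" if "b \<in> topspace B" for b
    using \<sigma>p[OF sXt[OF that]] by simp
  have \<tau>': "join_proj ?\<pi> (\<tau> b) = sX (fst (b, 1::real))" if "b \<in> topspace B" for b
    using \<tau>p[OF that] by simp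
  have dr: "d c < r" if "c \<in> cs" for c using dm m that by force
  \<comment> \<open>L is a homotopy over X from \<sigma> \<circ> s_X to \<tau>: it lifts the
    homotopy that rests at s_X.\<close>
  obtain L where L: "continuous_map (cyl B) ?J L"
    "\<And>b t. b \<in> topspace B \<Longrightarrow> t \<in> {0..1} \<Longrightarrow> join_proj ?\<pi> (L (b, t)) = sX (fst (b, t))"
    "\<And>b. b \<in> topspace B \<Longrightarrow> L (b, 0) = \<sigma> (sX b)" "\<And>b. b \<in> topspace B \<Longrightarrow> L (b, 1) = \<tau> b"
    using cw_lifting[OF cw fibJ, of "\<lambda>z. sX (fst z)" r "\<lambda>b. \<sigma> (sX b)" \<tau>, OF q con' \<sigma>s \<sigma>s' \<tau>c \<tau>' dr] by blast
  let ?A = "sX ` topspace B"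
  have cofp: "cofibred_pair X ?A" by (rule closed_cofibration_cofibred_pair[OF cof])
  have clA: "closedin X ?A" using cof by (simp add: closed_cofibration_def)
  have AX: "?A \<subseteq> topspace X" by (rule closedin_subset[OF clA])
  define D where "D = topspace X \<times> {0} \<union> ?A \<times> {0..1::real}"
  \<comment> \<open>On s_X(B) the projection p_X inverts s_X, so there L is a homotopy of the
    restricted section; it starts at \<sigma>, which makes the two cases agree.\<close>
  define \<zeta> where "\<zeta> = (\<lambda>z. if snd z = 0 then \<sigma> (fst z) else L (pX (fst z), snd z))"
  have \<zeta>A: "\<zeta> z = L (pX (fst z), snd z)" if "z \<in> ?A \<times> {0..1}" for z
    using that L(3) sX(2) by (auto simp: \<zeta>_def)
  have \<zeta>c: "continuous_map (subtopology (cyl X) D) ?J \<zeta>"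
  proof (rule continuous_map_glue_closed)
    have 0: "closedin (cyl X) (topspace X \<times> {0})" "closedin (cyl X) (?A \<times> {0..1})"
      using clA by (auto simp: closedin_prod_Times_iff)
    show "closedin (subtopology (cyl X) D) (topspace X \<times> {0})" "closedin (subtopology (cyl X) D) (?A \<times> {0..1})"
      by (auto intro!: closedin_subset_topspace 0 simp: D_def)
    have "continuous_map (subtopology (cyl X) (topspace X \<times> {0})) ?J (\<lambda>z. \<sigma> (fst z))"
      by (rule continuous_map_compose'[OF continuous_map_fst_sub \<sigma>c])
    then have 1: "continuous_map (subtopology (cyl X) (topspace X \<times> {0})) ?J \<zeta>"
      by (rule continuous_map_eq) (auto simp: \<zeta>_def)
    have "continuous_map (subtopology (cyl X) (?A \<times> {0..1})) ?J (\<lambda>z. L (pX (fst z), snd z))"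
      by (rule continuous_map_compose'[OF _ L(1)])
         (intro continuous_map_pairedI continuous_map_snd_sub continuous_map_compose'[OF continuous_map_fst_sub pXc])
    then have 2: "continuous_map (subtopology (cyl X) (?A \<times> {0..1})) ?J \<zeta>"
      by (rule continuous_map_eq) (auto simp: \<zeta>A)
    have s: "D \<inter> (topspace X \<times> {0}) = topspace X \<times> {0}" "D \<inter> (?A \<times> {0..1}) = ?A \<times> {0..1}"
      by (auto simp: D_def)
    show "continuous_map (subtopology (subtopology (cyl X) D) (topspace X \<times> {0})) ?J \<zeta>"
      "continuous_map (subtopology (subtopology (cyl X) D) (?A \<times> {0..1})) ?J \<zeta>"
      unfolding subtopology_subtopology s using 1 2 by auto
  qed (auto simp: D_def)
  have \<zeta>p: "join_proj ?\<pi> (\<zeta> z) = fst z" if zD: "z \<in> D" for z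
  proof (cases "snd z = 0")
    case True
    then show ?thesis using zD \<sigma>p AX by (auto simp: \<zeta>_def D_def)
  next
    case False
    then obtain b where b: "b \<in> topspace B" "fst z = sX b" "snd z \<in> {0..1}" using zD by (auto simp: D_def)
    then show ?thesis using False L(2)[OF b(1,3)] sX(2) by (simp add: \<zeta>_def)
  qed
  obtain \<Sigma> where \<Sigma>: "continuous_map (cyl X) ?J \<Sigma>" "\<And>z. z \<in> topspace (cyl X) \<Longrightarrow> join_proj ?\<pi> (\<Sigma> z) = fst z"
    "\<And>z. z \<in> D \<Longrightarrow> \<Sigma> z = \<zeta> z"
    using relative_lifting[OF fibJ cofp, of fst D \<zeta>, OF continuous_map_fst D_def \<zeta>c \<zeta>p] by blast
  \<comment> \<open>The end of the extended homotopy: again a section of the join over all of X, but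
    equal to \<tau> on s_X(B).\<close>
  define S where "S = (\<lambda>x. \<Sigma> (x, 1))"
  have Sc: "continuous_map X ?J S" unfolding S_def using continuous_map_slice[OF \<Sigma>(1), of 1] by simp
  have Scar: "S x \<in> join_carrier ?P ?\<pi> (Suc n)" if "x \<in> topspace X" for x
    using Sc that unfolding continuous_map_join_iff by blast
  have Spm: "partial_map X ?P (\<lambda>x. S x i)" for i using Sc unfolding continuous_map_join_iff by blast
  have Sp: "?\<pi> (the (S x i)) = x" if x: "x \<in> topspace X" and i: "S x i \<noteq> None" for x i
  proof -
    obtain p where p: "S x i = Some p" using i by blast
    have "join_proj ?\<pi> (S x) = ?\<pi> p" by (rule join_proj_eq[OF Scar[OF x] p])
    then show ?thesis using \<Sigma>(2)[of "(x, 1)"] x p by (simp add: S_def)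
  qed
  have SA: "S (sX b) = \<tau> b" if b: "b \<in> topspace B" for b
  proof -
    have "(sX b, 1) \<in> D" using b by (auto simp: D_def)
    then show ?thesis using \<Sigma>(3)[of "(sX b, 1)"] L(4)[OF b] sX(2)[OF b] by (simp add: S_def \<zeta>_def)
  qed
  \<comment> \<open>The new cover consists of the domains of the coordinates of S; it covers X
    because points of the join have at least one entry.\<close>
  define W where "W = (\<lambda>i. {x \<in> topspace X. S x i \<noteq> None})"
  have "n \<in> {n. \<exists>U :: nat \<Rightarrow> 'x set.
      (\<forall>i\<le>n. openin X (U i) \<and> sX ` topspace B \<subseteq> U i) \<and> topspace X \<subseteq> (\<Union>i\<le>n. U i) \<and>
      (\<forall>i\<le>n. \<exists>s. continuous_map (subtopology X (U i)) E s \<and>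
                  (\<forall>x\<in>U i. pE (s x) = pX x) \<and>
                  (\<forall>b\<in>topspace B. s (sX b) = sE b) \<and>
                  homotopic_with (\<lambda>h. (\<forall>x\<in>U i. pX (h x) = pX x) \<and>
                                      (\<forall>b\<in>topspace B. h (sX b) = sX b))
                     (subtopology X (U i)) X (f \<circ> s) id)}"
  proof (intro CollectI exI[of _ W] conjI allI impI)
    fix i assume i: "i \<le> n"
    show Wo: "openin X (W i)" unfolding W_def by (rule partial_map_dom[OF Spm])
    show AW: "?A \<subseteq> W i" using AX SA i by (auto simp: W_def \<tau>_def)
    have Wt: "topspace (subtopology X (W i)) = W i" by (auto simp: W_def)
    define h where "h = (\<lambda>x. the (S x i))"
    have hc: "continuous_map (subtopology X (W i)) ?P h"
      unfolding W_def h_def by (rule partial_map_continuous[OF Spm])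
    have ht: "h x \<in> topspace ?P" if "x \<in> W i" for x
      using continuous_map_funspace[OF hc] that Wt by blast
    note hD = mapping_pathsD[OF ht]
    have h1: "snd (h x) 1 = x" if "x \<in> W i" for x using Sp[of x i] that by (simp add: W_def h_def)
    have hA: "h (sX b) = base b" if "b \<in> topspace B" for b
      using SA[OF that] i by (simp add: h_def \<tau>_def)
    show "\<exists>s. continuous_map (subtopology X (W i)) E s \<and> (\<forall>x\<in>W i. pE (s x) = pX x) \<and>
                  (\<forall>b\<in>topspace B. s (sX b) = sE b) \<and>
                  homotopic_with (\<lambda>h. (\<forall>x\<in>W i. pX (h x) = pX x) \<and> (\<forall>b\<in>topspace B. h (sX b) = sX b))
                     (subtopology X (W i)) X (f \<circ> s) id"
    proof (intro exI conjI ballI)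
      show "continuous_map (subtopology X (W i)) E (\<lambda>x. fst (h x))"
        by (rule continuous_map_compose'[OF hc mapping_paths_fst])
      show "pE (fst (h x)) = pX x" if "x \<in> W i" for x using hD(3)[OF that, of 1] h1[OF that] by simp
      show "fst (h (sX b)) = sE b" if "b \<in> topspace B" for b using hA[OF that] by (simp add: base_def)
      show "homotopic_with (\<lambda>h. (\<forall>x\<in>W i. pX (h x) = pX x) \<and> (\<forall>b\<in>topspace B. h (sX b) = sX b))
                     (subtopology X (W i)) X (f \<circ> (\<lambda>x. fst (h x))) id"
      proof (subst homotopic_with)
        fix a c :: "'x \<Rightarrow> 'x" assume "\<And>x. x \<in> topspace (subtopology X (W i)) \<Longrightarrow> a x = c x"
        then have "\<And>x. x \<in> W i \<Longrightarrow> a x = c x" using Wt by blast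
        then show "((\<forall>x\<in>W i. pX (a x) = pX x) \<and> (\<forall>b\<in>topspace B. a (sX b) = sX b)) =
            ((\<forall>x\<in>W i. pX (c x) = pX x) \<and> (\<forall>b\<in>topspace B. c (sX b) = sX b))"
          using AW by (simp add: image_subset_iff)
      next
        \<comment> \<open>The path components of the coordinate are the required homotopy from f of
          the section to the inclusion; it rests on s_X(B), where the paths are those of
          \<open>base\<close>.\<close>
        let ?h = "\<lambda>z. snd (h (snd z)) (fst z)"
        show "\<exists>H. continuous_map (prod_topology (top_of_set {0..1::real}) (subtopology X (W i))) X H \<and>
          (\<forall>x\<in>topspace (subtopology X (W i)). H (0, x) = (f \<circ> (\<lambda>x. fst (h x))) x) \<and>
          (\<forall>x\<in>topspace (subtopology X (W i)). H (1, x) = id x) \<and>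
          (\<forall>t\<in>{0..1}. (\<forall>x\<in>W i. pX (H (t, x)) = pX x) \<and> (\<forall>b\<in>topspace B. H (t, sX b) = sX b))"
          unfolding Wt
        proof (intro exI[of _ ?h] conjI ballI)
          show "continuous_map (prod_topology (top_of_set {0..1}) (subtopology X (W i))) X ?h"
            by (rule mapping_paths_eval[OF continuous_map_compose'[OF continuous_map_snd hc] continuous_map_fst])
        next
          fix x assume "x \<in> W i"
          then show "?h (0, x) = (f \<circ> (\<lambda>x. fst (h x))) x" "?h (1, x) = id x" using hD(2) h1 by auto
        next
          fix t :: real and x assume t: "t \<in> {0..1}" and x: "x \<in> W i"
          show "pX (?h (t, x)) = pX x" using hD(3)[OF x t] hD(3)[OF x, of 1] h1[OF x] by simp
        next
          fix t :: real and b assume t: "t \<in> {0..1}" and b: "b \<in> topspace B"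
          show "?h (t, sX b) = sX b" using hA[OF b] t by (simp add: base_def)
        qed
      qed
    qed
  next
    show "topspace X \<subseteq> (\<Union>i\<le>n. W i)"
    proof
      fix x assume x: "x \<in> topspace X"
      obtain i p where "S x i = Some p" "i < Suc n" using Scar[OF x] by (rule join_carrierE)
      then have "x \<in> W i" "i \<le> n" using x by (simp_all add: W_def)
      then show "x \<in> (\<Union>i\<le>n. W i)" by blast
    qed
  qed
  then have "secat_B_pointed B E X pE sE pX sX f \<le> enat n"
    unfolding secat_B_pointed_def by (intro Inf_lower imageI)
  then show ?thesis using secat_le_pointed[of E X pE pX f B sE sX] enat by simp
qed

end
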